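(* Let $R=k[x_1,\ldots,x_d]$ be a polynomial ring over an infinite field $k$, and let $I\neq0$ be a $0$-dimensional monomial ideal that has a reduction $J$ generated by a regular sequence of monomials. (a) Let $H$ be an ideal integral over $I$ (that is, $I\subset H\subset\overline I$) with the same core as $I$. If $H$ and $I$ are generated by forms of the same degree or if $\mathrm{char}\,k=0$, then $\omega_{R[Ht,t^{-1}]}=\omega_{R[It,t^{-1}]}$. (b) If $\mathrm{char}\,k=0$, then the ideal $\check I$ is the largest ideal integral over $I$ with the same core as $I$.
   Context: A monomial ideal is an ideal generated by monomials; $I$ is $0$-dimensional if $\dim R/I=0$. A subideal $J$ of an ideal $I$ is a reduction of $I$ if $I^{r+1}=JI^r$ for some integer $r\ge0$; $\mathrm{core}(I)$ is the intersection of all reductions of $I$. $\overline I$ is the integral closure of $I$. Let $t$ be an indeterminate and let $g=\mathrm{ht}\,I$ (here $g=d$). Put $A=R[Jt,t^{-1}]\subset R[t,t^{-1}]$, graded with $\deg t=1$, and $\omega_A=At^{g-1}\subset R[t,t^{-1}]$. For an ideal $H$ with $I\subset H\subset\overline I$ (so that $J$ is a reduction of $H$), including $H=I$, set $\omega_{R[Ht,t^{-1}]}=\omega_A:_{R[t,t^{-1}]}R[Ht,t^{-1}]$, a graded canonical module of $R[Ht,t^{-1}]$; the equality in (a) is one of submodules of $R[t,t^{-1}]$. With $B=R[It,t^{-1}]$, set $D=\omega_B:_{R[t,t^{-1}]}\omega_B=A:_{R[t,t^{-1}]}(A:_{R[t,t^{-1}]}B)$. Then $\check I$ is the $R$-ideal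 with $[D]_1=\check I\,t$, where $[D]_1$ is the degree-one component of $D$. *)

theory Defs
  imports
    "HOL-Algebra.Algebraic_Closure_Type"
    "HOL-Algebra.Ideal_Product"
    "HOL-Algebra.Generated_Rings"
    "HOL-Algebra.QuotRing"
    "HOL-Library.Poly_Mapping"
    "HOL-Library.Extended_Real"
    "HOL-Library.Cardinality"
begin

section \<open>Ideals of a commutative ring\<close>

text \<open>Powers of ideals are taken in the monoid \<^const>\<open>ideals_set\<close> of ideals of \<open>R\<close>: its
  multiplication is \<^const>\<open>ideal_prod\<close> and its unit is the unit ideal.\<close>

abbreviation ideal_power :: "('a, 'b) ring_scheme \<Rightarrow> 'a set \<Rightarrow> nat \<Rightarrow> 'a set" where
  "ideal_power R I n \<equiv> I [^]\<^bsub>ideals_set R\<^esub> n"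

definition is_reduction :: "('a, 'b) ring_scheme \<Rightarrow> 'a set \<Rightarrow> 'a set \<Rightarrow> bool" where
  "is_reduction R J I \<longleftrightarrow> ideal J R \<and> J \<subseteq> I \<and>
     (\<exists>r. ideal_power R I (r + 1) = ideal_prod R J (ideal_power R I r))"

definition core :: "('a, 'b) ring_scheme \<Rightarrow> 'a set \<Rightarrow> 'a set" where
  "core R I = \<Inter> {J. is_reduction R J I}"

text \<open>Elements satisfying \<open>x\<^sup>n + a\<^sub>1 x\<^sup>n\<^sup>-\<^sup>1 + \<dots> + a\<^sub>n = 0\<close> for some \<open>n \<ge> 1\<close> and \<open>a\<^sub>i \<in> I\<^sup>i\<close>.\<close>

definition integral_closure :: "('a, 'b) ring_scheme \<Rightarrow> 'a set \<Rightarrow> 'a set" where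
  "integral_closure R I = {x \<in> carrier R. \<exists>(n::nat) a. n \<ge> 1 \<and>
     (\<forall>i\<in>{1..n}. a i \<in> ideal_power R I i) \<and>
     x [^]\<^bsub>R\<^esub> n \<oplus>\<^bsub>R\<^esub> (\<Oplus>\<^bsub>R\<^esub>i\<in>{1..n}. a i \<otimes>\<^bsub>R\<^esub> x [^]\<^bsub>R\<^esub> (n - i)) = \<zero>\<^bsub>R\<^esub>}"

definition integral_over :: "('a, 'b) ring_scheme \<Rightarrow> 'a set \<Rightarrow> 'a set \<Rightarrow> bool" where
  "integral_over R H I \<longleftrightarrow> ideal H R \<and> I \<subseteq> H \<and> H \<subseteq> integral_closure R I"

definition regular_sequence :: "('a, 'b) ring_scheme \<Rightarrow> 'a list \<Rightarrow> bool" where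
  "regular_sequence R fs \<longleftrightarrow> set fs \<subseteq> carrier R \<and>
     (\<forall>i<length fs. \<forall>a\<in>carrier R.
        fs ! i \<otimes>\<^bsub>R\<^esub> a \<in> Idl\<^bsub>R\<^esub> (set (take i fs)) \<longrightarrow> a \<in> Idl\<^bsub>R\<^esub> (set (take i fs))) \<and>
     Idl\<^bsub>R\<^esub> (set fs) \<noteq> carrier R"

text \<open>Supremum of the lengths of chains of prime ideals. It is taken in \<^typ>\<open>ereal\<close>, so that
  the zero ring has dimension \<open>-\<infinity>\<close> rather than \<open>0\<close>.\<close>

definition krull_dim :: "('a, 'b) ring_scheme \<Rightarrow> ereal" where
  "krull_dim R = (SUP n \<in> {n. \<exists>P :: nat \<Rightarrow> 'a set.
     (\<forall>i\<le>n. primeideal (P i) R) \<and> (\<forall>i<n. P i \<subset> P (Suc i))}. ereal (real n))"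


section \<open>Polynomials\<close>

text \<open>\<open>('v, 'k) mpoly\<close> is the polynomial ring over \<open>'k\<close> in indeterminates indexed by the
  finite type \<open>'v\<close>; a monomial is given by its exponent vector \<open>'v \<Rightarrow>\<^sub>0 nat\<close>. Via
  \<^const>\<open>ring_of_type_algebra\<close> the ring is seen as an object of HOL-Algebra.\<close>

type_synonym ('v, 'k) mpoly = "('v \<Rightarrow>\<^sub>0 nat) \<Rightarrow>\<^sub>0 'k"

abbreviation mpoly_ring :: "('v::finite, 'k::field) mpoly ring" where
  "mpoly_ring \<equiv> ring_of_type_algebra"

definition monomials :: "('v::finite, 'k::field) mpoly set" where
  "monomials = range (\<lambda>m. Poly_Mapping.single m 1)"

definition monomial_ideal :: "('v::finite, 'k::field) mpoly set \<Rightarrow> bool" where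
  "monomial_ideal I \<longleftrightarrow> (\<exists>M \<subseteq> monomials. I = Idl\<^bsub>mpoly_ring\<^esub> M)"

definition is_form :: "nat \<Rightarrow> ('v::finite, 'k::field) mpoly \<Rightarrow> bool" where
  "is_form n f \<longleftrightarrow> (\<forall>m \<in> Poly_Mapping.keys f. (\<Sum>v\<in>UNIV. Poly_Mapping.lookup m v) = n)"

definition generated_by_forms :: "nat \<Rightarrow> ('v::finite, 'k::field) mpoly set \<Rightarrow> bool" where
  "generated_by_forms n I \<longleftrightarrow> (\<exists>F. (\<forall>f\<in>F. is_form n f) \<and> I = Idl\<^bsub>mpoly_ring\<^esub> F)"


section \<open>Extended Rees algebras and canonical modules\<close>

text \<open>The Laurent polynomial ring \<open>R[t,t\<^sup>-\<^sup>1]\<close> is \<open>int \<Rightarrow>\<^sub>0 'r\<close>, where \<open>Poly_Mapping.single n f\<close>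
  is \<open>f t\<^sup>n\<close>.\<close>

text \<open>\<open>R[Ht,t\<^sup>-\<^sup>1]\<close>, the subring of \<open>R[t,t\<^sup>-\<^sup>1]\<close> generated by \<open>R\<close>, \<open>Ht\<close> and \<open>t\<^sup>-\<^sup>1\<close>.\<close>

definition ext_rees :: "'r::comm_ring_1 set \<Rightarrow> (int \<Rightarrow>\<^sub>0 'r) set" where
  "ext_rees H = generate_ring ring_of_type_algebra
     (range (Poly_Mapping.single 0) \<union> Poly_Mapping.single 1 ` H \<union> {Poly_Mapping.single (-1) 1})"

definition colon :: "'a::comm_ring_1 set \<Rightarrow> 'a set \<Rightarrow> 'a set" where
  "colon M N = {z. \<forall>y\<in>N. z * y \<in> M}"

text \<open>\<open>\<omega>\<^sub>A = A t\<^sup>g\<^sup>-\<^sup>1\<close> for \<open>A = R[Jt,t\<^sup>-\<^sup>1]\<close>; the height \<open>g\<close> of the \<open>0\<close>-dimensional ideal is the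
  number of indeterminates.\<close>

definition omega_base :: "('v::finite, 'k::field) mpoly set \<Rightarrow> (int \<Rightarrow>\<^sub>0 ('v, 'k) mpoly) set" where
  "omega_base J = (\<lambda>a. a * Poly_Mapping.single (int CARD('v) - 1) 1) ` ext_rees J"

text \<open>\<open>omega_rees J H\<close> is \<open>\<omega>\<close> of \<open>R[Ht,t\<^sup>-\<^sup>1]\<close>, formed with respect to the reduction \<open>J\<close>.\<close>

definition omega_rees ::
    "('v::finite, 'k::field) mpoly set \<Rightarrow> ('v, 'k) mpoly set \<Rightarrow> (int \<Rightarrow>\<^sub>0 ('v, 'k) mpoly) set" where
  "omega_rees J H = colon (omega_base J) (ext_rees H)"

definition check_ideal ::
    "('v::finite, 'k::field) mpoly set \<Rightarrow> ('v, 'k) mpoly set \<Rightarrow> ('v, 'k) mpoly set" where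
  "check_ideal J I =
     {f. Poly_Mapping.single 1 f \<in> colon (omega_rees J I) (omega_rees J I)}"

end

theory Submission
  imports Defs "Jordan_Normal_Form.Determinant" "HOL-Analysis.Poly_Roots"
begin

text \<open>Zero-dimensionality and regularity force \<open>J\<close> to be generated by pure powers
  \<open>y\<^sub>v = x\<^sub>v\<^sup>a\<close>, so \<open>J\<^sup>n\<close> is described by the order function
  \<open>ord m = \<Sum>\<^sub>v \<lfloor>m\<^sub>v / a\<^sub>v\<rfloor>\<close>. Let \<open>W H n\<close> be the degree-\<open>n\<close> part of the canonical
  module of \<open>R[Ht,t\<^sup>-\<^sup>1]\<close>. For monomial \<open>I\<close> and \<open>n \<ge> d\<close> it satisfies
  \<open>W I n \<subseteq> J (W I (n - 1))\<close>, hence it is governed by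
  \<open>W I d = {f. \<forall>m. f I\<^sup>m \<subseteq> J\<^sup>m\<^sup>+\<^sup>1}\<close>, which has to be compared with the core.

  Lower bound: \<open>W I d\<close> lies in every reduction \<open>K\<close> of \<open>I\<close>. High powers of the \<open>y\<^sub>v\<close> are
  exchanged one at a time for general elements \<open>z\<close> of \<open>K\<close>: modulo the remaining generators
  and elements of high weight, such a power is \<open>z c\<close> with \<open>c\<close> in a power of \<open>I\<close>. The
  product of these \<open>c\<close> multiplies \<open>W I d\<close> into the ideal of the powers, and dividing them out
  again leaves the ideal of the \<open>z\<close>.

  Upper bound: if \<open>g\<close> lies in the core of \<open>H\<close> and \<open>h \<in> H\<close>, then \<open>g h\<^sup>i \<in> J\<^sup>i\<^sup>+\<^sup>1\<close>. For almost
  all scalars \<open>l\<close>, the element \<open>y + l h\<close> together with \<open>d - 1\<close> linear forms in the \<open>y\<^sub>v\<close>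
  generates a reduction of \<open>H\<close> up to a high power of \<open>J\<close>; comparing the coefficients of \<open>l\<close>
  by a Vandermonde argument bounds \<open>g h\<^sup>i\<close>.

  In characteristic zero, polarising the upper bound puts the core of \<open>H\<close> into \<open>W H d\<close>. For forms
  of one degree \<open>n\<close> all \<open>a\<^sub>v\<close> equal \<open>n\<close>, and monomials of the core separate \<open>I\<close> from any
  generator of \<open>H\<close> whose exponents are new modulo \<open>n\<close>.\<close>

section \<open>The semiring of ideals of a commutative ring\<close>

text \<open>The argument is natural in the local ring at the origin, where error terms of high order
  can be ignored. The polynomial ring is kept here, and the weight filtration \<open>F\<close>
  measures the errors instead: every reduction of \<open>I\<close> contains some \<open>F n\<close>,
  so equalities and regularity are needed only up to \<open>F n\<close>. The weights are scaled so
  that all \<open>y v\<close> have the same weight \<open>L\<close>; then the powers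
  \<open>I ^ m\<close> modulo their terms of weight above \<open>m * L\<close> form a quotient of
  the special fibre ring with finite-dimensional components, and general elements can be found there
  by elimination over the field.

  The two bounds are not symmetric. The lower bound uses that \<open>I\<close> is generated by
  monomials, while an arbitrary reduction \<open>K\<close> is not, so nothing about \<open>K\<close>
  can be read off from exponents. The upper bound holds for every \<open>H\<close> having
  \<open>J\<close> as a reduction. For (a) this is enough, since an arbitrary \<open>H\<close>
  enters only through the upper bound; for (b) the lower bound is also applied to
  \<open>check_idl\<close>, which is why that ideal must be shown to be monomial.\<close>

definition ideal_set :: "'a::comm_ring_1 set \<Rightarrow> bool" where
  "ideal_set I \<longleftrightarrow> 0 \<in> I \<and> (\<forall>a\<in>I. \<forall>b\<in>I. a + b \<in> I) \<and> (\<forall>r. \<forall>a\<in>I. r * a \<in> I)"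

text \<open>As a type, ideals form a commutative semiring with an order, so that
  \<open>binomial_ring\<close>, finite sums and monotonicity rules apply to them verbatim.\<close>

typedef (overloaded) 'a idl = "{I :: 'a::comm_ring_1 set. ideal_set I}"
  morphisms elts Idl_of
  by (rule exI[of _ UNIV]) (simp add: ideal_set_def)

setup_lifting type_definition_idl

definition mem :: "'a::comm_ring_1 \<Rightarrow> 'a idl \<Rightarrow> bool" (infix "\<in>\<^sub>i" 50) where
  "x \<in>\<^sub>i I \<longleftrightarrow> x \<in> elts I"

lemma ideal_set_elts: "ideal_set (elts I)"
  using elts by auto

lemma mem_zero [simp, intro]: "0 \<in>\<^sub>i I"
  and mem_add [intro]: "a \<in>\<^sub>i I \<Longrightarrow> b \<in>\<^sub>i I \<Longrightarrow> a + b \<in>\<^sub>i I"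
  and mem_mult_left [intro]: "a \<in>\<^sub>i I \<Longrightarrow> r * a \<in>\<^sub>i I"
  using ideal_set_elts[of I] by (auto simp: mem_def ideal_set_def)

lemma mem_mult_right [intro]: "a \<in>\<^sub>i I \<Longrightarrow> a * r \<in>\<^sub>i I"
  using mem_mult_left[of a I r] by (simp add: mult.commute)

lemma mem_uminus [intro]: "a \<in>\<^sub>i I \<Longrightarrow> - a \<in>\<^sub>i I"
  using mem_mult_left[of a I "-1"] by simp

lemma mem_diff [intro]: "a \<in>\<^sub>i I \<Longrightarrow> b \<in>\<^sub>i I \<Longrightarrow> a - b \<in>\<^sub>i I"
  using mem_add[of a I "- b"] by auto

lemma mem_sum [intro]: "(\<And>x. x \<in> S \<Longrightarrow> f x \<in>\<^sub>i I) \<Longrightarrow> sum f S \<in>\<^sub>i I"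
  by (induction S rule: infinite_finite_induct) auto

lemma idl_eqI: "(\<And>x. x \<in>\<^sub>i I \<longleftrightarrow> x \<in>\<^sub>i J) \<Longrightarrow> I = J"
  by (metis elts_inject mem_def subsetI subset_antisym)

lemma mem_Idl_of: "ideal_set S \<Longrightarrow> x \<in>\<^sub>i Idl_of S \<longleftrightarrow> x \<in> S"
  by (simp add: mem_def Idl_of_inverse)

definition gen :: "'a::comm_ring_1 set \<Rightarrow> 'a idl" where
  "gen S = Idl_of (\<Inter>{I. ideal_set I \<and> S \<subseteq> I})"

lemma mem_gen: "x \<in>\<^sub>i gen S \<longleftrightarrow> (\<forall>I. ideal_set I \<longrightarrow> S \<subseteq> I \<longrightarrow> x \<in> I)"
  unfolding gen_def by (subst mem_Idl_of) (auto simp: ideal_set_def)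

lemma gen_mem [intro]: "x \<in> S \<Longrightarrow> x \<in>\<^sub>i gen S"
  by (auto simp: mem_gen)

lemma gen_induct [consumes 1, case_names zero base add mult]:
  assumes "x \<in>\<^sub>i gen S" "P 0" "\<And>s. s \<in> S \<Longrightarrow> P s" "\<And>a b. P a \<Longrightarrow> P b \<Longrightarrow> P (a + b)"
    "\<And>r a. P a \<Longrightarrow> P (r * a)"
  shows "P x"
  using assms(1)[unfolded mem_gen, rule_format, of "Collect P"] assms(2-)
  by (auto simp: ideal_set_def)

instantiation idl :: (comm_ring_1) comm_semiring_1
begin

lift_definition zero_idl :: "'a idl" is "{0}" by (simp add: ideal_set_def)
lift_definition one_idl :: "'a idl" is "UNIV" by (simp add: ideal_set_def)
lift_definition plus_idl :: "'a idl \<Rightarrow> 'a idl \<Rightarrow> 'a idl" is "\<lambda>I J. {a + b | a b. a \<in> I \<and> b \<in> J}"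
proof -
  fix I J :: "'a set" assume I: "ideal_set I" and J: "ideal_set J"
  show "ideal_set {a + b | a b. a \<in> I \<and> b \<in> J}" (is "ideal_set ?S")
    unfolding ideal_set_def
  proof (intro conjI ballI allI)
    show "0 \<in> ?S"
      using I J unfolding ideal_set_def by (metis (mono_tags, lifting) add_0 mem_Collect_eq)
  next
    fix x y assume "x \<in> ?S" "y \<in> ?S"
    then obtain a b c d where "x = a + b" "y = c + d" "a \<in> I" "b \<in> J" "c \<in> I" "d \<in> J" by blast
    then have "x + y = (a + c) + (b + d)" "a + c \<in> I" "b + d \<in> J"
      using I J unfolding ideal_set_def by auto
    then show "x + y \<in> ?S" by blast
  next
    fix r x assume "x \<in> ?S"
    then obtain a b where "x = a + b" "a \<in> I" "b \<in> J" by blast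
    then have "r * x = r * a + r * b" "r * a \<in> I" "r * b \<in> J"
      using I J unfolding ideal_set_def by (auto simp: distrib_left)
    then show "r * x \<in> ?S" by blast
  qed
qed
definition times_idl :: "'a idl \<Rightarrow> 'a idl \<Rightarrow> 'a idl" where
  "times_idl I J = gen {a * b | a b. a \<in>\<^sub>i I \<and> b \<in>\<^sub>i J}"

lemma mem_0: "x \<in>\<^sub>i 0 \<longleftrightarrow> x = 0"
  unfolding mem_def by transfer simp
lemma mem_1: "x \<in>\<^sub>i 1"
  unfolding mem_def by transfer simp
lemma mem_plus: "x \<in>\<^sub>i I + J \<longleftrightarrow> (\<exists>a b. x = a + b \<and> a \<in>\<^sub>i I \<and> b \<in>\<^sub>i J)"
  unfolding mem_def by transfer simp
lemma mem_times: "a \<in>\<^sub>i I \<Longrightarrow> b \<in>\<^sub>i J \<Longrightarrow> a * b \<in>\<^sub>i I * J"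
  unfolding times_idl_def by blast
lemma times_induct [consumes 1, case_names prod add]:
  assumes "x \<in>\<^sub>i I * J" "\<And>a b. a \<in>\<^sub>i I \<Longrightarrow> b \<in>\<^sub>i J \<Longrightarrow> P (a * b)"
    "\<And>a b. a \<in>\<^sub>i I * J \<Longrightarrow> b \<in>\<^sub>i I * J \<Longrightarrow> P a \<Longrightarrow> P b \<Longrightarrow> P (a + b)"
  shows "P x"
proof -
  \<comment> \<open>\<open>gen_induct\<close> multiplies by ring elements, but \<open>P\<close> is
    assumed closed only under products and sums; hence all multiples of \<open>x\<close> enter the
    induction predicate.\<close>
  have "x \<in>\<^sub>i I * J \<and> (\<forall>r. P (r * x))"
    using assms(1) unfolding times_idl_def[of I J]
  proof (induction rule: gen_induct)
    case zero
    show ?case using assms(2)[of 0 0] by simp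
  next
    case (base s)
    then obtain a b where s: "s = a * b" "a \<in>\<^sub>i I" "b \<in>\<^sub>i J" by blast
    have "P (r * s)" for r
      using assms(2)[OF mem_mult_left[OF s(2)] s(3)] s(1) by (simp add: mult.assoc)
    then show ?case using base by blast
  next
    case (add a b)
    have "P (r * (a + b))" for r
      unfolding distrib_left
      by (rule assms(3)) (use add in \<open>simp_all add: mem_mult_left times_idl_def\<close>)
    then show ?case using add by blast
  next
    case (mult r a)
    have "P (r' * (r * a))" for r'
      using mult by (simp flip: mult.assoc)
    then show ?case using mult by blast
  qed
  then have "P (1 * x)" by blast
  then show ?thesis by simp
qed

instance
proof
  fix A B C :: "'a idl"
  show "A + B + C = A + (B + C)"
  proof (rule idl_eqI)
    fix x
    have "x \<in>\<^sub>i A + B + C \<longleftrightarrow> (\<exists>a b c. x = (a + b) + c \<and> a \<in>\<^sub>i A \<and> b \<in>\<^sub>i B \<and> c \<in>\<^sub>i C)"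
      unfolding mem_plus by blast
    also have "\<dots> \<longleftrightarrow> (\<exists>a b c. x = a + (b + c) \<and> a \<in>\<^sub>i A \<and> b \<in>\<^sub>i B \<and> c \<in>\<^sub>i C)"
      by (simp only: add.assoc)
    also have "\<dots> \<longleftrightarrow> x \<in>\<^sub>i A + (B + C)"
      unfolding mem_plus by blast
    finally show "x \<in>\<^sub>i A + B + C \<longleftrightarrow> x \<in>\<^sub>i A + (B + C)" .
  qed
  show "A + B = B + A"
  proof (rule idl_eqI)
    fix x
    show "x \<in>\<^sub>i A + B \<longleftrightarrow> x \<in>\<^sub>i B + A"
      unfolding mem_plus by (subst add.commute) blast
  qed
  show "0 + A = A"
    by (rule idl_eqI) (simp add: mem_plus mem_0)
  have comm: "A * B = B * A" for A B :: "'a idl"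
    unfolding times_idl_def by (subst mult.commute, rule arg_cong[of _ _ gen]) blast
  then show "A * B = B * A" .
  have assoc: "x \<in>\<^sub>i A * B * C \<Longrightarrow> x \<in>\<^sub>i A * (B * C)" for A B C :: "'a idl" and x
  proof (induction rule: times_induct)
    case (prod a b)
    from prod(1) show ?case
      by (induction rule: times_induct) (auto simp: prod mult.assoc distrib_right mem_times)
  qed blast
  show "A * B * C = A * (B * C)"
  proof (rule idl_eqI, rule iffI)
    fix x assume "x \<in>\<^sub>i A * (B * C)"
    then show "x \<in>\<^sub>i A * B * C"
      using assoc[of x C B A] by (metis comm)
  qed (rule assoc)
  show "1 * A = A"
  proof (rule idl_eqI, rule iffI)
    fix x assume "x \<in>\<^sub>i 1 * A" then show "x \<in>\<^sub>i A"
      by (induction rule: times_induct) auto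
  next
    fix x assume "x \<in>\<^sub>i A" then show "x \<in>\<^sub>i 1 * A"
      using mem_times[of 1 1 x A] by (simp add: mem_1)
  qed
  show "(A + B) * C = A * C + B * C"
  proof (rule idl_eqI, rule iffI)
    fix x assume "x \<in>\<^sub>i (A + B) * C" then show "x \<in>\<^sub>i A * C + B * C"
    proof (induction rule: times_induct)
      case (prod a b)
      then obtain u v where "a = u + v" "u \<in>\<^sub>i A" "v \<in>\<^sub>i B" unfolding mem_plus by blast
      then show ?case
        unfolding mem_plus using prod by (metis distrib_right mem_times)
    qed blast
  next
    fix x assume "x \<in>\<^sub>i A * C + B * C"
    then obtain a b where x: "x = a + b" "a \<in>\<^sub>i A * C" "b \<in>\<^sub>i B * C" unfolding mem_plus by blast
    have "a \<in>\<^sub>i (A + B) * C" using x(2)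
    proof (induction rule: times_induct)
      case (prod u v)
      have "u \<in>\<^sub>i A + B" unfolding mem_plus by (intro exI[of _ u] exI[of _ 0]) (simp add: prod)
      then show ?case using prod by (simp add: mem_times)
    qed blast
    moreover have "b \<in>\<^sub>i (A + B) * C" using x(3)
    proof (induction rule: times_induct)
      case (prod u v)
      have "u \<in>\<^sub>i A + B" unfolding mem_plus by (intro exI[of _ 0] exI[of _ u]) (simp add: prod)
      then show ?case using prod by (simp add: mem_times)
    qed blast
    ultimately show "x \<in>\<^sub>i (A + B) * C" using x by auto
  qed
  show "0 * A = 0"
  proof (rule idl_eqI, rule iffI)
    fix x assume "x \<in>\<^sub>i 0 * A" then show "x \<in>\<^sub>i 0"
      by (induction rule: times_induct) (auto simp: mem_0)
  qed (auto simp: mem_0)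
  show "A * 0 = 0"
  proof (rule idl_eqI, rule iffI)
    fix x assume "x \<in>\<^sub>i A * 0" then show "x \<in>\<^sub>i 0"
      by (induction rule: times_induct) (auto simp: mem_0)
  qed (auto simp: mem_0)
  show "(0::'a idl) \<noteq> 1"
    using mem_0[of "1::'a"] mem_1[of "1::'a"] by auto
qed

end

declare mem_0 [simp] mem_1 [simp]

instantiation idl :: (comm_ring_1) "{semilattice_inf, canonically_ordered_monoid_add, ordered_comm_semiring}"
begin

lift_definition less_eq_idl :: "'a idl \<Rightarrow> 'a idl \<Rightarrow> bool" is "(\<subseteq>)" .
lift_definition less_idl :: "'a idl \<Rightarrow> 'a idl \<Rightarrow> bool" is "(\<subset>)" .
lift_definition inf_idl :: "'a idl \<Rightarrow> 'a idl \<Rightarrow> 'a idl" is "(\<inter>)" by (auto simp: ideal_set_def)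

lemma le_idl: "I \<le> J \<longleftrightarrow> (\<forall>x. x \<in>\<^sub>i I \<longrightarrow> x \<in>\<^sub>i J)"
  unfolding mem_def by transfer auto

lemma mem_inf: "x \<in>\<^sub>i inf I J \<longleftrightarrow> x \<in>\<^sub>i I \<and> x \<in>\<^sub>i J"
  unfolding mem_def by transfer auto

instance
proof
  fix A B C D :: "'a idl"
  show "A < B \<longleftrightarrow> A \<le> B \<and> \<not> B \<le> A" by transfer auto
  show "A \<le> A" by transfer auto
  show "A \<le> B \<Longrightarrow> B \<le> C \<Longrightarrow> A \<le> C" by transfer auto
  show "A \<le> B \<Longrightarrow> B \<le> A \<Longrightarrow> A = B" by transfer auto
  show "inf A B \<le> A" "inf A B \<le> B" by (transfer; auto)+
  show "A \<le> B \<Longrightarrow> A \<le> C \<Longrightarrow> A \<le> inf B C" by transfer auto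
  show "A \<le> B \<longleftrightarrow> (\<exists>C. B = A + C)"
  proof
    assume le: "A \<le> B"
    have "B = A + B"
    proof (rule idl_eqI, rule iffI)
      fix x assume "x \<in>\<^sub>i B" then show "x \<in>\<^sub>i A + B"
        unfolding mem_plus by (intro exI[of _ 0] exI[of _ x]) simp
    next
      fix x assume "x \<in>\<^sub>i A + B" then show "x \<in>\<^sub>i B"
        using le by (auto simp: mem_plus le_idl)
    qed
    then show "\<exists>C. B = A + C" ..
  next
    assume "\<exists>C. B = A + C"
    then show "A \<le> B" by (metis add.right_neutral le_idl mem_plus mem_zero)
  qed
  show "A \<le> B \<Longrightarrow> C + A \<le> C + B" by (auto simp: le_idl mem_plus)
  show "A \<le> B \<Longrightarrow> C * A \<le> C * B"
  proof -
    assume le: "A \<le> B"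
    have "x \<in>\<^sub>i C * A \<Longrightarrow> x \<in>\<^sub>i C * B" for x
      by (induction rule: times_induct) (use le in \<open>auto simp: le_idl intro: mem_times\<close>)
    then show "C * A \<le> C * B" by (simp add: le_idl)
  qed
qed

end

lemma memD: "x \<in>\<^sub>i I \<Longrightarrow> I \<le> J \<Longrightarrow> x \<in>\<^sub>i J"
  by (simp add: le_idl)

lemma idl_le_add1 [simp]: "I \<le> I + J" and idl_le_add2 [simp]: "I \<le> J + I" for I J :: "'a::comm_ring_1 idl"
  by (metis le_iff_add, metis le_iff_add add.commute)

lemma mem_addI1: "x \<in>\<^sub>i I \<Longrightarrow> x \<in>\<^sub>i I + J" and mem_addI2: "x \<in>\<^sub>i J \<Longrightarrow> x \<in>\<^sub>i I + J"
  by (auto elim: memD)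

lemma idl_add_le [simp]: "I + J \<le> K \<longleftrightarrow> I \<le> K \<and> J \<le> K" for I J K :: "'a::comm_ring_1 idl"
proof
  show "I + J \<le> K" if "I \<le> K \<and> J \<le> K"
    using that by (auto simp: le_idl mem_plus)
qed (use order_trans[OF idl_le_add1] order_trans[OF idl_le_add2] in blast)

lemma idl_add_idem [simp]: "I + I = I" for I :: "'a::comm_ring_1 idl"
  by (rule antisym) simp_all

lemma idl_le_1 [simp]: "I \<le> 1" for I :: "'a::comm_ring_1 idl"
  by (simp add: le_idl)

lemma idl_mult_mono: "A \<le> B \<Longrightarrow> C \<le> D \<Longrightarrow> A * C \<le> B * D" for A B C D :: "'a::comm_ring_1 idl"
  by (rule mult_mono) auto

lemma idl_mult_le1: "A \<le> C \<Longrightarrow> A * B \<le> C" for A B C :: "'a::comm_ring_1 idl"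
  using idl_mult_mono[of A C B 1] by simp

lemma idl_mult_le2: "B \<le> C \<Longrightarrow> A * B \<le> C" for A B C :: "'a::comm_ring_1 idl"
  using idl_mult_mono[of A 1 B C] by simp

lemma idl_power_mono: "A \<le> B \<Longrightarrow> A ^ n \<le> B ^ n" for A B :: "'a::comm_ring_1 idl"
  by (induction n) (auto intro: idl_mult_mono)

lemma idl_power_anti: "m \<le> n \<Longrightarrow> A ^ n \<le> A ^ m" for A :: "'a::comm_ring_1 idl"
  by (metis idl_mult_le1 le_add_diff_inverse order_refl power_add)

lemma mem_power: "x \<in>\<^sub>i A \<Longrightarrow> x ^ n \<in>\<^sub>i A ^ n"
  by (induction n) (auto intro: mem_times)

lemma idl_times_le_iff: "I * J \<le> K \<longleftrightarrow> (\<forall>a b. a \<in>\<^sub>i I \<longrightarrow> b \<in>\<^sub>i J \<longrightarrow> a * b \<in>\<^sub>i K)"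
proof
  assume *: "\<forall>a b. a \<in>\<^sub>i I \<longrightarrow> b \<in>\<^sub>i J \<longrightarrow> a * b \<in>\<^sub>i K"
  have "x \<in>\<^sub>i I * J \<Longrightarrow> x \<in>\<^sub>i K" for x
    by (induction rule: times_induct) (use * in auto)
  then show "I * J \<le> K" by (simp add: le_idl)
qed (auto intro: memD mem_times)

definition pr :: "'a::comm_ring_1 \<Rightarrow> 'a idl" where
  "pr a = gen {a}"

lemma gen_le_iff: "gen S \<le> I \<longleftrightarrow> (\<forall>x\<in>S. x \<in>\<^sub>i I)"
proof
  assume *: "\<forall>x\<in>S. x \<in>\<^sub>i I"
  have "x \<in>\<^sub>i gen S \<Longrightarrow> x \<in>\<^sub>i I" for x
    by (induction rule: gen_induct) (use * in auto)
  then show "gen S \<le> I" by (simp add: le_idl)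
qed (auto simp: le_idl)

lemma pr_le_iff [simp]: "pr a \<le> I \<longleftrightarrow> a \<in>\<^sub>i I"
  by (simp add: pr_def gen_le_iff)

lemma mem_pr_self [simp, intro]: "a \<in>\<^sub>i pr a"
  by (auto simp: pr_def)

lemma mem_pr_mult: "x \<in>\<^sub>i pr a * I \<longleftrightarrow> (\<exists>y. y \<in>\<^sub>i I \<and> x = a * y)"
proof
  have pr: "x \<in>\<^sub>i pr a \<Longrightarrow> \<exists>r. x = a * r" for x
    unfolding pr_def
  proof (induction rule: gen_induct)
    case zero then show ?case by (metis mult_zero_right)
  next
    case (base s) then show ?case by (metis mult.right_neutral singletonD)
  next
    case (add x y) then show ?case by (metis distrib_left)
  next
    case (mult r x) then show ?case by (metis mult.left_commute)
  qed
  assume "x \<in>\<^sub>i pr a * I"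
  then show "\<exists>y. y \<in>\<^sub>i I \<and> x = a * y"
  proof (induction rule: times_induct)
    case (prod u v)
    then show ?case using pr by (metis mem_mult_left mult.assoc)
  next
    case (add u v)
    then show ?case by (metis distrib_left mem_add)
  qed
qed (auto intro: mem_times)

lemma mem_pr: "x \<in>\<^sub>i pr a \<longleftrightarrow> (\<exists>r. x = a * r)"
  using mem_pr_mult[of x a 1] by simp

lemma pr_mult: "pr a * pr b = pr (a * b)"
  by (rule idl_eqI) (auto simp: mem_pr_mult mem_pr mult.assoc)

lemma pr_power: "pr a ^ n = pr (a ^ n)"
proof (induction n)
  case 0
  have "pr 1 = (1 :: 'a idl)" by (rule idl_eqI) (simp add: mem_pr)
  then show ?case by simp
qed (simp add: pr_mult)

lemma gen_insert: "gen (insert a S) = pr a + gen S"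
  by (rule antisym) (auto simp: gen_le_iff intro: mem_addI1 mem_addI2)

lemma gen_empty [simp]: "gen {} = 0"
  using gen_le_iff[of "{}" 0] by simp

lemma gen_image_finite: "finite S \<Longrightarrow> gen (f ` S) = (\<Sum>x\<in>S. pr (f x))"
proof (induction S rule: finite_induct)
  case (insert a S)
  then show ?case by (simp add: gen_insert)
qed simp

lemma mem_sum_idl: "finite S \<Longrightarrow> i \<in> S \<Longrightarrow> A i \<le> (\<Sum>x\<in>S. A x)" for A :: "'b \<Rightarrow> 'a::comm_ring_1 idl"
  by (simp add: sum.remove)

lemma sum_idl_le_iff: "finite S \<Longrightarrow> (\<Sum>x\<in>S. A x) \<le> B \<longleftrightarrow> (\<forall>x\<in>S. A x \<le> B)" for A :: "'b \<Rightarrow> 'a::comm_ring_1 idl"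
  by (induction S rule: finite_induct) auto

lemma idl_mod_mult:
  assumes "x \<in>\<^sub>i A + B" "B \<le> C" shows "x \<in>\<^sub>i A + C"
  using assms by (meson add_left_mono memD)

text \<open>A term of the binomial expansion has at least \<open>m\<close> factors \<open>A\<close>
  or at least \<open>n\<close> factors \<open>B\<close>. The other factors are bounded by
  \<open>T\<close>, which preserves the total exponent \<open>m + n\<close>.\<close>

lemma add_power_le:
  fixes A B T :: "'a::comm_ring_1 idl"
  assumes "A \<le> T" "B \<le> T"
  shows "(A + B) ^ (m + n) \<le> A ^ m * T ^ n + B ^ n * T ^ m"
proof -
  have AT: "A ^ k \<le> T ^ k" and BT: "B ^ k \<le> T ^ k" for k
    using assms idl_power_mono by blast+
  have "A ^ k * B ^ (m + n - k) \<le> A ^ m * T ^ n + B ^ n * T ^ m" if k: "k \<le> m + n" for k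
  proof (cases "m \<le> k")
    case True
    then have "A ^ k * B ^ (m + n - k) = A ^ m * (A ^ (k - m) * B ^ (m + n - k))"
      by (simp flip: power_add mult.assoc)
    also have "\<dots> \<le> A ^ m * (T ^ (k - m) * T ^ (m + n - k))"
      by (intro idl_mult_mono AT BT order_refl)
    also have "\<dots> = A ^ m * T ^ n" using True k by (simp flip: power_add)
    finally show ?thesis by (meson idl_le_add1 order_trans)
  next
    case False
    then have e: "m + n - k = n + (m - k)" by simp
    have "A ^ k * B ^ (m + n - k) = B ^ n * (A ^ k * B ^ (m - k))"
      unfolding e by (simp add: power_add mult_ac)
    also have "\<dots> \<le> B ^ n * (T ^ k * T ^ (m - k))"
      by (intro idl_mult_mono AT BT order_refl)
    also have "\<dots> = B ^ n * T ^ m" using False by (simp flip: power_add)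
    finally show ?thesis by (meson idl_le_add2 order_trans)
  qed
  then show ?thesis
    unfolding binomial_ring
    by (subst sum_idl_le_iff) (auto simp: mult.assoc intro: idl_mult_le2)
qed

text \<open>Pigeonhole: among more than \<open>\<Sum>g\<in>G. E g\<close> factors, some
  \<open>g\<close> occurs at least \<open>E g\<close> times. The \<open>Suc\<close> also covers
  empty \<open>G\<close>, where a zeroth power would be the unit ideal.\<close>

lemma sum_power_le:
  fixes A :: "'b \<Rightarrow> 'a::comm_ring_1 idl"
  assumes "finite G" "\<And>g. g \<in> G \<Longrightarrow> A g \<le> T" "n \<ge> Suc (\<Sum>g\<in>G. E g)"
  shows "(\<Sum>g\<in>G. A g) ^ n \<le> (\<Sum>g\<in>G. A g ^ E g * T ^ (n - E g))"
  using assms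
proof (induction G arbitrary: n rule: finite_induct)
  case empty
  then show ?case by (cases n) auto
next
  case (insert a G)
  let ?m = "n - E a"
  have n: "n = E a + ?m" and m: "?m \<ge> Suc (sum E G)" using insert by auto
  have "(\<Sum>g\<in>insert a G. A g) ^ n = (A a + (\<Sum>g\<in>G. A g)) ^ (E a + ?m)"
    using insert n by simp
  also have "\<dots> \<le> A a ^ E a * T ^ ?m + (\<Sum>g\<in>G. A g) ^ ?m * T ^ E a"
    using insert by (intro add_power_le) (auto simp: sum_idl_le_iff)
  also have "\<dots> \<le> A a ^ E a * T ^ ?m + (\<Sum>g\<in>G. A g ^ E g * T ^ (?m - E g)) * T ^ E a"
    by (rule add_mono[OF order_refl idl_mult_mono[OF insert.IH order_refl]])
      (use insert.prems m in auto)
  also have "(\<Sum>g\<in>G. A g ^ E g * T ^ (?m - E g)) * T ^ E a = (\<Sum>g\<in>G. A g ^ E g * T ^ (n - E g))"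
    unfolding sum_distrib_right
  proof (rule sum.cong)
    fix g assume "g \<in> G"
    then have "E g \<le> sum E G" using insert by (simp add: member_le_sum)
    then have "(?m - E g) + E a = n - E g" using m by linarith
    then show "A g ^ E g * T ^ (?m - E g) * T ^ E a = A g ^ E g * T ^ (n - E g)"
      by (metis mult.assoc power_add)
  qed simp
  finally show ?case using insert by simp
qed

declare memD [trans]

section \<open>Ideals, reductions and integrality in terms of \<open>idl\<close>\<close>

lemma carrier_rta [simp]: "carrier ring_of_type_algebra = UNIV"
  and mult_rta [simp]: "x \<otimes>\<^bsub>ring_of_type_algebra\<^esub> y = x * y"
  and add_rta [simp]: "x \<oplus>\<^bsub>ring_of_type_algebra\<^esub> y = x + y"
  and one_rta [simp]: "\<one>\<^bsub>ring_of_type_algebra\<^esub> = 1"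
  and zero_rta [simp]: "\<zero>\<^bsub>ring_of_type_algebra\<^esub> = 0"
  for x y :: "'a::comm_ring_1"
  by (simp_all add: ring_of_type_algebra_def)

lemma uminus_rta [simp]: "\<ominus>\<^bsub>ring_of_type_algebra\<^esub> x = - x" for x :: "'a::comm_ring_1"
proof -
  interpret R: cring "ring_of_type_algebra :: 'a ring" by (rule cring_from_type_algebra)
  show ?thesis using R.minus_equality[of "- x" x] by simp
qed

lemma pow_rta [simp]: "x [^]\<^bsub>ring_of_type_algebra\<^esub> n = x ^ n" for x :: "'a::comm_ring_1" and n :: nat
proof -
  interpret R: cring "ring_of_type_algebra :: 'a ring" by (rule cring_from_type_algebra)
  show ?thesis by (induction n) (simp_all add: mult.commute)
qed

lemma finsum_rta [simp]: "finite S \<Longrightarrow> (\<Oplus>\<^bsub>ring_of_type_algebra\<^esub>i\<in>S. f i) = sum f S"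
  for f :: "'b \<Rightarrow> 'a::comm_ring_1"
proof -
  interpret R: cring "ring_of_type_algebra :: 'a ring" by (rule cring_from_type_algebra)
  show "finite S \<Longrightarrow> ?thesis"
    by (induction S rule: finite_induct) (simp_all add: R.finsum_insert)
qed

lemma ideal_rta_iff: "ideal I ring_of_type_algebra \<longleftrightarrow> ideal_set I" for I :: "'a::comm_ring_1 set"
proof
  assume "ideal I ring_of_type_algebra"
  then show "ideal_set I"
    using additive_subgroup.zero_closed[OF ideal.axioms(1)] additive_subgroup.a_closed[OF ideal.axioms(1)]
      ideal.I_l_closed
    unfolding ideal_set_def by fastforce
next
  interpret R: cring "ring_of_type_algebra :: 'a ring" by (rule cring_from_type_algebra)
  assume I: "ideal_set I"
  have neg: "- x \<in> I" if "x \<in> I" for x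
    using I that unfolding ideal_set_def by (metis mult_minus1)
  have inv: "inv\<^bsub>add_monoid ring_of_type_algebra\<^esub> x = - x" for x :: 'a
    unfolding a_inv_def[symmetric] by simp
  show "ideal I ring_of_type_algebra"
  proof (rule idealI)
    show "subgroup I (add_monoid ring_of_type_algebra)"
    proof (rule subgroup.intro)
      show "inv\<^bsub>add_monoid ring_of_type_algebra\<^esub> x \<in> I" if "x \<in> I" for x
        unfolding inv by (rule neg[OF that])
    qed (use I in \<open>auto simp: ideal_set_def\<close>)
    fix a x assume a: "a \<in> I"
    then show "x \<otimes>\<^bsub>ring_of_type_algebra\<^esub> a \<in> I" using I by (simp add: ideal_set_def)
    then show "a \<otimes>\<^bsub>ring_of_type_algebra\<^esub> x \<in> I" by (simp add: mult.commute)
  qed (rule R.ring_axioms)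
qed

lemma ideal_rta_elts [simp]: "ideal (elts I) ring_of_type_algebra"
  by (simp add: ideal_rta_iff ideal_set_elts)

lemma ideal_rtaE:
  assumes "ideal Y ring_of_type_algebra"
  obtains I where "Y = elts I"
  using assms by (metis Idl_of_inverse ideal_rta_iff mem_Collect_eq)

lemma Idl_rta: "Idl\<^bsub>ring_of_type_algebra\<^esub> S = elts (gen S)"
proof -
  have "ideal_set (\<Inter>{I. ideal_set I \<and> S \<subseteq> I})" by (auto simp: ideal_set_def)
  then show ?thesis
    by (simp add: genideal_def gen_def ideal_rta_iff Idl_of_inverse)
qed

lemma ideal_prod_rta: "ideal_prod ring_of_type_algebra (elts A) (elts B) = elts (A * B)"
  for A B :: "'a::comm_ring_1 idl"
proof (rule Set.set_eqI)
  fix x :: 'a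
  have "x \<in>\<^sub>i A * B" if "x \<in> ideal_prod ring_of_type_algebra (elts A) (elts B)"
    using that by (induction rule: ideal_prod.induct) (auto simp: mem_def[symmetric] intro: mem_times)
  moreover have "x \<in> ideal_prod ring_of_type_algebra (elts A) (elts B)" if "x \<in>\<^sub>i A * B"
    using that
  proof (induction rule: times_induct)
    case (prod a b)
    then show ?case
      using ideal_prod.prod[of a "elts A" b "elts B" ring_of_type_algebra] by (simp add: mem_def)
  next
    case (add a b)
    then show ?case
      using ideal_prod.sum[of a ring_of_type_algebra "elts A" "elts B" b] by simp
  qed
  ultimately show "x \<in> ideal_prod ring_of_type_algebra (elts A) (elts B) \<longleftrightarrow> x \<in> elts (A * B)"
    by (auto simp: mem_def)
qed

lemma elts_1: "elts 1 = UNIV"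
  by (auto simp: mem_def[symmetric])

lemma ideal_power_rta: "ideal_power ring_of_type_algebra (elts A) n = elts (A ^ n)"
proof (induction n)
  case 0
  then show ?case by (simp add: nat_pow_def ideals_set_def elts_1)
next
  case (Suc n)
  have "ideal_power ring_of_type_algebra (elts A) (Suc n) =
      ideal_prod ring_of_type_algebra (ideal_power ring_of_type_algebra (elts A) n) (elts A)"
    by (simp add: nat_pow_def ideals_set_def)
  then show ?case by (simp add: Suc ideal_prod_rta mult.commute)
qed

lemma elts_le_iff: "elts I \<subseteq> elts J \<longleftrightarrow> I \<le> J"
  by (auto simp: le_idl mem_def)

definition reduction :: "'a::comm_ring_1 idl \<Rightarrow> 'a idl \<Rightarrow> bool" where
  "reduction J I \<longleftrightarrow> J \<le> I \<and> (\<exists>r. I ^ Suc r = J * I ^ r)"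

lemma is_reduction_rta: "is_reduction ring_of_type_algebra (elts J) (elts I) \<longleftrightarrow> reduction J I"
  by (simp only: is_reduction_def reduction_def ideal_rta_elts ideal_power_rta ideal_prod_rta
      elts_inject elts_le_iff Suc_eq_plus1 simp_thms)

lemma mem_core_rta:
  "x \<in> core ring_of_type_algebra (elts I) \<longleftrightarrow> (\<forall>K. reduction K I \<longrightarrow> x \<in>\<^sub>i K)"
proof
  assume "x \<in> core ring_of_type_algebra (elts I)"
  then show "\<forall>K. reduction K I \<longrightarrow> x \<in>\<^sub>i K"
    by (auto simp: core_def mem_def is_reduction_rta)
next
  assume *: "\<forall>K. reduction K I \<longrightarrow> x \<in>\<^sub>i K"
  show "x \<in> core ring_of_type_algebra (elts I)"
    unfolding core_def
  proof safe
    fix K assume K: "is_reduction ring_of_type_algebra K (elts I)"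
    then obtain K' where "K = elts K'" unfolding is_reduction_def by (auto elim: ideal_rtaE)
    then show "x \<in> K" using K * by (auto simp: mem_def is_reduction_rta)
  qed
qed

lemma reduction_powers:
  assumes "reduction J I"
  obtains r where "\<And>m n. m \<ge> r \<Longrightarrow> I ^ (n + m) = J ^ n * I ^ m"
proof -
  from assms obtain r where r: "I ^ Suc r = J * I ^ r" by (auto simp: reduction_def)
  have "I ^ (n + (k + r)) = J ^ n * I ^ (k + r)" for n k
  proof (induction n)
    case (Suc n)
    have "I ^ (Suc n + (k + r)) = I ^ (n + k) * I ^ Suc r"
      by (metis add.assoc add_Suc add_Suc_right power_add)
    also have "\<dots> = J * I ^ (n + (k + r))" by (simp only: r power_add ac_simps)
    finally show ?case by (simp add: Suc mult.assoc)
  qed simp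
  then have "I ^ (n + m) = J ^ n * I ^ m" if "m \<ge> r" for m n
    using that by (metis le_add_diff_inverse2)
  then show ?thesis by (rule that)
qed

lemma reductionI:
  assumes "J \<le> I" "I ^ Suc r \<le> J * I ^ r"
  shows "reduction J I"
proof -
  have "J * I ^ r \<le> I ^ Suc r" using assms(1) by (simp add: idl_mult_mono)
  then show ?thesis using assms unfolding reduction_def by (meson antisym)
qed

text \<open>The equation of integral dependence as a single membership. It amounts to
  \<open>J\<close> being a reduction of \<open>J + pr f\<close>; \<open>integral_iff\<close>
  recovers the coefficients.\<close>

definition integral :: "'a::comm_ring_1 idl \<Rightarrow> 'a \<Rightarrow> bool" where
  "integral J f \<longleftrightarrow> (\<exists>n. f ^ Suc n \<in>\<^sub>i J * (J + pr f) ^ n)"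

lemma mem_sum_idl_obtain:
  assumes "finite S" "x \<in>\<^sub>i (\<Sum>i\<in>S. A i)"
  obtains a where "\<And>i. i \<in> S \<Longrightarrow> a i \<in>\<^sub>i A i" "x = (\<Sum>i\<in>S. a i)"
proof -
  from assms have "\<exists>a. (\<forall>i\<in>S. a i \<in>\<^sub>i A i) \<and> x = (\<Sum>i\<in>S. a i)"
  proof (induction S arbitrary: x rule: finite_induct)
    case (insert i S)
    then obtain u v where x: "x = u + v" "u \<in>\<^sub>i A i" "v \<in>\<^sub>i sum A S" by (auto simp: mem_plus)
    obtain a where a: "\<forall>i\<in>S. a i \<in>\<^sub>i A i" "v = sum a S" using insert x by blast
    have "sum (a(i := u)) S = sum a S" using insert by (intro sum.cong) auto
    then show ?case
      using insert x a by (intro exI[of _ "a(i := u)"]) auto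
  qed simp
  then show ?thesis using that by blast
qed

lemma integral_shape:
  "J * (J + pr f) ^ n = (\<Sum>i\<le>n. J ^ Suc i * pr (f ^ (n - i)))"
proof -
  \<comment> \<open>Addition of ideals is idempotent, so positive binomial coefficients act as
    \<open>1\<close>.\<close>
  have bin: "of_nat k * I = I" if "k > 0" for k and I :: "'a idl"
  proof -
    have "of_nat (Suc j) * I = I" for j
      by (induction j) (simp_all add: distrib_right)
    then show ?thesis using that by (cases k) auto
  qed
  have "(J + pr f) ^ n = (\<Sum>i\<le>n. J ^ i * pr (f ^ (n - i)))"
    unfolding binomial_ring
    by (intro sum.cong) (simp_all add: mult.assoc bin pr_power)
  then show ?thesis by (simp add: sum_distrib_left mult.assoc)
qed

lemma integral_iff:
  "integral J f \<longleftrightarrow> (\<exists>n\<ge>1. \<exists>a. (\<forall>i\<in>{1..n}. a i \<in>\<^sub>i J ^ i) \<and> f ^ n = (\<Sum>i=1..n. a i * f ^ (n - i)))"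
proof
  assume "integral J f"
  then obtain n where "f ^ Suc n \<in>\<^sub>i (\<Sum>i\<le>n. J ^ Suc i * pr (f ^ (n - i)))"
    by (auto simp: integral_def integral_shape)
  then obtain b where b: "\<And>i. i \<le> n \<Longrightarrow> b i \<in>\<^sub>i J ^ Suc i * pr (f ^ (n - i))" "f ^ Suc n = (\<Sum>i\<le>n. b i)"
    using mem_sum_idl_obtain[of "{..n}"] by auto
  have "\<forall>i. \<exists>y. i \<le> n \<longrightarrow> y \<in>\<^sub>i J ^ Suc i \<and> b i = y * f ^ (n - i)"
    using b(1) by (metis mem_pr_mult mult.commute)
  then obtain c where c: "\<And>i. i \<le> n \<Longrightarrow> c i \<in>\<^sub>i J ^ Suc i \<and> b i = c i * f ^ (n - i)" by metis
  have "f ^ Suc n = (\<Sum>i\<le>n. c i * f ^ (n - i))" using b(2) c by simp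
  also have "\<dots> = (\<Sum>i=1..Suc n. c (i - 1) * f ^ (Suc n - i))"
    by (rule sum.reindex_bij_witness[of _ "\<lambda>i. i - 1" Suc]) auto
  finally show "\<exists>n\<ge>1. \<exists>a. (\<forall>i\<in>{1..n}. a i \<in>\<^sub>i J ^ i) \<and> f ^ n = (\<Sum>i=1..n. a i * f ^ (n - i))"
    using c by (intro exI[of _ "Suc n"] conjI exI[of _ "\<lambda>i. c (i - 1)"]) (auto simp: Suc_le_eq gr0_conv_Suc)
next
  assume "\<exists>n\<ge>1. \<exists>a. (\<forall>i\<in>{1..n}. a i \<in>\<^sub>i J ^ i) \<and> f ^ n = (\<Sum>i=1..n. a i * f ^ (n - i))"
  then obtain n a where n: "n \<ge> 1" and a: "\<And>i. i \<in> {1..n} \<Longrightarrow> a i \<in>\<^sub>i J ^ i"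
    and f: "f ^ n = (\<Sum>i=1..n. a i * f ^ (n - i))" by blast
  obtain m where m: "n = Suc m" using n by (cases n) auto
  have "f ^ n \<in>\<^sub>i J * (J + pr f) ^ m"
    unfolding f
  proof (rule mem_sum)
    fix i assume i: "i \<in> {1..n}"
    then have "a i * f ^ (n - i) \<in>\<^sub>i J ^ i * (J + pr f) ^ (n - i)"
      by (intro mem_times a mem_power) (auto intro: mem_addI2)
    also have "J ^ i * (J + pr f) ^ (n - i) = J * (J ^ (i - 1) * (J + pr f) ^ (n - i))"
      using i by (cases i) (auto simp: mult.assoc)
    also have "\<dots> \<le> J * ((J + pr f) ^ (i - 1) * (J + pr f) ^ (n - i))"
      by (intro idl_mult_mono order_refl idl_power_mono idl_le_add1)
    also have "\<dots> = J * (J + pr f) ^ m" using i m by (simp flip: power_add)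
    finally show "a i * f ^ (n - i) \<in>\<^sub>i J * (J + pr f) ^ m"
      .
  qed
  then show "integral J f" unfolding integral_def m by blast
qed

lemma integral_mono: "integral J f \<Longrightarrow> J \<le> I \<Longrightarrow> integral I f"
  unfolding integral_iff using idl_power_mono memD by metis

lemma integral_closure_rta: "x \<in> integral_closure ring_of_type_algebra (elts I) \<longleftrightarrow> integral I x"
proof -
  have "x \<in> integral_closure ring_of_type_algebra (elts I) \<longleftrightarrow>
    (\<exists>n\<ge>1. \<exists>a. (\<forall>i\<in>{1..n}. a i \<in>\<^sub>i I ^ i) \<and> x ^ n + (\<Sum>i=1..n. a i * x ^ (n - i)) = 0)"
    by (auto simp: integral_closure_def ideal_power_rta mem_def)
  also have "\<dots> \<longleftrightarrow> integral I x"
    unfolding integral_iff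
  proof (rule iffI; elim exE conjE)
    fix n a assume "1 \<le> n" "\<forall>i\<in>{1..n}. a i \<in>\<^sub>i I ^ i" "x ^ n + (\<Sum>i=1..n. a i * x ^ (n - i)) = 0"
    then show "\<exists>n\<ge>1. \<exists>a. (\<forall>i\<in>{1..n}. a i \<in>\<^sub>i I ^ i) \<and> x ^ n = (\<Sum>i=1..n. a i * x ^ (n - i))"
      by (intro exI[of _ n] conjI exI[of _ "\<lambda>i. - a i"]) (auto simp: sum_negf eq_neg_iff_add_eq_0)
  next
    fix n a assume "1 \<le> n" "\<forall>i\<in>{1..n}. a i \<in>\<^sub>i I ^ i" "x ^ n = (\<Sum>i=1..n. a i * x ^ (n - i))"
    then show "\<exists>n\<ge>1. \<exists>a. (\<forall>i\<in>{1..n}. a i \<in>\<^sub>i I ^ i) \<and> x ^ n + (\<Sum>i=1..n. a i * x ^ (n - i)) = 0"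
      by (intro exI[of _ n] conjI exI[of _ "\<lambda>i. - a i"]) (auto simp: sum_negf)
  qed
  finally show ?thesis .
qed

section \<open>The determinant trick\<close>

lemma prod_mem_power:
  fixes x :: "nat \<Rightarrow> 'a::comm_ring_1"
  assumes "\<And>i. i < n \<Longrightarrow> x i \<in>\<^sub>i U" "k < n" "x k \<in>\<^sub>i J"
  shows "(\<Prod>i<n. x i) \<in>\<^sub>i J * U ^ (n - 1)"
proof -
  have "(\<Prod>i\<in>S. x i) \<in>\<^sub>i U ^ card S" if "finite S" "S \<subseteq> {..<n}" for S
    using that by (induction S rule: finite_induct) (auto intro: mem_times assms)
  from this[of "{..<n} - {k}"] have "x k * (\<Prod>i\<in>{..<n} - {k}. x i) \<in>\<^sub>i J * U ^ (n - 1)"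
    using assms by (auto intro: mem_times)
  then show ?thesis using assms by (simp add: prod.remove)
qed

lemma prod_diff_mem:
  fixes c :: "nat \<Rightarrow> 'a::comm_ring_1"
  assumes "\<And>i. i < n \<Longrightarrow> c i \<in>\<^sub>i J" "J \<le> U" "f \<in>\<^sub>i U"
  shows "(\<Prod>i<n. f - c i) - f ^ n \<in>\<^sub>i J * U ^ (n - 1)"
  using assms(1)
proof (induction n)
  case (Suc n)
  have "f ^ n * c n \<in>\<^sub>i U ^ n * J" using Suc assms by (intro mem_times mem_power) auto
  moreover have "((\<Prod>i<n. f - c i) - f ^ n) * (f - c n) \<in>\<^sub>i J * U ^ n"
  proof (cases n)
    case (Suc m)
    have "((\<Prod>i<n. f - c i) - f ^ n) * (f - c n) \<in>\<^sub>i (J * U ^ (n - 1)) * U"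
      by (rule mem_times[OF Suc.IH mem_diff[OF assms(3) memD[OF Suc.prems assms(2)]]])
        (use Suc.prems in auto)
    then show ?thesis using Suc by (simp add: mult_ac)
  qed simp
  ultimately have "((\<Prod>i<n. f - c i) - f ^ n) * (f - c n) - f ^ n * c n \<in>\<^sub>i J * U ^ n"
    by (auto simp: mult.commute)
  then show ?case by (simp add: algebra_simps)
qed simp

text \<open>Cayley-Hamilton: multiplication by \<open>f\<close> on the generators is given by a
  matrix \<open>c\<close> over \<open>J\<close>, so the determinant of \<open>f - c\<close>
  annihilates \<open>gen S\<close>, and in particular the nonzerodivisor \<open>u\<close>. Expanding
  the vanishing determinant gives the integral equation.\<close>

lemma integral_of_stable:
  fixes f u :: "'a::comm_ring_1"
  assumes fin: "finite S" and stable: "pr f * gen S \<le> J * gen S"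
    and u: "u \<in>\<^sub>i gen S" "\<And>x. x * u = 0 \<Longrightarrow> x = 0"
  shows "integral J f"
proof -
  obtain g :: "nat \<Rightarrow> 'a" and n where S: "S = g ` {..<n}"
    using finite_imp_nat_seg_image_inj_on[OF fin] by (auto simp: lessThan_def)
  have gen: "gen S = (\<Sum>j<n. pr (g j))" unfolding S by (rule gen_image_finite) simp
  have "\<exists>c. (\<forall>j<n. c j \<in>\<^sub>i J) \<and> f * g i = (\<Sum>j<n. c j * g j)" if "i < n" for i
  proof -
    have "f * g i \<in>\<^sub>i J * gen S"
      by (rule memD[OF mem_times stable]) (use that S in auto)
    then have "f * g i \<in>\<^sub>i (\<Sum>j<n. J * pr (g j))" by (simp add: gen sum_distrib_left)
    then obtain b where b: "\<And>j. j < n \<Longrightarrow> b j \<in>\<^sub>i J * pr (g j)" "f * g i = (\<Sum>j<n. b j)"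
      using mem_sum_idl_obtain[of "{..<n}"] by auto
    have "\<forall>j. \<exists>y. j < n \<longrightarrow> y \<in>\<^sub>i J \<and> b j = y * g j"
      using b(1) by (metis mem_pr_mult mult.commute)
    then obtain c where "\<And>j. j < n \<Longrightarrow> c j \<in>\<^sub>i J \<and> b j = c j * g j" by metis
    then show ?thesis using b(2) by (intro exI[of _ c]) auto
  qed
  then obtain c where c: "\<And>i j. i < n \<Longrightarrow> j < n \<Longrightarrow> c i j \<in>\<^sub>i J"
    and fg: "\<And>i. i < n \<Longrightarrow> f * g i = (\<Sum>j<n. c i j * g j)" by metis
  define U where "U = J + pr f"
  have JU: "J \<le> U" and fU: "f \<in>\<^sub>i U" by (auto simp: U_def intro: mem_addI2)
  define A where "A = mat n n (\<lambda>(i, j). (if i = j then f else 0) - c i j)"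
  have A: "A \<in> carrier_mat n n" by (simp add: A_def)
  have Ag: "A *\<^sub>v vec n g = 0\<^sub>v n"
  proof (rule eq_vecI)
    fix i assume "i < dim_vec (0\<^sub>v n :: 'a vec)"
    then have i: "i < n" by simp
    have "(A *\<^sub>v vec n g) $ i = (\<Sum>j<n. ((if i = j then f else 0) - c i j) * g j)"
      using i by (simp add: A_def scalar_prod_def lessThan_atLeast0)
    also have "\<dots> = (\<Sum>j<n. if i = j then f * g j else 0) - (\<Sum>j<n. c i j * g j)"
      unfolding sum_subtractf[symmetric] by (rule sum.cong) (auto simp: algebra_simps)
    also have "\<dots> = 0" using i fg by simp
    finally show "(A *\<^sub>v vec n g) $ i = 0\<^sub>v n $ i" using i by simp
  qed (simp add: A_def)
  have "det A * g i = 0" if i: "i < n" for i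
  proof -
    have delta: "(\<Sum>k = 0..<n. det A * (if k = i then 1 else 0) * g k) = det A * g i"
      using i by (subst sum.remove[of _ i]) auto
    have "(adj_mat A * A) *\<^sub>v vec n g = adj_mat A *\<^sub>v (A *\<^sub>v vec n g)"
      using adj_mat[OF A] A by (intro assoc_mult_mat_vec) auto
    also have "\<dots> = 0\<^sub>v n"
      unfolding Ag using adj_mat(1)[OF A] by auto
    finally have "(det A \<cdot>\<^sub>m 1\<^sub>m n) *\<^sub>v vec n g = 0\<^sub>v n"
      unfolding adj_mat(3)[OF A] .
    moreover have "((det A \<cdot>\<^sub>m 1\<^sub>m n) *\<^sub>v vec n g) $ i = det A * g i"
      using i delta by (simp add: scalar_prod_def eq_commute[of i])
    ultimately show ?thesis using i by simp
  qed
  then have S0: "det A * s = 0" if "s \<in> S" for s using that S by auto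
  have "det A * x = 0" if "x \<in>\<^sub>i gen S" for x
    using that by (induction rule: gen_induct) (auto simp: S0 distrib_left mult.left_commute)
  then have det0: "det A = 0" using u by blast
  have "n \<noteq> 0"
  proof
    assume "n = 0"
    then have "u = 0" using u(1) gen by simp
    then show False using u(2)[of 1] by simp
  qed
  then obtain m where n: "n = Suc m" by (cases n) auto
  let ?P = "{p. p permutes {0..<n}}"
  let ?t = "\<lambda>p. signof p * (\<Prod>i = 0..<n. A $$ (i, p i))"
  have fin': "finite ?P" by (simp add: finite_permutations)
  have "det A = ?t id + sum ?t (?P - {id})"
    unfolding det_def'[OF A] by (rule sum.remove) (auto simp: fin' permutes_id)
  moreover have "?t id = (\<Prod>i<n. f - c i i)"
    by (auto simp: A_def lessThan_atLeast0 intro!: prod.cong)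
  \<comment> \<open>A permutation other than the identity moves some \<open>k\<close>, and the
    factor in row \<open>k\<close> is an off-diagonal entry, hence in \<open>J\<close>.\<close>
  moreover have "sum ?t (?P - {id}) \<in>\<^sub>i J * U ^ m"
  proof (intro mem_sum mem_mult_left)
    fix p assume p: "p \<in> ?P - {id}"
    then obtain k where k: "p k \<noteq> k" "k < n"
      by (metis (no_types, lifting) DiffE atLeast0LessThan eq_id_iff insertI1 lessThan_iff mem_Collect_eq
          permutes_not_in singletonI)
    have pn: "p i < n" if "i < n" for i
      using p that permutes_in_image[of p "{0..<n}" i] by auto
    have "(\<Prod>i<n. A $$ (i, p i)) \<in>\<^sub>i J * U ^ (n - 1)"
    proof (rule prod_mem_power[of _ _ _ k])
      show "A $$ (i, p i) \<in>\<^sub>i U" if "i < n" for i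
        using that pn memD[OF c JU] fU by (auto simp: A_def intro!: mem_diff mem_uminus)
      show "A $$ (k, p k) \<in>\<^sub>i J"
        using k pn c by (auto simp: A_def intro!: mem_uminus)
    qed (use k in simp)
    then show "(\<Prod>i = 0..<n. A $$ (i, p i)) \<in>\<^sub>i J * U ^ m"
      by (simp add: n lessThan_atLeast0)
  qed
  moreover have "(\<Prod>i<n. f - c i i) - f ^ n \<in>\<^sub>i J * U ^ m"
    using prod_diff_mem[of n "\<lambda>i. c i i" J U f] c JU fU n by simp
  ultimately have mem: "- (((\<Prod>i<n. f - c i i) - f ^ n) + sum ?t (?P - {id})) \<in>\<^sub>i J * U ^ m"
    and zero: "(\<Prod>i<n. f - c i i) + sum ?t (?P - {id}) = 0"
    using det0 by (blast intro: mem_uminus mem_add, simp)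
  have "- ((y - f ^ n) + z) = f ^ n" if "y + z = 0" for y z
    using that by (simp add: algebra_simps add_eq_0_iff)
  from mem[unfolded this[OF zero]] have "f ^ n \<in>\<^sub>i J * U ^ m" .
  then show ?thesis unfolding integral_def U_def n by blast
qed

section \<open>Monomials and monomial ideals\<close>

abbreviation lkp :: "('b \<Rightarrow>\<^sub>0 'a::zero) \<Rightarrow> 'b \<Rightarrow> 'a" where
  "lkp \<equiv> Poly_Mapping.lookup"

abbreviation mon :: "('v::finite \<Rightarrow>\<^sub>0 nat) \<Rightarrow> ('v, 'k::field) mpoly" where
  "mon m \<equiv> Poly_Mapping.single m 1"

abbreviation cst :: "'k::field \<Rightarrow> ('v::finite, 'k) mpoly" where
  "cst c \<equiv> Poly_Mapping.single 0 c"

lemma lookup_single_mult: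
  fixes f :: "('b::cancel_comm_monoid_add) \<Rightarrow>\<^sub>0 ('a::comm_semiring_0)"
  shows "lkp (Poly_Mapping.single m c * f) (m + n) = c * lkp f n"
proof -
  have "lkp (Poly_Mapping.single m c * f) (m + n)
      = Sum_any (\<lambda>l. lkp (Poly_Mapping.single m c) l * Sum_any (\<lambda>q. lkp f q when m + n = l + q))"
    by (rule lookup_mult)
  also have "\<dots> = (\<Sum>l\<in>{m}. lkp (Poly_Mapping.single m c) l * Sum_any (\<lambda>q. lkp f q when m + n = l + q))"
    by (rule Sum_any.expand_superset) (auto simp: lookup_single when_def split: if_splits)
  also have "\<dots> = c * Sum_any (\<lambda>q. lkp f q when n = q)" by simp
  finally show ?thesis by simp
qed

lemma lookup_single_mult_0:
  fixes f :: "('b::cancel_comm_monoid_add) \<Rightarrow>\<^sub>0 ('a::comm_semiring_0)"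
  assumes "\<And>n. k \<noteq> m + n"
  shows "lkp (Poly_Mapping.single m c * f) k = 0"
proof -
  have "lkp (Poly_Mapping.single m c * f) k
      = Sum_any (\<lambda>l. lkp (Poly_Mapping.single m c) l * Sum_any (\<lambda>q. lkp f q when k = l + q))"
    by (rule lookup_mult)
  also have "\<dots> = (\<Sum>l\<in>{m}. lkp (Poly_Mapping.single m c) l * Sum_any (\<lambda>q. lkp f q when k = l + q))"
    by (rule Sum_any.expand_superset) (auto simp: lookup_single when_def split: if_splits)
  also have "\<dots> = 0" using assms by simp
  finally show ?thesis .
qed

lemma keys_mon_mult: "Poly_Mapping.keys (mon m * f) = (+) m ` Poly_Mapping.keys f"
  for f :: "('v::finite, 'k::field) mpoly"
proof (rule Set.set_eqI)
  fix k
  show "k \<in> Poly_Mapping.keys (mon m * f) \<longleftrightarrow> k \<in> (+) m ` Poly_Mapping.keys f"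
  proof (cases "\<exists>n. k = m + n")
    case True
    then obtain n where "k = m + n" ..
    then show ?thesis by (auto simp: in_keys_iff lookup_single_mult)
  next
    case False
    then show ?thesis by (auto simp: in_keys_iff lookup_single_mult_0)
  qed
qed

lemma lookup_cst_mult: "lkp (cst c * f) k = c * lkp f k"
  using lookup_single_mult[of 0 c f k] by simp

lemma mon_nzd: "mon m * f = 0 \<Longrightarrow> f = 0" for f :: "('v::finite, 'k::field) mpoly"
  using keys_mon_mult[of m f] by simp

lemma mon_mult: "mon m * mon n = (mon (m + n) :: ('v::finite, 'k::field) mpoly)"
  by (simp add: mult_single)

lemma mpoly_sum: "f = (\<Sum>k\<in>Poly_Mapping.keys f. cst (lkp f k) * mon k)"
  for f :: "('v::finite, 'k::field) mpoly"
proof (rule poly_mapping_eqI)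
  fix k
  have "lkp (\<Sum>k\<in>Poly_Mapping.keys f. cst (lkp f k) * mon k) k
      = (\<Sum>l\<in>Poly_Mapping.keys f. if l = k then lkp f k else 0)"
    unfolding lookup_sum by (rule sum.cong) (auto simp: lookup_cst_mult lookup_single when_def)
  also have "\<dots> = lkp f k" by (simp add: in_keys_iff)
  finally show "lkp f k = lkp (\<Sum>k\<in>Poly_Mapping.keys f. cst (lkp f k) * mon k) k" ..
qed

lemma mem_of_keys: "(\<And>k. k \<in> Poly_Mapping.keys f \<Longrightarrow> mon k \<in>\<^sub>i I) \<Longrightarrow> f \<in>\<^sub>i I"
  for f :: "('v::finite, 'k::field) mpoly"
  by (subst mpoly_sum[of f]) auto

definition monI :: "('v::finite, 'k::field) mpoly idl \<Rightarrow> bool" where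
  "monI I \<longleftrightarrow> (\<forall>f k. f \<in>\<^sub>i I \<longrightarrow> k \<in> Poly_Mapping.keys f \<longrightarrow> mon k \<in>\<^sub>i I)"

lemma monI_mem_iff: "monI I \<Longrightarrow> f \<in>\<^sub>i I \<longleftrightarrow> (\<forall>k\<in>Poly_Mapping.keys f. mon k \<in>\<^sub>i I)"
  using mem_of_keys unfolding monI_def by blast

lemma mon_mem_add: "mon m \<in>\<^sub>i I \<Longrightarrow> mon (m + n) \<in>\<^sub>i (I :: ('v::finite, 'k::field) mpoly idl)"
  by (metis mem_mult_right mon_mult)

lemma keys_subsetD: "k \<in> Poly_Mapping.keys (f + g) \<Longrightarrow> k \<in> Poly_Mapping.keys f \<or> k \<in> Poly_Mapping.keys g"
  using keys_add[of f g] by auto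

lemma keys_multD:
  "k \<in> Poly_Mapping.keys (f * g) \<Longrightarrow> \<exists>m n. k = m + n \<and> m \<in> Poly_Mapping.keys f \<and> n \<in> Poly_Mapping.keys g"
  using keys_mult[of f g] by auto

lemma monI_0 [simp]: "monI 0" and monI_1 [simp]: "monI 1"
  by (auto simp: monI_def)

lemma monI_add:
  assumes "monI A" "monI B" shows "monI (A + B)"
  unfolding monI_def
proof (intro allI impI)
  fix f k assume "f \<in>\<^sub>i A + B" and k: "k \<in> Poly_Mapping.keys f"
  then obtain u v where "f = u + v" "u \<in>\<^sub>i A" "v \<in>\<^sub>i B" by (auto simp: mem_plus)
  then show "mon k \<in>\<^sub>i A + B"
    using k assms keys_subsetD unfolding monI_def by (metis mem_addI1 mem_addI2)
qed

lemma mon_mem_plus: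
  assumes "monI A" "monI B"
  shows "mon k \<in>\<^sub>i A + B \<longleftrightarrow> mon k \<in>\<^sub>i A \<or> mon k \<in>\<^sub>i B"
proof
  assume "mon k \<in>\<^sub>i A + B"
  then obtain u v where uv: "mon k = u + v" "u \<in>\<^sub>i A" "v \<in>\<^sub>i B" by (auto simp: mem_plus)
  then have "k \<in> Poly_Mapping.keys (u + v)" by (metis keys_single singletonI zero_neq_one)
  then show "mon k \<in>\<^sub>i A \<or> mon k \<in>\<^sub>i B"
    using uv assms keys_subsetD unfolding monI_def by metis
qed (auto intro: mem_addI1 mem_addI2)

lemma times_keys:
  assumes "monI A" "monI B" "f \<in>\<^sub>i A * B" "k \<in> Poly_Mapping.keys f"
  shows "\<exists>a b. k = a + b \<and> mon a \<in>\<^sub>i A \<and> mon b \<in>\<^sub>i B"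
  using assms(3,4)
proof (induction arbitrary: k rule: times_induct)
  case (prod f g)
  from keys_multD[OF prod(3)] obtain m n
    where "k = m + n" "m \<in> Poly_Mapping.keys f" "n \<in> Poly_Mapping.keys g" by blast
  moreover from this have "mon m \<in>\<^sub>i A" "mon n \<in>\<^sub>i B"
    using prod assms(1,2) unfolding monI_def by blast+
  ultimately show ?case by blast
next
  case (add f g)
  from keys_subsetD[OF add.prems(1)] show ?case using add.IH by blast
qed

lemma mon_mem_times:
  assumes "monI A" "monI B"
  shows "mon k \<in>\<^sub>i A * B \<longleftrightarrow> (\<exists>a b. k = a + b \<and> mon a \<in>\<^sub>i A \<and> mon b \<in>\<^sub>i B)"
proof
  assume "mon k \<in>\<^sub>i A * B"
  then show "\<exists>a b. k = a + b \<and> mon a \<in>\<^sub>i A \<and> mon b \<in>\<^sub>i B"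
    using times_keys[OF assms] by (metis keys_single singletonI zero_neq_one)
next
  assume "\<exists>a b. k = a + b \<and> mon a \<in>\<^sub>i A \<and> mon b \<in>\<^sub>i B"
  then show "mon k \<in>\<^sub>i A * B" using mem_times mon_mult by metis
qed

lemma monI_times:
  assumes "monI A" "monI B" shows "monI (A * B)"
  unfolding monI_def using times_keys[OF assms] mon_mem_times[OF assms] by blast

lemma monI_power: "monI A \<Longrightarrow> monI (A ^ n)"
  by (induction n) (auto intro: monI_times)

lemma monI_sum: "(\<And>i. i \<in> S \<Longrightarrow> monI (A i)) \<Longrightarrow> monI (\<Sum>i\<in>S. A i)"
  by (induction S rule: infinite_finite_induct) (auto intro: monI_add)

lemma monI_pr: "monI (pr (mon m :: ('v::finite, 'k::field) mpoly))"
  unfolding monI_def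
proof (intro allI impI)
  fix f :: "('v, 'k) mpoly" and k assume "f \<in>\<^sub>i pr (mon m)" "k \<in> Poly_Mapping.keys f"
  then obtain n where "k = m + n" by (auto simp: mem_pr keys_mon_mult)
  then show "mon k \<in>\<^sub>i pr (mon m)" by (simp add: mon_mem_add)
qed

lemma mon_mem_pr: "mon k \<in>\<^sub>i pr (mon m :: ('v::finite, 'k::field) mpoly) \<longleftrightarrow> (\<exists>n. k = m + n)"
proof
  assume "mon k \<in>\<^sub>i pr (mon m :: ('v::finite, 'k::field) mpoly)"
  then obtain f :: "('v, 'k) mpoly" where "mon k = mon m * f" by (auto simp: mem_pr)
  then have "Poly_Mapping.keys (mon k :: ('v, 'k) mpoly) = (+) m ` Poly_Mapping.keys f"
    by (simp add: keys_mon_mult)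
  then show "\<exists>n. k = m + n" by auto
qed (auto intro: mon_mem_add)

lemma gen_mon_iff:
  "f \<in>\<^sub>i gen (mon ` E) \<longleftrightarrow> (\<forall>k\<in>Poly_Mapping.keys f. \<exists>m\<in>E. \<exists>n. k = m + n)"
  for f :: "('v::finite, 'k::field) mpoly"
proof
  assume "f \<in>\<^sub>i gen (mon ` E)"
  then show "\<forall>k\<in>Poly_Mapping.keys f. \<exists>m\<in>E. \<exists>n. k = m + n"
  proof (induction rule: gen_induct)
    case (base s)
    then obtain m where "m \<in> E" "s = mon m" by blast
    moreover have "m = m + 0" by simp
    ultimately show ?case by (metis (no_types, lifting) keys_single singletonD zero_neq_one)
  next
    case (add a b)
    show ?case
    proof
      fix k assume "k \<in> Poly_Mapping.keys (a + b)"
      from keys_subsetD[OF this] show "\<exists>m\<in>E. \<exists>n. k = m + n" using add.IH by blast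
    qed
  next
    case (mult r a)
    show ?case
    proof
      fix k assume "k \<in> Poly_Mapping.keys (r * a)"
      from keys_multD[OF this] obtain p q where "k = p + q" "q \<in> Poly_Mapping.keys a" by blast
      moreover from this(2) obtain m n where "m \<in> E" "q = m + n" using mult by blast
      ultimately have "m \<in> E" "k = m + (p + n)" by (simp_all add: ac_simps)
      then show "\<exists>m\<in>E. \<exists>n. k = m + n" by blast
    qed
  qed simp
next
  assume *: "\<forall>k\<in>Poly_Mapping.keys f. \<exists>m\<in>E. \<exists>n. k = m + n"
  show "f \<in>\<^sub>i gen (mon ` E)"
  proof (rule mem_of_keys)
    fix k assume "k \<in> Poly_Mapping.keys f"
    then obtain m n where "m \<in> E" "k = m + n" using * by blast
    then show "mon k \<in>\<^sub>i gen (mon ` E)" by (auto intro!: mon_mem_add)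
  qed
qed

lemma monI_gen: "monI (gen (mon ` E) :: ('v::finite, 'k::field) mpoly idl)"
  unfolding monI_def
proof (intro allI impI)
  fix f :: "('v, 'k) mpoly" and k assume "f \<in>\<^sub>i gen (mon ` E)" "k \<in> Poly_Mapping.keys f"
  then obtain m n where "m \<in> E" "k = m + n" using gen_mon_iff by blast
  then show "mon k \<in>\<^sub>i gen (mon ` E)" by (auto intro!: mon_mem_add)
qed

lemma pm_le_obtain:
  fixes m k :: "'v::finite \<Rightarrow>\<^sub>0 nat"
  assumes "\<And>v. lkp m v \<le> lkp k v"
  obtains n where "k = m + n"
proof
  show "k = m + (k - m)"
    by (rule poly_mapping_eqI) (use assms in \<open>simp add: lookup_add lookup_minus\<close>)
qed

subsection \<open>Ideals defined by a superadditive function of the exponent\<close>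

text \<open>Common frame for two filtrations by monomials: \<open>ord\<close>, which gives the
  powers of \<open>J\<close>, and the additive weight \<open>wt\<close>, which gives
  \<open>F\<close>.\<close>

definition superadd :: "(('v::finite \<Rightarrow>\<^sub>0 nat) \<Rightarrow> nat) \<Rightarrow> bool" where
  "superadd \<phi> \<longleftrightarrow> (\<forall>m n. \<phi> m + \<phi> n \<le> \<phi> (m + n))"

definition V :: "(('v::finite \<Rightarrow>\<^sub>0 nat) \<Rightarrow> nat) \<Rightarrow> nat \<Rightarrow> ('v, 'k::field) mpoly idl" where
  "V \<phi> n = gen (mon ` {m. n \<le> \<phi> m})"

lemma mem_V: "superadd \<phi> \<Longrightarrow> f \<in>\<^sub>i V \<phi> n \<longleftrightarrow> (\<forall>k\<in>Poly_Mapping.keys f. n \<le> \<phi> k)"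
proof -
  assume \<phi>: "superadd \<phi>"
  have "(\<exists>m\<in>{m. n \<le> \<phi> m}. \<exists>l. k = m + l) \<longleftrightarrow> n \<le> \<phi> k" for k
  proof
    assume "\<exists>m\<in>{m. n \<le> \<phi> m}. \<exists>l. k = m + l"
    then obtain m l where "n \<le> \<phi> m" and k: "k = m + l" by blast
    moreover have "\<phi> m + \<phi> l \<le> \<phi> k" using \<phi> unfolding superadd_def k by blast
    ultimately show "n \<le> \<phi> k" by linarith
  next
    assume "n \<le> \<phi> k"
    then show "\<exists>m\<in>{m. n \<le> \<phi> m}. \<exists>l. k = m + l"
      by (intro bexI[of _ k] exI[of _ 0]) auto
  qed
  then show ?thesis by (simp add: V_def gen_mon_iff)
qed

lemma mon_mem_V: "superadd \<phi> \<Longrightarrow> mon m \<in>\<^sub>i (V \<phi> n :: ('v::finite, 'k::field) mpoly idl) \<longleftrightarrow> n \<le> \<phi> m"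
  by (simp add: mem_V)

lemma monI_V: "monI (V \<phi> n)"
  unfolding V_def by (rule monI_gen)

lemma V_mult: 
  assumes "superadd \<phi>"
  shows "V \<phi> m * V \<phi> n \<le> (V \<phi> (m + n) :: ('v::finite, 'k::field) mpoly idl)"
  unfolding idl_times_le_iff mem_V[OF assms]
proof (intro allI impI ballI)
  fix f g :: "('v, 'k) mpoly" and k
  assume "\<forall>k\<in>Poly_Mapping.keys f. m \<le> \<phi> k" "\<forall>k\<in>Poly_Mapping.keys g. n \<le> \<phi> k"
    and "k \<in> Poly_Mapping.keys (f * g)"
  then obtain i j where "k = i + j" "m \<le> \<phi> i" "n \<le> \<phi> j" by (blast dest: keys_multD)
  moreover from this have "\<phi> i + \<phi> j \<le> \<phi> k" using assms unfolding superadd_def by blast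
  ultimately show "m + n \<le> \<phi> k" by linarith
qed

lemma V_anti: "m \<le> n \<Longrightarrow> V \<phi> n \<le> V \<phi> m"
  unfolding V_def by (auto simp: gen_le_iff intro!: gen_mem)

lemma V_power: "superadd \<phi> \<Longrightarrow> A \<le> V \<phi> m \<Longrightarrow> A ^ n \<le> V \<phi> (n * m)"
proof (induction n)
  case 0
  then show ?case by (simp add: le_idl mem_V)
next
  case (Suc n)
  then show ?case using V_mult[of \<phi> m "n * m"] idl_mult_mono[of A "V \<phi> m" "A ^ n"] by (auto intro: order_trans)
qed

section \<open>Linear algebra over the coefficient field\<close>

text \<open>Instead of inverting a matrix, the value at one scalar \<open>l0\<close> is subtracted
  and the unit \<open>l - l0\<close> divided out. The divided difference, with coefficients
  \<open>d j\<close>, has smaller degree, and the \<open>c j\<close> are recovered from the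
  \<open>d j\<close>.\<close>

lemma vandermonde_mem:
  fixes c :: "nat \<Rightarrow> ('v::finite, 'k::field) mpoly"
  assumes "infinite \<Gamma>" "\<And>l. l \<in> \<Gamma> \<Longrightarrow> (\<Sum>i\<le>n. c i * cst l ^ i) \<in>\<^sub>i I" "i \<le> n"
  shows "c i \<in>\<^sub>i I"
  using assms
proof (induction n arbitrary: c \<Gamma> i)
  case 0
  then obtain l where "l \<in> \<Gamma>" by (metis finite.emptyI ex_in_conv)
  then show ?case using 0 by fastforce
next
  case (Suc n)
  obtain l0 where l0: "l0 \<in> \<Gamma>" using Suc.prems(1) by (metis finite.emptyI ex_in_conv)
  define d where "d j = (\<Sum>k=Suc j..Suc n. c k * cst l0 ^ (k - Suc j))" for j
  have d: "d j \<in>\<^sub>i I" if "j \<le> n" for j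
  proof (rule Suc.IH)
    show "infinite (\<Gamma> - {l0})" using Suc.prems(1) by simp
    fix l assume l: "l \<in> \<Gamma> - {l0}"
    have "(\<Sum>i\<le>Suc n. c i * cst l ^ i) - (\<Sum>i\<le>Suc n. c i * cst l0 ^ i) \<in>\<^sub>i I"
      using l l0 by (intro mem_diff Suc.prems(2)) auto
    also have "(\<Sum>i\<le>Suc n. c i * cst l ^ i) - (\<Sum>i\<le>Suc n. c i * cst l0 ^ i)
        = (cst l - cst l0) * (\<Sum>j<Suc n. \<Sum>k=Suc j..Suc n. c k * cst l0 ^ (k - Suc j) * cst l ^ j)"
      by (rule sub_polyfun)
    also have "(\<Sum>j<Suc n. \<Sum>k=Suc j..Suc n. c k * cst l0 ^ (k - Suc j) * cst l ^ j) = (\<Sum>j\<le>n. d j * cst l ^ j)"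
      by (simp only: d_def sum_distrib_right lessThan_Suc_atMost)
    finally have *: "(cst l - cst l0) * (\<Sum>j\<le>n. d j * cst l ^ j) \<in>\<^sub>i I" .
    have "cst (1 / (l - l0)) * (cst l - cst l0) = (1 :: ('v, 'k) mpoly)"
      using l by (simp add: mult_single flip: single_diff)
    then have "(\<Sum>j\<le>n. d j * cst l ^ j) = cst (1 / (l - l0)) * ((cst l - cst l0) * (\<Sum>j\<le>n. d j * cst l ^ j))"
      by (simp flip: mult.assoc)
    then show "(\<Sum>j\<le>n. d j * cst l ^ j) \<in>\<^sub>i I"
      using mem_mult_left[OF *, of "cst (1 / (l - l0))"] by simp
  qed (use that in simp)
  have cS: "c (Suc j) \<in>\<^sub>i I" if "j \<le> n" for j
  proof -
    have "d j = c (Suc j) + (\<Sum>k=Suc (Suc j)..Suc n. c k * cst l0 ^ (k - Suc j))"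
      unfolding d_def using that by (subst sum.atLeast_Suc_atMost) auto
    also have "(\<Sum>k=Suc (Suc j)..Suc n. c k * cst l0 ^ (k - Suc j)) = cst l0 * d (Suc j)"
      unfolding d_def sum_distrib_left
    proof (rule sum.cong)
      fix k assume "k \<in> {Suc (Suc j)..Suc n}"
      then have "k - Suc j = Suc (k - Suc (Suc j))" by auto
      then show "c k * cst l0 ^ (k - Suc j) = cst l0 * (c k * cst l0 ^ (k - Suc (Suc j)))"
        by (simp add: mult_ac)
    qed simp
    finally have "c (Suc j) = d j - cst l0 * d (Suc j)" by simp
    moreover have "d (Suc j) \<in>\<^sub>i I"
      using d[of "Suc j"] by (cases "Suc j \<le> n") (simp_all add: d_def)
    ultimately show ?thesis using d[OF that] by auto
  qed
  show ?case
  proof (cases i)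
    case 0
    have "(\<Sum>i\<le>Suc n. c i * cst l0 ^ i) - (\<Sum>i\<le>n. c (Suc i) * cst l0 ^ Suc i) \<in>\<^sub>i I"
      by (intro mem_diff Suc.prems(2)[OF l0] mem_sum mem_mult_right cS) simp
    then show ?thesis unfolding 0 by (simp add: sum.atMost_Suc_shift del: sum.atMost_Suc)
  next
    case (Suc j)
    then show ?thesis using cS Suc.prems by simp
  qed
qed

lemma nontrivial_relation:
  fixes \<kappa> :: "'i \<Rightarrow> 't \<Rightarrow> 'k::field"
  assumes "finite T" "finite S" "card T < card S"
  shows "\<exists>G. (\<exists>i\<in>S. G i \<noteq> 0) \<and> (\<forall>t\<in>T. (\<Sum>i\<in>S. G i * \<kappa> i t) = 0)"
  using assms
proof (induction T arbitrary: S \<kappa> rule: finite_induct)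
  case empty
  then obtain i where "i \<in> S" by fastforce
  then show ?case by (intro exI[of _ "\<lambda>_. 1"]) auto
next
  case (insert t0 T)
  show ?case
  proof (cases "\<exists>i0\<in>S. \<kappa> i0 t0 \<noteq> 0")
    case False
    then have "\<forall>i\<in>S. \<kappa> i t0 = 0" by blast
    moreover obtain G where "\<exists>i\<in>S. G i \<noteq> 0" "\<forall>t\<in>T. (\<Sum>i\<in>S. G i * \<kappa> i t) = 0"
      using insert.IH[of S \<kappa>] insert.prems insert.hyps by auto
    ultimately show ?thesis by (intro exI[of _ G]) auto
  next
    case True
    then obtain i0 where i0: "i0 \<in> S" "\<kappa> i0 t0 \<noteq> 0" by blast
    let ?S = "S - {i0}"
    define \<kappa>' where "\<kappa>' i t = \<kappa> i t - \<kappa> i t0 / \<kappa> i0 t0 * \<kappa> i0 t" for i t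
    have "card T < card ?S" using insert i0 by simp
    then obtain G where G: "\<exists>i\<in>?S. G i \<noteq> 0" "\<forall>t\<in>T. (\<Sum>i\<in>?S. G i * \<kappa>' i t) = 0"
      using insert.IH[of ?S \<kappa>'] insert.prems by auto
    define g0 where "g0 = - (\<Sum>i\<in>?S. G i * \<kappa> i t0) / \<kappa> i0 t0"
    define G' where "G' = G(i0 := g0)"
    have split: "(\<Sum>i\<in>S. G' i * \<kappa> i t) = g0 * \<kappa> i0 t + (\<Sum>i\<in>?S. G i * \<kappa> i t)" for t
      using insert.prems i0 by (subst sum.remove[of S i0]) (auto simp: G'_def intro!: sum.cong)
    have "(\<Sum>i\<in>S. G' i * \<kappa> i t) = (\<Sum>i\<in>?S. G i * \<kappa>' i t)" for t
    proof -
      have "(\<Sum>i\<in>?S. G i * \<kappa>' i t) = (\<Sum>i\<in>?S. G i * \<kappa> i t) - (\<Sum>i\<in>?S. G i * \<kappa> i t0) / \<kappa> i0 t0 * \<kappa> i0 t"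
        unfolding \<kappa>'_def sum_distrib_right sum_divide_distrib
        by (simp add: sum_subtractf right_diff_distrib mult_ac)
      then show ?thesis unfolding split g0_def by simp
    qed
    then have "\<forall>t\<in>T. (\<Sum>i\<in>S. G' i * \<kappa> i t) = 0" using G by simp
    moreover have "(\<Sum>i\<in>S. G' i * \<kappa> i t0) = 0" unfolding split g0_def using i0 by simp
    moreover have "\<exists>i\<in>S. G' i \<noteq> 0" using G(1) by (auto simp: G'_def)
    ultimately show ?thesis by blast
  qed
qed

lemma finite_box: "finite {m :: 'v::finite \<Rightarrow>\<^sub>0 nat. \<forall>v. lkp m v < b v}"
proof (rule finite_imageD)
  have "lkp ` {m. \<forall>v. lkp m v < b v} \<subseteq> Pi\<^sub>E UNIV (\<lambda>v. {..<b v})" by auto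
  then show "finite (lkp ` {m. \<forall>v. lkp m v < b v})"
    by (rule finite_subset) (simp add: finite_PiE)
  show "inj_on lkp {m. \<forall>v. lkp m v < b v}"
    by (rule inj_onI, rule poly_mapping_eqI) simp
qed

interpretation kvs: vector_space "\<lambda>c f. cst c * (f :: ('v::finite, 'k::field) mpoly)"
  by unfold_locales
    (simp_all add: distrib_left distrib_right single_add mult_single flip: mult.assoc)

text \<open>Modulo the given pure powers only the finitely many monomials of a box survive. A vector
  space basis of the elements of \<open>H\<close> supported in the box, together with the pure
  powers, therefore generates \<open>H\<close>.\<close>

lemma fin_gen:
  fixes H :: "('v::finite, 'k::field) mpoly idl"
  assumes pow: "\<And>v. mon (Poly_Mapping.single v (b v)) \<in>\<^sub>i H"
  obtains S where "finite S" "H = gen S"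
proof -
  define B where "B = {m :: 'v \<Rightarrow>\<^sub>0 nat. \<forall>v. lkp m v < b v}"
  have finB: "finite B" unfolding B_def by (rule finite_box)
  define T where "T = {f. f \<in>\<^sub>i H \<and> Poly_Mapping.keys f \<subseteq> B}"
  obtain Bs where Bs: "Bs \<subseteq> T" "kvs.independent Bs" "T \<subseteq> kvs.span Bs"
    using kvs.maximal_independent_subset .
  have "T \<subseteq> kvs.span (mon ` B)"
  proof
    fix f assume f: "f \<in> T"
    have "(\<Sum>k\<in>Poly_Mapping.keys f. cst (lkp f k) * mon k) \<in> kvs.span (mon ` B)"
      using f by (intro kvs.span_sum kvs.span_scale kvs.span_base) (auto simp: T_def)
    then show "f \<in> kvs.span (mon ` B)" by (simp flip: mpoly_sum)
  qed
  then have finBs: "finite Bs"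
    using kvs.independent_span_bound[of "mon ` B" Bs] finB Bs by auto
  define P where "P = range (\<lambda>v. mon (Poly_Mapping.single v (b v)) :: ('v, 'k) mpoly)"
  have "H = gen (Bs \<union> P)"
  proof (rule antisym)
    show "gen (Bs \<union> P) \<le> H" using Bs(1) pow by (auto simp: gen_le_iff T_def P_def)
    show "H \<le> gen (Bs \<union> P)"
      unfolding le_idl
    proof (intro allI impI)
      fix f assume f: "f \<in>\<^sub>i H"
      define f2 where "f2 = (\<Sum>k\<in>Poly_Mapping.keys f - B. cst (lkp f k) * mon k)"
      have "mon k \<in>\<^sub>i gen P" if k: "k \<notin> B" for k
      proof -
        obtain v where v: "b v \<le> lkp k v"
          using k unfolding B_def mem_Collect_eq by (meson linorder_not_less)
        have "lkp (Poly_Mapping.single v (b v)) u \<le> lkp k u" for u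
          using v by (auto simp: lookup_single when_def)
        then obtain n where "k = Poly_Mapping.single v (b v) + n" by (rule pm_le_obtain)
        then show ?thesis by (auto simp: P_def intro!: mon_mem_add)
      qed
      then have f2: "f2 \<in>\<^sub>i gen P" unfolding f2_def by (intro mem_sum mem_mult_left) auto
      have PB: "gen P \<le> gen (Bs \<union> P)" "gen Bs \<le> gen (Bs \<union> P)" by (auto simp: gen_le_iff)
      have "gen P \<le> H" using pow by (auto simp: gen_le_iff P_def)
      have split: "f = (\<Sum>k\<in>Poly_Mapping.keys f \<inter> B. cst (lkp f k) * mon k) + f2"
        unfolding f2_def
        by (subst mpoly_sum[of f], subst sum.Int_Diff[of _ _ B]) simp_all
      have "f - f2 \<in> T"
      proof -
        have "f - f2 \<in>\<^sub>i H" using f f2 \<open>gen P \<le> H\<close> by (blast intro: memD mem_diff)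
        moreover have "Poly_Mapping.keys (f - f2) \<subseteq> B"
        proof
          fix k assume "k \<in> Poly_Mapping.keys (f - f2)"
          also have "f - f2 = (\<Sum>k\<in>Poly_Mapping.keys f \<inter> B. cst (lkp f k) * mon k)"
            using split by (simp add: algebra_simps)
          also have "Poly_Mapping.keys \<dots> \<subseteq> (\<Union>k\<in>Poly_Mapping.keys f \<inter> B. Poly_Mapping.keys (cst (lkp f k) * mon k))"
            by (rule keys_sum)
          also have "\<dots> \<subseteq> B" by (auto simp: mult_single split: if_splits)
          finally show "k \<in> B" .
        qed
        ultimately show ?thesis by (simp add: T_def)
      qed
      then have "f - f2 \<in> kvs.span Bs" using Bs(3) by blast
      moreover have "kvs.span Bs \<subseteq> {x. x \<in>\<^sub>i gen Bs}"
        by (rule kvs.span_minimal) (auto simp: kvs.subspace_def)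
      ultimately have "(f - f2) + f2 \<in>\<^sub>i gen (Bs \<union> P)" using f2 PB by (blast intro: memD mem_add)
      then show "f \<in>\<^sub>i gen (Bs \<union> P)" by simp
    qed
  qed
  then show ?thesis using that[of "Bs \<union> P"] finBs by (simp add: P_def)
qed

section \<open>Ideals generated by powers of the variables\<close>

locale power_ideal =
  fixes a :: "'v::finite \<Rightarrow> nat" and J :: "('v, 'k::field) mpoly idl"
  assumes a_pos: "\<And>v. 0 < a v"
    and J_def: "J = (\<Sum>v\<in>UNIV. pr (mon (Poly_Mapping.single v (a v))))"
    and inf_k: "infinite (UNIV :: 'k set)"
begin

definition y :: "'v \<Rightarrow> ('v, 'k) mpoly" where "y v = mon (Poly_Mapping.single v (a v))"
definition ord :: "('v \<Rightarrow>\<^sub>0 nat) \<Rightarrow> nat" where "ord m = (\<Sum>v\<in>UNIV. lkp m v div a v)"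
definition L :: nat where "L = (\<Prod>v\<in>UNIV. a v)"
text \<open>Chosen so that \<open>a v * w v = L\<close> for every \<open>v\<close>: all generators
  \<open>y v\<close> of \<open>J\<close> get the same weight.\<close>

definition w :: "'v \<Rightarrow> nat" where "w v = (\<Prod>u\<in>UNIV - {v}. a u)"
definition wt :: "('v \<Rightarrow>\<^sub>0 nat) \<Rightarrow> nat" where "wt m = (\<Sum>v\<in>UNIV. lkp m v * w v)"

abbreviation F :: "nat \<Rightarrow> ('v, 'k) mpoly idl" where "F \<equiv> V wt"

lemma L_pos: "0 < L" unfolding L_def using a_pos by (simp add: prod_pos)
lemma w_pos: "0 < w v" unfolding w_def using a_pos by (simp add: prod_pos)
lemma a_w: "a v * w v = L" unfolding w_def L_def by (subst prod.remove[of UNIV v]) auto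

lemma wt_add: "wt (m + n) = wt m + wt n"
  by (simp add: wt_def lookup_add distrib_right sum.distrib)

lemma superadd_wt [simp]: "superadd wt"
  by (simp add: superadd_def wt_add)

lemma superadd_ord [simp]: "superadd ord"
  unfolding superadd_def ord_def lookup_add sum.distrib[symmetric]
  by (intro allI sum_mono) (metis div_add1_eq le_add1)

lemma ord_single_add: "ord (Poly_Mapping.single v (c * a v) + m) = c + ord m"
proof -
  have "ord (Poly_Mapping.single v (c * a v) + m) = (\<Sum>u\<in>UNIV. (if u = v then c else 0) + lkp m u div a u)"
    unfolding ord_def lookup_add using a_pos
    by (intro sum.cong) (auto simp: lookup_single when_def)
  then show ?thesis by (simp add: sum.distrib ord_def)
qed

lemma wt_single: "wt (Poly_Mapping.single v (c * a v)) = c * L"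
proof -
  have "wt (Poly_Mapping.single v (c * a v)) = (\<Sum>u\<in>UNIV. if u = v then c * L else 0)"
    unfolding wt_def by (intro sum.cong) (auto simp: lookup_single when_def mult.assoc a_w)
  then show ?thesis by simp
qed

lemma y_power: "y v ^ c = mon (Poly_Mapping.single v (c * a v))"
  by (induction c) (simp_all add: y_def mult_single single_add[symmetric] add.commute)

lemma J_y: "J = (\<Sum>v\<in>UNIV. pr (y v))"
  by (simp add: J_def y_def)

lemma y_mem_J: "y v \<in>\<^sub>i J"
  using mem_sum_idl[of UNIV v "\<lambda>v. pr (y v)"] by (simp add: J_y)

lemma ord_pos_obtain:
  assumes "1 \<le> ord k" obtains v k' where "k = Poly_Mapping.single v (a v) + k'"
proof -
  have "\<exists>v. a v \<le> lkp k v"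
  proof (rule ccontr)
    assume "\<nexists>v. a v \<le> lkp k v"
    then have "ord k = 0" by (simp add: ord_def linorder_not_le)
    then show False using assms by simp
  qed
  then obtain v where v: "a v \<le> lkp k v" ..
  have "lkp (Poly_Mapping.single v (a v)) u \<le> lkp k u" for u
    using v by (auto simp: lookup_single when_def)
  then show ?thesis by (rule pm_le_obtain) (rule that)
qed

lemma J_power: "J ^ n = V ord n"
proof (rule antisym)
  have "ord (Poly_Mapping.single v (a v)) = 1" for v
    using ord_single_add[of v 1 0] by (simp add: ord_def)
  then have "J \<le> V ord 1"
    by (simp add: J_def sum_idl_le_iff mon_mem_V)
  then show "J ^ n \<le> V ord n" using V_power[of ord J 1 n] by simp
next
  show "V ord n \<le> J ^ n"
  proof (induction n)
    case (Suc n)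
    have "mon m \<in>\<^sub>i J ^ Suc n" if m: "Suc n \<le> ord m" for m
    proof -
      have "\<exists>v. a v \<le> lkp m v"
      proof (rule ccontr)
        assume "\<nexists>v. a v \<le> lkp m v"
        then have "ord m = 0" by (simp add: ord_def linorder_not_le)
        then show False using m by simp
      qed
      then obtain v where v: "a v \<le> lkp m v" ..
      have "lkp (Poly_Mapping.single v (a v)) u \<le> lkp m u" for u
        using v by (auto simp: lookup_single when_def)
      then obtain m' where m': "m = Poly_Mapping.single v (a v) + m'" by (rule pm_le_obtain)
      then have "n \<le> ord m'" using m ord_single_add[of v 1 m'] by simp
      then have "(mon m' :: ('v, 'k) mpoly) \<in>\<^sub>i V ord n" by (simp add: mon_mem_V)
      then have "mon m' \<in>\<^sub>i J ^ n" using Suc.IH by (rule memD)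
      then have "y v * mon m' \<in>\<^sub>i J * J ^ n" by (intro mem_times y_mem_J)
      then show ?thesis by (simp add: m' y_def mult_single)
    qed
    then show ?case unfolding V_def by (auto simp: gen_le_iff)
  qed simp
qed

lemma mem_J_power: "f \<in>\<^sub>i J ^ n \<longleftrightarrow> (\<forall>k\<in>Poly_Mapping.keys f. n \<le> ord k)"
  by (simp add: J_power mem_V)

lemma monI_J: "monI J"
  using J_power[of 1] monI_V by (metis power_one_right)

lemma y_cancel: "y v ^ c * f \<in>\<^sub>i J ^ (c + n) \<longleftrightarrow> f \<in>\<^sub>i J ^ n"
  by (simp add: mem_J_power y_power keys_mon_mult ord_single_add)

lemma y_cancel1: "y v * f \<in>\<^sub>i J ^ Suc n \<longleftrightarrow> f \<in>\<^sub>i J ^ n"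
  using y_cancel[of v 1 f n] by simp

text \<open>Rounding down in \<open>ord\<close> loses less than one block of weight \<open>L\<close>
  per variable. Together with \<open>J_le_F\<close> this makes the filtrations by \<open>F\<close>
  and by powers of \<open>J\<close> cofinal.\<close>

lemma wt_le_ord: "wt m \<le> (ord m + CARD('v)) * L"
proof -
  have "lkp m v * w v \<le> (lkp m v div a v) * L + L" for v
  proof -
    have "lkp m v \<le> (lkp m v div a v) * a v + a v"
      using div_mult_mod_eq[of "lkp m v" "a v"] mod_less_divisor[OF a_pos, of "lkp m v" v] by linarith
    then have "lkp m v * w v \<le> ((lkp m v div a v) * a v + a v) * w v" by (rule mult_le_mono1)
    then show ?thesis by (simp add: distrib_right mult.assoc a_w)
  qed
  then have "wt m \<le> (\<Sum>v\<in>UNIV. (lkp m v div a v) * L + L)" unfolding wt_def by (intro sum_mono)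
  then show ?thesis by (simp add: sum.distrib ord_def sum_distrib_right distrib_right)
qed

lemma F_le_J: "(m + CARD('v)) * L \<le> n \<Longrightarrow> F n \<le> J ^ m"
  unfolding le_idl J_power
proof (intro allI impI)
  fix f assume n: "(m + CARD('v)) * L \<le> n" and f: "f \<in>\<^sub>i F n"
  have "m \<le> ord k" if "k \<in> Poly_Mapping.keys f" for k
  proof -
    have "(m + CARD('v)) * L \<le> (ord k + CARD('v)) * L"
      using n f that wt_le_ord[of k] unfolding mem_V[OF superadd_wt] by (meson order_trans)
    then show ?thesis using L_pos by simp
  qed
  then show "f \<in>\<^sub>i V ord m" by (simp add: mem_V)
qed

lemma J_le_F: "J ^ m \<le> F (m * L)"
proof -
  have "J \<le> F L"
    using wt_single[of _ 1] by (simp add: J_def sum_idl_le_iff mon_mem_V)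
  then show ?thesis by (intro V_power) simp_all
qed

lemma fin_gen_J:
  assumes "J ^ n \<le> H" obtains S where "finite S" "H = gen S"
proof (rule fin_gen[of "\<lambda>v. n * a v" H])
  fix v show "mon (Poly_Mapping.single v (n * a v)) \<in>\<^sub>i H"
    using memD[OF mem_power[OF y_mem_J, of v n] assms] by (simp add: y_power)
qed (rule that)

end

section \<open>General elements of a reduction\<close>

locale monomial_reduction = power_ideal a J
  for a :: "'v::finite \<Rightarrow> nat" and J :: "('v, 'k::field) mpoly idl" +
  fixes I :: "('v, 'k) mpoly idl"
  assumes monI_I: "monI I" and red: "reduction J I"
begin

lemma J_le_I: "J \<le> I"
  using red by (simp add: reduction_def)

lemma y_mem_I: "y v \<in>\<^sub>i I"
  by (rule memD[OF y_mem_J J_le_I])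

lemma mon_power_wt: "\<exists>k'. mon k ^ n = (mon k' :: ('v, 'k) mpoly) \<and> wt k' = n * wt k"
proof (induction n)
  case 0
  then show ?case by (intro exI[of _ 0]) (simp add: wt_def)
next
  case (Suc n)
  then obtain k' where "mon k ^ n = (mon k' :: ('v, 'k) mpoly)" "wt k' = n * wt k" by blast
  then show ?case by (intro exI[of _ "k + k'"]) (simp add: mult_single wt_add)
qed

text \<open>Let \<open>m\<close> be an exponent of least weight in \<open>I\<close>. Its power
  \<open>Suc r\<close> lies in \<open>J * I ^ r\<close>, whose monomials weigh at least
  \<open>L + r * wt m\<close>; comparison gives \<open>L \<le> wt m\<close>.\<close>

lemma I_le_F: "I \<le> F L"
proof (rule ccontr)
  assume "\<not> I \<le> F L"
  then obtain f k where "f \<in>\<^sub>i I" "k \<in> Poly_Mapping.keys f" "wt k < L"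
    by (auto simp: le_idl mem_V not_le_imp_less linorder_not_le)
  then have k: "mon k \<in>\<^sub>i I" "wt k < L" using monI_I unfolding monI_def by blast+
  from ex_has_least_nat[of "\<lambda>k. mon k \<in>\<^sub>i I" k wt, OF k(1)] obtain m
    where m: "mon m \<in>\<^sub>i I" and least: "\<And>k. mon k \<in>\<^sub>i I \<Longrightarrow> wt m \<le> wt k" by blast
  have I_le: "I \<le> F (wt m)"
    using monI_I least unfolding le_idl monI_def by (auto simp: mem_V)
  from red obtain r where r: "I ^ Suc r = J * I ^ r" by (auto simp: reduction_def)
  obtain k' where k': "mon m ^ Suc r = (mon k' :: ('v, 'k) mpoly)" "wt k' = Suc r * wt m"
    using mon_power_wt by blast
  have "mon m ^ Suc r \<in>\<^sub>i J * I ^ r" using mem_power[OF m, of "Suc r"] unfolding r .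
  then have "(mon k' :: ('v, 'k) mpoly) \<in>\<^sub>i J * I ^ r" unfolding k'(1) .
  then obtain p q where pq: "k' = p + q" "mon p \<in>\<^sub>i J" "mon q \<in>\<^sub>i I ^ r"
    using mon_mem_times[OF monI_J monI_power[OF monI_I]] by blast
  have "L \<le> wt p" using memD[OF pq(2) J_le_F[of 1, simplified]] by (simp add: mon_mem_V)
  moreover have "r * wt m \<le> wt q"
    using memD[OF pq(3) V_power[OF superadd_wt I_le]] by (simp add: mon_mem_V)
  ultimately have "L + r * wt m \<le> Suc r * wt m" using pq(1) k'(2) by (simp add: wt_add)
  then show False using least[OF k(1)] k(2) by simp
qed

lemma I_power_le_F: "I ^ m \<le> F (m * L)"
  using V_power[OF superadd_wt I_le_F] .

section \<open>Powers of \<open>I\<close> modulo terms of higher weight\<close>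

definition D :: "nat \<Rightarrow> ('v, 'k) mpoly idl" where
  "D m = inf (I ^ m) (F (Suc (m * L)))"

text \<open>The quotients of \<open>I ^ m\<close> by \<open>D m\<close> are the components of a
  graded algebra, spanned by the monomials of weight exactly \<open>m * L\<close>.
  \<open>Q U m\<close> is the degree-\<open>m\<close> part of the ideal generated there by
  \<open>U\<close> in degree one, which explains the value \<open>0\<close> at
  \<open>m = 0\<close>.\<close>

definition Q :: "('v, 'k) mpoly idl \<Rightarrow> nat \<Rightarrow> ('v, 'k) mpoly idl" where
  "Q U m = (if m = 0 then 0 else U * I ^ (m - 1)) + D m"

lemma D_mult: "D m * I ^ n \<le> D (m + n)"
proof -
  have "D m * I ^ n \<le> I ^ m * I ^ n" by (rule idl_mult_mono) (simp_all add: D_def)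
  moreover have "D m * I ^ n \<le> F (Suc (m * L)) * F (n * L)"
    by (rule idl_mult_mono) (simp_all add: D_def I_power_le_F)
  moreover have "F (Suc (m * L)) * F (n * L) \<le> (F (Suc ((m + n) * L)) :: ('v, 'k) mpoly idl)"
    using V_mult[OF superadd_wt, of "Suc (m * L)" "n * L"] by (simp add: distrib_right)
  ultimately show ?thesis unfolding D_def[of "m + n"] power_add by (blast intro: order_trans le_infI)
qed

lemma Q_mult: "Q U m * I ^ n \<le> Q U (m + n)"
proof (cases m)
  case 0
  then show ?thesis using D_mult[of 0 n] by (auto simp: Q_def intro: order_trans)
next
  case (Suc k)
  have "Q U m * I ^ n = U * I ^ (k + n) + D m * I ^ n"
    by (simp add: Q_def Suc distrib_right power_add mult.assoc)
  also have "\<dots> \<le> Q U (m + n)"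
    unfolding Q_def using D_mult[of m n] Suc by (auto intro: order_trans)
  finally show ?thesis .
qed

lemma Q_mono: "U \<le> U' \<Longrightarrow> Q U m \<le> Q U' m"
  unfolding Q_def by (auto intro: order_trans[OF idl_mult_mono idl_le_add1])

lemma D_le_Q: "D m \<le> Q U m"
  by (simp add: Q_def)

text \<open>\<open>U\<close> behaves as a reduction of \<open>I\<close> up to terms of higher
  weight; \<open>RED_lift\<close> later makes the error arbitrarily small.\<close>

definition RED :: "('v, 'k) mpoly idl \<Rightarrow> bool" where
  "RED U \<longleftrightarrow> U \<le> I \<and> (\<exists>m. I ^ Suc m \<le> Q U (Suc m))"

lemma RED_all:
  assumes "RED U" obtains M where "\<And>m. m \<ge> M \<Longrightarrow> I ^ Suc m \<le> Q U (Suc m)"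
proof -
  from assms obtain M where M: "I ^ Suc M \<le> Q U (Suc M)" by (auto simp: RED_def)
  have "I ^ Suc (M + n) \<le> Q U (Suc (M + n))" for n
    using order_trans[OF idl_mult_mono[OF M order_refl] Q_mult, of n]
    by (metis add_Suc power_add)
  then show ?thesis using that by (metis le_add_diff_inverse)
qed

lemma finite_wt_eq: "finite {t. wt t = n}"
proof (rule finite_subset)
  show "{t. wt t = n} \<subseteq> {m. \<forall>v. lkp m v < (\<lambda>_. Suc n) v}"
  proof safe
    fix t v assume "n = wt t"
    have "lkp t v * 1 \<le> lkp t v * w v" using w_pos[of v] by (intro mult_le_mono2) simp
    also have "\<dots> \<le> wt t" unfolding wt_def by (rule member_le_sum) auto
    finally show "lkp t v < Suc (wt t)" by simp
  qed
qed (rule finite_box)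

text \<open>Modulo \<open>Q U e\<close> the powers of \<open>I\<close> have bounded dimension over the field, so the
  \<open>e + 1\<close> products \<open>p\<^sup>i q\<^sup>e\<^sup>-\<^sup>i\<close> become dependent.\<close>

lemma binary_relation:
  assumes z: "z \<in>\<^sub>i I" and RED: "RED (pr z + U)" and p: "p \<in>\<^sub>i I" and q: "q \<in>\<^sub>i I"
  obtains e G where "e \<ge> 1" "\<exists>i\<le>e. G i \<noteq> 0" "(\<Sum>i\<le>e. cst (G i) * (p ^ i * q ^ (e - i))) \<in>\<^sub>i Q U e"
proof -
  obtain M where M: "\<And>m. m \<ge> M \<Longrightarrow> I ^ Suc m \<le> Q (pr z + U) (Suc m)" using RED_all[OF RED] by blast
  \<comment> \<open>These finitely many monomials span \<open>I ^ M\<close> modulo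
    \<open>D M\<close>.\<close>
  define T where "T = {t. mon t \<in>\<^sub>i I ^ M \<and> wt t = M * L}"
  have finT: "finite T" unfolding T_def by (rule finite_subset[OF _ finite_wt_eq[of "M * L"]]) auto
  \<comment> \<open>From degree \<open>M\<close> on, each further degree is \<open>z\<close> times
    the previous one modulo \<open>Q U\<close>. So the same \<open>T\<close>, multiplied by
    \<open>z ^ n\<close>, spans degree \<open>M + n\<close>, and the dimension bound does not depend
    on \<open>n\<close>.\<close>
  have span: "\<exists>\<kappa>. f - (\<Sum>t\<in>T. cst (\<kappa> t) * (z ^ n * mon t)) \<in>\<^sub>i Q U (M + n)" if "f \<in>\<^sub>i I ^ (M + n)" for f n
    using that
  proof (induction n arbitrary: f)
    case 0
    define g where "g = f - (\<Sum>t\<in>T. cst (lkp f t) * mon t)"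
    have lg: "lkp g k = (if k \<in> T then 0 else lkp f k)" for k
    proof -
      have "lkp (\<Sum>t\<in>T. cst (lkp f t) * mon t) k = (\<Sum>t\<in>T. if t = k then lkp f k else 0)"
        unfolding lookup_sum by (rule sum.cong) (auto simp: mult_single lookup_single when_def)
      then show ?thesis using finT by (simp add: g_def lookup_minus)
    qed
    have "g \<in>\<^sub>i D M"
    proof (rule mem_of_keys)
      fix k assume "k \<in> Poly_Mapping.keys g"
      then have k: "k \<notin> T" "k \<in> Poly_Mapping.keys f" by (auto simp: in_keys_iff lg split: if_splits)
      then have kI: "mon k \<in>\<^sub>i I ^ M" using 0 monI_power[OF monI_I] unfolding monI_def by auto
      then have "M * L \<le> wt k" using memD[OF kI I_power_le_F] by (simp add: mon_mem_V)
      then have "Suc (M * L) \<le> wt k" using k kI by (auto simp: T_def)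
      then show "mon k \<in>\<^sub>i D M" using kI by (simp add: D_def mem_inf mon_mem_V)
    qed
    then show ?case
      using memD[OF _ D_le_Q] by (intro exI[of _ "lkp f"]) (simp add: g_def)
  next
    case (Suc n)
    have "f \<in>\<^sub>i pr z * I ^ (M + n) + Q U (Suc (M + n))"
      using memD[OF Suc.prems, of "Q (pr z + U) (Suc (M + n))"] M[of "M + n"]
      by (simp add: Q_def distrib_right add.assoc)
    then obtain g b where f: "f = z * g + b" "g \<in>\<^sub>i I ^ (M + n)" "b \<in>\<^sub>i Q U (Suc (M + n))"
      by (auto simp: mem_plus[of _ "pr z * I ^ (M + n)"] mem_pr_mult)
    obtain \<kappa> where \<kappa>: "g - (\<Sum>t\<in>T. cst (\<kappa> t) * (z ^ n * mon t)) \<in>\<^sub>i Q U (M + n)"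
      using Suc.IH[OF f(2)] by blast
    have "(g - (\<Sum>t\<in>T. cst (\<kappa> t) * (z ^ n * mon t))) * z \<in>\<^sub>i Q U (M + n + 1)"
      by (rule memD[OF mem_times[OF \<kappa>] Q_mult[of U _ 1]]) (simp add: z)
    then have "z * (g - (\<Sum>t\<in>T. cst (\<kappa> t) * (z ^ n * mon t))) + b \<in>\<^sub>i Q U (M + Suc n)"
      using f(3) by (simp add: mem_add mult.commute)
    also have "z * (g - (\<Sum>t\<in>T. cst (\<kappa> t) * (z ^ n * mon t))) + b
        = f - (\<Sum>t\<in>T. cst (\<kappa> t) * (z ^ Suc n * mon t))"
      by (simp add: f(1) right_diff_distrib sum_distrib_left mult_ac)
    finally show ?case by blast
  qed
  define n where "n = Suc (card T)"
  define e where "e = M + n"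
  have pq: "p ^ i * q ^ (e - i) \<in>\<^sub>i I ^ (M + n)" if "i \<le> e" for i
  proof -
    have "p ^ i * q ^ (e - i) \<in>\<^sub>i I ^ i * I ^ (e - i)" by (intro mem_times mem_power p q)
    then show ?thesis using that by (simp add: e_def flip: power_add)
  qed
  then have "\<forall>i. \<exists>\<kappa>. i \<le> e \<longrightarrow> p ^ i * q ^ (e - i) - (\<Sum>t\<in>T. cst (\<kappa> t) * (z ^ n * mon t)) \<in>\<^sub>i Q U e"
    using span unfolding e_def by meson
  from choice[OF this] obtain \<kappa> where \<kappa>: "\<And>i. i \<le> e \<Longrightarrow> p ^ i * q ^ (e - i) - (\<Sum>t\<in>T. cst (\<kappa> i t) * (z ^ n * mon t)) \<in>\<^sub>i Q U e"
    by blast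
  have "card T < card {..e}" by (simp add: e_def n_def)
  then obtain G where G: "\<exists>i\<in>{..e}. G i \<noteq> 0" "\<forall>t\<in>T. (\<Sum>i\<in>{..e}. G i * \<kappa> i t) = 0"
    using nontrivial_relation[OF finT, of "{..e}" \<kappa>] by auto
  have cst_sum: "cst (\<Sum>i\<in>S. h i) = (\<Sum>i\<in>S. cst (h i) :: ('v, 'k) mpoly)" if "finite S" for S :: "nat set" and h
    using that by (induction S rule: finite_induct) (simp_all add: single_add)
  have "(\<Sum>i\<le>e. cst (G i) * (\<Sum>t\<in>T. cst (\<kappa> i t) * (z ^ n * mon t)))
      = (\<Sum>t\<in>T. cst (\<Sum>i\<le>e. G i * \<kappa> i t) * (z ^ n * mon t))"
    unfolding sum_distrib_left cst_sum[OF finite_atMost] sum_distrib_right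
    by (subst sum.swap) (simp add: mult_single flip: mult.assoc)
  also have "\<dots> = 0" using G(2) by simp
  finally have "(\<Sum>i\<le>e. cst (G i) * (p ^ i * q ^ (e - i)))
      = (\<Sum>i\<le>e. cst (G i) * (p ^ i * q ^ (e - i) - (\<Sum>t\<in>T. cst (\<kappa> i t) * (z ^ n * mon t))))"
    by (simp add: right_diff_distrib sum_subtractf)
  moreover have "\<dots> \<in>\<^sub>i Q U e" using \<kappa> by (intro mem_sum mem_mult_left) simp
  ultimately show ?thesis using that[of e G] G(1) by (auto simp: e_def n_def)
qed

section \<open>Homogeneous elements that are nilpotent modulo \<open>Q U\<close>\<close>

definition nil :: "('v, 'k) mpoly idl \<Rightarrow> nat \<Rightarrow> ('v, 'k) mpoly \<Rightarrow> bool" where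
  "nil U m x \<longleftrightarrow> x \<in>\<^sub>i I ^ m \<and> (\<exists>e\<ge>1. x ^ e \<in>\<^sub>i Q U (e * m))"

lemma nil_add:
  assumes "nil U m x" "nil U m x'" shows "nil U m (x + x')"
proof -
  from assms obtain e f where e: "e \<ge> 1" "x ^ e \<in>\<^sub>i Q U (e * m)" and f: "f \<ge> 1" "x' ^ f \<in>\<^sub>i Q U (f * m)"
    and x: "x \<in>\<^sub>i I ^ m" "x' \<in>\<^sub>i I ^ m" unfolding nil_def by blast
  have "x ^ i * x' ^ (e + f - i) \<in>\<^sub>i Q U ((e + f) * m)" if i: "i \<le> e + f" for i
  proof (cases "e \<le> i")
    case True
    have "x ^ (i - e) * x' ^ (e + f - i) \<in>\<^sub>i (I ^ m) ^ (i - e) * (I ^ m) ^ (e + f - i)"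
      by (intro mem_times mem_power x)
    also have "(I ^ m) ^ (i - e) * (I ^ m) ^ (e + f - i) = I ^ (f * m)"
      using True i by (metis (no_types, lifting) Nat.diff_add_assoc2 add_diff_cancel_left' le_add_diff_inverse mult.commute power_add power_mult)
    finally have "x ^ e * (x ^ (i - e) * x' ^ (e + f - i)) \<in>\<^sub>i Q U (e * m + f * m)"
      by (rule memD[OF mem_times[OF e(2)] Q_mult])
    then show ?thesis using True by (simp add: distrib_right flip: power_add mult.assoc)
  next
    case False
    have "x ^ i * x' ^ (e - i) \<in>\<^sub>i (I ^ m) ^ i * (I ^ m) ^ (e - i)"
      by (intro mem_times mem_power x)
    also have "(I ^ m) ^ i * (I ^ m) ^ (e - i) = I ^ (e * m)"
      using False by (metis le_add_diff_inverse linorder_not_le mult.commute nat_less_le power_add power_mult)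
    finally have "x' ^ f * (x ^ i * x' ^ (e - i)) \<in>\<^sub>i Q U (f * m + e * m)"
      by (rule memD[OF mem_times[OF f(2)] Q_mult])
    also have "x' ^ f * (x ^ i * x' ^ (e - i)) = x ^ i * x' ^ (f + (e - i))"
      by (simp only: power_add mult_ac)
    also have "f + (e - i) = e + f - i" using False by simp
    finally show ?thesis by (simp add: distrib_right add.commute)
  qed
  then have "(x + x') ^ (e + f) \<in>\<^sub>i Q U ((e + f) * m)"
    unfolding binomial_ring by (intro mem_sum) (auto simp: mult.assoc)
  then show ?thesis using x e unfolding nil_def by (intro conjI exI[of _ "e + f"]) auto
qed

lemma nil_mult:
  assumes "nil U m x" "g \<in>\<^sub>i I ^ n" shows "nil U (m + n) (x * g)"
proof -
  from assms obtain e where e: "e \<ge> 1" "x ^ e \<in>\<^sub>i Q U (e * m)" and x: "x \<in>\<^sub>i I ^ m" unfolding nil_def by blast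
  have "g ^ e \<in>\<^sub>i I ^ (e * n)"
    using mem_power[OF assms(2), of e] by (simp flip: power_mult add: mult.commute)
  then have "x ^ e * g ^ e \<in>\<^sub>i Q U (e * m + e * n)"
    by (rule memD[OF mem_times[OF e(2)] Q_mult])
  then show ?thesis
    using e x assms(2) unfolding nil_def
    by (intro conjI exI[of _ e]) (auto simp: power_mult_distrib distrib_left power_add mem_times)
qed

lemma nil_Q: "x \<in>\<^sub>i I ^ m \<Longrightarrow> x \<in>\<^sub>i Q U m \<Longrightarrow> nil U m x"
  unfolding nil_def by (intro conjI exI[of _ 1]) auto

lemma nil_root:
  assumes "x \<in>\<^sub>i I" "f \<ge> 1" "nil U f (x ^ f)" shows "nil U 1 x"
proof -
  from assms obtain e where e: "e \<ge> 1" "(x ^ f) ^ e \<in>\<^sub>i Q U (e * f)" unfolding nil_def by blast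
  then have "x ^ (f * e) \<in>\<^sub>i Q U (f * e * 1)" by (simp add: power_mult mult.commute[of e])
  moreover have "f * e \<ge> 1" using assms(2) e(1) by simp
  ultimately show ?thesis
    using assms(1) unfolding nil_def by (intro conjI exI[of _ "f * e"]) auto
qed

lemma nil_self: "z \<in>\<^sub>i I \<Longrightarrow> nil (pr z + U) 1 z"
  by (rule nil_Q) (auto simp: Q_def intro!: mem_addI1)

text \<open>Modulo \<open>U\<close> a single parameter \<open>z\<close> suffices, so
  \<open>p\<close> and \<open>q\<close> satisfy a nonzero homogeneous relation \<open>G\<close>.
  Modulo \<open>p - cst l * q\<close> the relation becomes \<open>q ^ e\<close> times the value of
  \<open>G\<close> at \<open>l\<close>; any \<open>l\<close> that is not a root makes
  \<open>q\<close>, and then \<open>p\<close>, nilpotent.\<close>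

lemma general_step:
  assumes z: "z \<in>\<^sub>i I" and RED: "RED (pr z + U)" and p: "p \<in>\<^sub>i I" and q: "q \<in>\<^sub>i I"
  obtains l where "nil (pr (p - cst l * q) + U) 1 p" "nil (pr (p - cst l * q) + U) 1 q"
proof -
  obtain e G where e: "e \<ge> 1" and G: "\<exists>i\<le>e. G i \<noteq> 0"
    and rel: "(\<Sum>i\<le>e. cst (G i) * (p ^ i * q ^ (e - i))) \<in>\<^sub>i Q U e"
    by (rule binary_relation[OF z RED p q])
  have "\<exists>l. (\<Sum>i\<le>e. G i * l ^ i) \<noteq> 0"
  proof (rule ccontr)
    assume "\<nexists>l. (\<Sum>i\<le>e. G i * l ^ i) \<noteq> 0"
    then have zero: "(\<Sum>i\<le>e. G i * l ^ i) = 0" for l by blast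
    have cp: "cst l ^ i = (cst (l ^ i) :: ('v, 'k) mpoly)" for l :: 'k and i
      by (induction i) (simp_all add: mult_single)
    have cs: "cst (\<Sum>i\<le>n. h i) = (\<Sum>i\<le>n. cst (h i) :: ('v, 'k) mpoly)" for n and h :: "nat \<Rightarrow> 'k"
      by (induction n) (simp_all add: single_add)
    have "cst (G i) \<in>\<^sub>i (0 :: ('v, 'k) mpoly idl)" if "i \<le> e" for i
    proof (rule vandermonde_mem[OF inf_k _ that])
      fix l :: 'k
      have "(\<Sum>i\<le>e. cst (G i) * cst l ^ i) = (cst (\<Sum>i\<le>e. G i * l ^ i) :: ('v, 'k) mpoly)"
        by (simp add: cs cp mult_single)
      then show "(\<Sum>i\<le>e. cst (G i) * cst l ^ i) \<in>\<^sub>i (0 :: ('v, 'k) mpoly idl)" by (simp add: zero)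
    qed
    then have "G i = 0" if "i \<le> e" for i
      using that by (metis lookup_single_eq lookup_zero mem_0)
    then show False using G by blast
  qed
  then obtain l where l: "(\<Sum>i\<le>e. G i * l ^ i) \<noteq> 0" ..
  define x where "x = p - cst l * q"
  have x: "x \<in>\<^sub>i I" unfolding x_def using p q by auto
  have cp: "cst l ^ i = (cst (l ^ i) :: ('v, 'k) mpoly)" for i
    by (induction i) (simp_all add: mult_single)
  have diff: "p ^ i * q ^ (e - i) - cst (l ^ i) * q ^ e \<in>\<^sub>i pr x * I ^ (e - 1)" if i: "i \<le> e" for i
  proof (cases i)
    case (Suc j)
    have "p ^ i - (cst l * q) ^ i = x * (\<Sum>t<Suc j. p ^ t * (cst l * q) ^ (j - t))"
      unfolding Suc x_def by (rule diff_power_eq_sum)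
    moreover have "(\<Sum>t<Suc j. p ^ t * (cst l * q) ^ (j - t)) \<in>\<^sub>i I ^ j"
    proof (rule mem_sum)
      fix t assume "t \<in> {..<Suc j}"
      then have "I ^ t * I ^ (j - t) = I ^ j" by (simp flip: power_add)
      moreover have "p ^ t * (cst l * q) ^ (j - t) \<in>\<^sub>i I ^ t * I ^ (j - t)"
        using p q by (intro mem_times mem_power) auto
      ultimately show "p ^ t * (cst l * q) ^ (j - t) \<in>\<^sub>i I ^ j" by simp
    qed
    ultimately have "(p ^ i - (cst l * q) ^ i) * q ^ (e - i) \<in>\<^sub>i (pr x * I ^ j) * I ^ (e - i)"
      using q by (intro mem_times mem_power) (auto simp: mem_pr_mult)
    also have "(pr x * I ^ j) * I ^ (e - i) = pr x * I ^ (e - 1)"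
      using i Suc by (simp add: mult.assoc flip: power_add)
    also have "(p ^ i - (cst l * q) ^ i) * q ^ (e - i) = p ^ i * q ^ (e - i) - cst (l ^ i) * q ^ e"
      using i by (simp add: left_diff_distrib power_mult_distrib cp mult.assoc flip: power_add)
    finally show ?thesis .
  qed simp
  have cs: "cst (\<Sum>i\<le>n. h i) = (\<Sum>i\<le>n. cst (h i) :: ('v, 'k) mpoly)" for n and h :: "nat \<Rightarrow> 'k"
    by (induction n) (simp_all add: single_add)
  have "(\<Sum>i\<le>e. cst (G i) * (p ^ i * q ^ (e - i) - cst (l ^ i) * q ^ e)) \<in>\<^sub>i Q (pr x + U) e"
    using e memD[OF diff, of _ "Q (pr x + U) e"]
    by (intro mem_sum mem_mult_left) (auto simp: Q_def distrib_right add.assoc)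
  then have "(\<Sum>i\<le>e. cst (G i) * (p ^ i * q ^ (e - i)))
      - (\<Sum>i\<le>e. cst (G i) * (p ^ i * q ^ (e - i) - cst (l ^ i) * q ^ e)) \<in>\<^sub>i Q (pr x + U) e"
    using memD[OF rel Q_mono[of U "pr x + U"]] by (intro mem_diff) simp_all
  also have "(\<Sum>i\<le>e. cst (G i) * (p ^ i * q ^ (e - i)))
      - (\<Sum>i\<le>e. cst (G i) * (p ^ i * q ^ (e - i) - cst (l ^ i) * q ^ e))
      = cst (\<Sum>i\<le>e. G i * l ^ i) * q ^ e"
    by (simp add: cs right_diff_distrib sum_subtractf sum_distrib_right mult_single flip: mult.assoc)
  finally have "cst (1 / (\<Sum>i\<le>e. G i * l ^ i)) * (cst (\<Sum>i\<le>e. G i * l ^ i) * q ^ e) \<in>\<^sub>i Q (pr x + U) e"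
    by (rule mem_mult_left)
  then have "q ^ e \<in>\<^sub>i Q (pr x + U) e"
    using l by (simp add: mult_single flip: mult.assoc)
  then have nq: "nil (pr x + U) 1 q" using q e unfolding nil_def by auto
  have "nil (pr x + U) 1 (x + q * cst l)"
    using nil_add[OF nil_self[OF x, of U]] nil_mult[OF nq, of "cst l" 0] by simp
  then have "nil (pr x + U) 1 p" by (simp add: x_def mult.commute)
  with nq show ?thesis unfolding x_def by (intro that)
qed

text \<open>Transitivity: nilpotence modulo \<open>p\<close> passes to nilpotence modulo
  \<open>x\<close> once \<open>p\<close> itself is nilpotent modulo \<open>x\<close>.\<close>

lemma nil_change:
  assumes v: "v \<in>\<^sub>i I" and p: "p \<in>\<^sub>i I" and nv: "nil (pr p + U) 1 v" and np: "nil (pr x + U) 1 p"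
  shows "nil (pr x + U) 1 v"
proof -
  from nv obtain e where e: "e \<ge> 1" "v ^ e \<in>\<^sub>i Q (pr p + U) e" unfolding nil_def by auto
  then have "v ^ e \<in>\<^sub>i pr p * I ^ (e - 1) + Q U e"
    by (simp add: Q_def distrib_right add.assoc)
  then obtain g b where gb: "v ^ e = p * g + b" "g \<in>\<^sub>i I ^ (e - 1)" "b \<in>\<^sub>i Q U e"
    unfolding mem_plus[of "v ^ e" "pr p * I ^ (e - 1)"] mem_pr_mult by blast
  have pg: "nil (pr x + U) e (p * g)" using nil_mult[OF np gb(2)] e by simp
  have "b = v ^ e - p * g" using gb by simp
  moreover have "v ^ e \<in>\<^sub>i I ^ e" "p * g \<in>\<^sub>i I ^ e"
    using mem_power[OF v] pg by (auto simp: nil_def)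
  ultimately have "b \<in>\<^sub>i I ^ e" by auto
  moreover have "b \<in>\<^sub>i Q (pr x + U) e" using memD[OF gb(3) Q_mono[of U "pr x + U"]] by simp
  ultimately have "nil (pr x + U) e (v ^ e)" unfolding gb(1) by (intro nil_add pg nil_Q)
  then show ?thesis using nil_root[OF v] e by blast
qed

text \<open>One combination of all the \<open>vs\<close> does the work of the whole list: each new
  \<open>v\<close> is merged with the element found so far by \<open>general_step\<close>, and
  \<open>nil_change\<close> carries the earlier ones along.\<close>

lemma general_element:
  assumes z: "z \<in>\<^sub>i I" and RED: "RED (pr z + U)" and vs: "\<And>v. v \<in> set vs \<Longrightarrow> v \<in>\<^sub>i K" and K: "K \<le> I"
  shows "\<exists>x. x \<in>\<^sub>i K \<and> (\<forall>v\<in>set vs. nil (pr x + U) 1 v)"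
  using vs
proof (induction vs)
  case Nil
  show ?case by (intro exI[of _ 0]) simp
next
  case (Cons v vs)
  then obtain p where p: "p \<in>\<^sub>i K" "\<forall>v\<in>set vs. nil (pr p + U) 1 v" by auto
  have v: "v \<in>\<^sub>i K" using Cons by simp
  obtain l where l: "nil (pr (p - cst l * v) + U) 1 p" "nil (pr (p - cst l * v) + U) 1 v"
    by (rule general_step[OF z RED memD[OF p(1) K] memD[OF v K]])
  have "nil (pr (p - cst l * v) + U) 1 v'" if v': "v' \<in> set vs" for v'
  proof (rule nil_change[OF _ memD[OF p(1) K] _ l(1)])
    have "v' \<in>\<^sub>i K" using Cons.prems[of v'] v' by simp
    then show "v' \<in>\<^sub>i I" using K by (rule memD)
    show "nil (pr p + U) 1 v'" using p(2) v' by blast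
  qed
  then show ?case using l p v by (intro exI[of _ "p - cst l * v"]) auto
qed

lemma power_le_reduction:
  assumes "reduction K I" obtains s where "I ^ Suc s = K * I ^ s" "I ^ Suc s \<le> K"
  using assms idl_mult_le1[of K K] by (auto simp: reduction_def)

text \<open>A Steinitz-type exchange. A general combination \<open>x\<close> of generators of
  \<open>K\<close> makes all of \<open>K\<close> nilpotent modulo \<open>pr x + U\<close>. Since
  \<open>I ^ Suc s = K * I ^ s\<close>, the \<open>y v\<close> become nilpotent as well, and since
  \<open>J\<close> is a reduction, a high power of \<open>I\<close> is then absorbed by
  pigeonhole.\<close>

theorem RED_exchange:
  assumes z: "z \<in>\<^sub>i I" and RED: "RED (pr z + U)" and K: "reduction K I"
  obtains x where "x \<in>\<^sub>i K" "RED (pr x + U)"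
proof -
  have KI: "K \<le> I" using K by (simp add: reduction_def)
  obtain s where s: "I ^ Suc s = K * I ^ s" "I ^ Suc s \<le> K" by (rule power_le_reduction[OF K])
  have "J ^ Suc s \<le> K" using order_trans[OF idl_power_mono[OF J_le_I] s(2)] .
  then obtain S where S: "finite S" "K = gen S" by (rule fin_gen_J)
  obtain vs where vs: "set vs = S" using finite_list[OF S(1)] by blast
  obtain x where x: "x \<in>\<^sub>i K" "\<forall>v\<in>set vs. nil (pr x + U) 1 v"
    using general_element[OF z RED, of vs K] KI vs S by auto
  define W where "W = pr x + U"
  have UI: "W \<le> I" using RED memD[OF x(1) KI] by (auto simp: RED_def W_def)
  have nil0: "nil W m 0" for m by (intro nil_Q) auto
  have K_nil: "nil W 1 k" if "k \<in>\<^sub>i K" for k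
    using that unfolding S(2)
  proof (induction rule: gen_induct)
    case (mult r k)
    then show ?case using nil_mult[of W 1 k r 0] by (simp add: mult.commute)
  qed (use x vs nil0 nil_add in \<open>auto simp: W_def\<close>)
  have KI_nil: "nil W (Suc s) f" if "f \<in>\<^sub>i K * I ^ s" for f
    using that
  proof (induction rule: times_induct)
    case (prod k g)
    then show ?case using nil_mult[OF K_nil[OF prod(1)] prod(2)] by simp
  qed (auto intro: nil_add)
  have "\<exists>E. y v ^ E \<in>\<^sub>i Q W E" for v
  proof -
    have "nil W (Suc s) (y v ^ Suc s)"
      using mem_power[OF y_mem_I, of v "Suc s"] unfolding s(1) by (rule KI_nil)
    then obtain e where "(y v ^ Suc s) ^ e \<in>\<^sub>i Q W (e * Suc s)" by (auto simp: nil_def)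
    then show ?thesis by (metis mult.commute power_mult)
  qed
  then obtain E where E: "\<And>v. y v ^ E v \<in>\<^sub>i Q W (E v)" by metis
  obtain r where r: "\<And>m n. m \<ge> r \<Longrightarrow> I ^ (n + m) = J ^ n * I ^ m" using reduction_powers[OF red] by blast
  define n where "n = Suc (\<Sum>v\<in>UNIV. E v)"
  have "I ^ (n + r) = J ^ n * I ^ r" by (rule r) simp
  also have "\<dots> \<le> (\<Sum>v\<in>UNIV. pr (y v) ^ E v * I ^ (n - E v)) * I ^ r"
    unfolding J_y by (intro idl_mult_mono sum_power_le) (auto simp: n_def y_mem_I)
  also have "\<dots> \<le> Q W (n + r)"
    unfolding sum_distrib_right
  proof (subst sum_idl_le_iff; (intro ballI)?)
    fix v
    have "E v \<le> n" using member_le_sum[of v UNIV E] by (simp add: n_def)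
    then have "pr (y v) ^ E v * I ^ (n - E v) * I ^ r = pr (y v ^ E v) * I ^ (n + r - E v)"
      by (simp add: pr_power mult.assoc flip: power_add)
    also have "\<dots> \<le> Q W (E v) * I ^ (n + r - E v)" using E by (intro idl_mult_mono) auto
    also have "\<dots> \<le> Q W (n + r)" using Q_mult[of W "E v" "n + r - E v"] \<open>E v \<le> n\<close> by simp
    finally show "pr (y v) ^ E v * I ^ (n - E v) * I ^ r \<le> Q W (n + r)" .
  qed simp
  finally have "RED W"
    unfolding RED_def using UI by (intro conjI exI[of _ "n + r - 1"]) (auto simp: n_def)
  then show ?thesis using that x(1) by (simp add: W_def)
qed

end

section \<open>Exchanging the generators of the monomial reduction\<close>

context monomial_reduction
begin

section \<open>From errors of higher weight to errors in an arbitrary \<open>F n\<close>\<close>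

lemma wt_split:
  assumes "n \<le> ord k"
  obtains p q where "k = p + q" "mon p \<in>\<^sub>i J ^ n" "wt p = n * L"
proof -
  have "\<exists>p q. k = p + q \<and> n \<le> ord p \<and> wt p = n * L"
    using assms
  proof (induction n arbitrary: k)
    case 0
    show ?case by (intro exI[of _ 0] exI[of _ k]) (simp add: wt_def)
  next
    case (Suc n)
    have "1 \<le> ord k" using Suc.prems by simp
    then obtain v k' where k': "k = Poly_Mapping.single v (a v) + k'" by (rule ord_pos_obtain)
    then have "n \<le> ord k'" using Suc.prems ord_single_add[of v 1 k'] by simp
    then obtain p q where pq: "k' = p + q" "n \<le> ord p" "wt p = n * L" using Suc.IH by blast
    show ?case
    proof (intro exI conjI)
      show "k = (Poly_Mapping.single v (a v) + p) + q" by (simp add: k' pq add.assoc)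
      show "Suc n \<le> ord (Poly_Mapping.single v (a v) + p)" using pq ord_single_add[of v 1 p] by simp
      show "wt (Poly_Mapping.single v (a v) + p) = Suc n * L"
        using pq wt_single[of v 1] by (simp add: wt_add)
    qed
  qed
  then show ?thesis using that by (auto simp: mem_J_power)
qed

text \<open>The error gains weight one step at a time. From a monomial of weight at least
  \<open>n\<close> one splits off a factor \<open>p0\<close> in \<open>J ^ Suc m\<close> of the
  least possible weight \<open>Suc m * L\<close>; rewriting \<open>p0\<close> by \<open>RED\<close>
  leaves a remainder heavier than \<open>p0\<close>, so the new error has weight at least
  \<open>Suc n\<close>.\<close>

lemma RED_lift:
  assumes "RED U" obtains N0 where "\<And>N n. N \<ge> N0 \<Longrightarrow> I ^ Suc N \<le> U * I ^ N + F n"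
proof -
  from assms obtain m where m: "I ^ Suc m \<le> U * I ^ m + D (Suc m)" by (auto simp: RED_def Q_def)
  obtain r where r: "\<And>m n. m \<ge> r \<Longrightarrow> I ^ (n + m) = J ^ n * I ^ m"
    using reduction_powers[OF red] by blast
  have main: "I ^ Suc N \<le> U * I ^ N + inf (I ^ Suc N) (F n)" if N: "N \<ge> m + r" for N n
  proof (induction n)
    case 0
    have "inf (I ^ Suc N) (F 0) = I ^ Suc N" by (rule idl_eqI) (simp add: mem_inf mem_V)
    then show ?case by simp
  next
    case (Suc n)
    have "inf (I ^ Suc N) (F n) \<le> U * I ^ N + inf (I ^ Suc N) (F (Suc n))"
      unfolding le_idl
    proof (intro allI impI, rule mem_of_keys)
      fix f k assume f: "f \<in>\<^sub>i inf (I ^ Suc N) (F n)" and k: "k \<in> Poly_Mapping.keys f"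
      have kI: "mon k \<in>\<^sub>i I ^ Suc N"
        using f k monI_power[OF monI_I, of "Suc N"] unfolding monI_def mem_inf by blast
      have wk: "n \<le> wt k" using f k by (simp add: mem_inf mem_V)
      have e: "I ^ Suc N = J ^ Suc m * I ^ (N - m)"
        using r[of "N - m" "Suc m"] N by simp
      obtain p q where pq: "k = p + q" "mon p \<in>\<^sub>i J ^ Suc m" "mon q \<in>\<^sub>i I ^ (N - m)"
        using kI unfolding e mon_mem_times[OF monI_power[OF monI_J] monI_power[OF monI_I]] by blast
      have "Suc m \<le> ord p" using pq(2) unfolding mem_J_power by simp
      then obtain p0 p1 where p: "p = p0 + p1" "mon p0 \<in>\<^sub>i J ^ Suc m" "wt p0 = Suc m * L"
        by (rule wt_split)
      define q' where "q' = p1 + q"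
      have q': "mon q' \<in>\<^sub>i I ^ (N - m)"
        unfolding q'_def by (subst add.commute) (rule mon_mem_add[OF pq(3)])
      have k': "mon k = mon p0 * (mon q' :: ('v, 'k) mpoly)"
        by (simp add: pq p q'_def mult_single add.assoc)
      have "mon p0 \<in>\<^sub>i U * I ^ m + D (Suc m)"
        using memD[OF p(2) order_trans[OF idl_power_mono[OF J_le_I] m]] .
      then obtain u d where ud: "mon p0 = u + d" "u \<in>\<^sub>i U * I ^ m" "d \<in>\<^sub>i D (Suc m)"
        by (auto simp: mem_plus)
      have "u * mon q' \<in>\<^sub>i (U * I ^ m) * I ^ (N - m)" by (rule mem_times[OF ud(2) q'])
      also have "(U * I ^ m) * I ^ (N - m) = U * I ^ N"
        using N by (simp add: mult.assoc flip: power_add)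
      finally have u: "u * mon q' \<in>\<^sub>i U * I ^ N" .
      have "d * mon q' \<in>\<^sub>i I ^ Suc m * I ^ (N - m)"
        using ud(3) by (intro mem_times q') (simp add: D_def mem_inf)
      also have "I ^ Suc m * I ^ (N - m) = I ^ Suc N"
        using N by (simp flip: power_add power_Suc)
      finally have d1: "d * mon q' \<in>\<^sub>i I ^ Suc N" .
      have "d * mon q' \<in>\<^sub>i F (Suc (Suc m * L)) * F (wt q')"
        using ud(3) by (intro mem_times) (simp_all add: D_def mem_inf mon_mem_V)
      also have "\<dots> \<le> F (Suc (Suc m * L) + wt q')" by (rule V_mult) simp
      also have "\<dots> \<le> F (Suc n)"
        using wk by (intro V_anti) (simp add: pq p q'_def wt_add)
      finally have "d * mon q' \<in>\<^sub>i inf (I ^ Suc N) (F (Suc n))" using d1 by (simp add: mem_inf)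
      then have "u * mon q' + d * mon q' \<in>\<^sub>i U * I ^ N + inf (I ^ Suc N) (F (Suc n))"
        using u unfolding mem_plus by blast
      then show "mon k \<in>\<^sub>i U * I ^ N + inf (I ^ Suc N) (F (Suc n))"
        by (simp only: k' ud(1) distrib_right)
    qed
    then have "U * I ^ N + inf (I ^ Suc N) (F n) \<le> U * I ^ N + inf (I ^ Suc N) (F (Suc n))" by simp
    with Suc show ?case by (rule order_trans)
  qed
  have "I ^ Suc N \<le> U * I ^ N + F n" if "N \<ge> m + r" for N n
    using order_trans[OF main[OF that, of n] add_left_mono[OF inf_le2]] .
  then show ?thesis by (rule that)
qed

text \<open>Only the \<open>B\<close>-part is fed back into the inclusion, so a power of
  \<open>B\<close> accumulates while the multiples of \<open>A\<close> are simply kept. The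
  coefficient of \<open>z\<close> retains the exponent \<open>N0 + k\<close>, one less than that of
  the left side; the final degree count rests on this.\<close>

lemma RED_iterate:
  assumes step: "\<And>N. N \<ge> N0 \<Longrightarrow> I ^ Suc N \<le> (pr z + A + B) * I ^ N + F n" and "A \<le> I" "B \<le> I"
  shows "I ^ (N0 + Suc k) \<le> pr z * I ^ (N0 + k) + A + B ^ Suc k + F n"
proof -
  have "I ^ (N0 + Suc k) \<le> pr z * I ^ (N0 + k) + A + B ^ Suc k * I ^ N0 + F n"
  proof (induction k)
    case 0
    have "(pr z + A + B) * I ^ N0 + F n \<le> pr z * I ^ N0 + A + B * I ^ N0 + F n"
      unfolding distrib_right by (intro add_mono order_refl idl_mult_le1)
    then show ?case using order_trans[OF step[of N0]] by simp
  next
    case (Suc k)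
    let ?R = "pr z * I ^ (N0 + Suc k) + A + B ^ Suc (Suc k) * I ^ N0 + F n"
    have R: "pr z * I ^ (N0 + Suc k) \<le> ?R" "A \<le> ?R" "B ^ Suc (Suc k) * I ^ N0 \<le> ?R" "F n \<le> ?R"
      by (simp_all add: add_increasing2 add_increasing)
    have "B * I ^ (N0 + Suc k) \<le> B * (pr z * I ^ (N0 + k) + A + B ^ Suc k * I ^ N0 + F n)"
      by (rule idl_mult_mono[OF order_refl Suc.IH])
    also have "\<dots> = pr z * (B * I ^ (N0 + k)) + B * A + B ^ Suc (Suc k) * I ^ N0 + B * F n"
      by (simp add: distrib_left mult_ac)
    also have "\<dots> \<le> ?R"
    proof -
      have "pr z * (B * I ^ (N0 + k)) \<le> pr z * I ^ (N0 + Suc k)"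
        using idl_mult_mono[OF order_refl idl_mult_mono[OF \<open>B \<le> I\<close> order_refl], of "pr z" "I ^ (N0 + k)"] by simp
      moreover have "B * A \<le> A" "B * F n \<le> F n" by (simp_all add: idl_mult_le2)
      ultimately show ?thesis using R by (auto intro: order_trans)
    qed
    finally have B: "B * I ^ (N0 + Suc k) \<le> ?R" .
    have "I ^ (N0 + Suc (Suc k)) \<le> (pr z + A + B) * I ^ (N0 + Suc k) + F n"
      using step[of "N0 + Suc k"] by simp
    also have "\<dots> = pr z * I ^ (N0 + Suc k) + A * I ^ (N0 + Suc k) + B * I ^ (N0 + Suc k) + F n"
      by (simp only: distrib_right)
    also have "\<dots> \<le> ?R"
      using R B order_trans[OF idl_mult_le1[OF order_refl] R(2)] by simp
    finally show ?case .
  qed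
  also have "\<dots> \<le> pr z * I ^ (N0 + k) + A + B ^ Suc k + F n"
    by (intro add_mono order_refl idl_mult_le1)
  finally show ?thesis .
qed

text \<open>\<open>SR d u\<close>: up to an arbitrarily small error in the filtration \<open>F\<close>, every \<open>u j\<close> is a
  nonzerodivisor modulo any of the other ones.\<close>

definition SR :: "nat \<Rightarrow> (nat \<Rightarrow> ('v, 'k) mpoly) \<Rightarrow> bool" where
  "SR d u \<longleftrightarrow> (\<forall>T j n. T \<subseteq> {..<d} \<longrightarrow> j < d \<longrightarrow> j \<notin> T \<longrightarrow>
     (\<exists>n'. \<forall>g. u j * g \<in>\<^sub>i (\<Sum>t\<in>T. pr (u t)) + F n' \<longrightarrow> g \<in>\<^sub>i (\<Sum>t\<in>T. pr (u t)) + F n))"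

lemma F_anti_add: "m \<le> n \<Longrightarrow> f \<in>\<^sub>i A + F n \<Longrightarrow> f \<in>\<^sub>i A + F m"
  by (rule idl_mod_mult) (auto intro: V_anti)

lemma mod_pr_obtain:
  assumes "f \<in>\<^sub>i pr x + A + B"
  obtains h s where "f = x * h + s" "s \<in>\<^sub>i A + B"
  using assms by (auto simp: add.assoc mem_plus[of f "pr x"] mem_pr)

text \<open>Krull intersection in quantitative form. If \<open>z * g\<close> vanishes modulo
  \<open>A\<close>, then \<open>g\<close> is \<open>x * h\<close> with \<open>z * h\<close>
  vanishing again; after \<open>n\<close> rounds \<open>g\<close> is a multiple of
  \<open>x ^ n\<close>, which lies in \<open>F n\<close>. The indices \<open>n'\<close> record how
  much precision each round costs.\<close>

lemma regular_shrink:
  assumes cancel_z: "\<And>n. \<exists>n'. \<forall>g. z * g \<in>\<^sub>i pr x + A + F n' \<longrightarrow> g \<in>\<^sub>i pr x + A + F n"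
    and cancel_x: "\<And>n. \<exists>n'. \<forall>g. x * g \<in>\<^sub>i A + F n' \<longrightarrow> g \<in>\<^sub>i A + F n"
    and x: "x \<in>\<^sub>i F 1"
  shows "\<exists>n'. \<forall>g. z * g \<in>\<^sub>i A + F n' \<longrightarrow> g \<in>\<^sub>i A + F n"
proof -
  have "\<exists>n'. \<forall>g. z * g \<in>\<^sub>i A + F n' \<longrightarrow> (\<exists>h. g - x ^ p * h \<in>\<^sub>i A + F n \<and> z * h \<in>\<^sub>i A + F n)" for p n
  proof (induction p arbitrary: n)
    case 0
    show ?case by (intro exI[of _ n] allI impI exI[of _ g for g]) auto
  next
    case (Suc p)
    obtain n1 where n1: "\<And>g. x * g \<in>\<^sub>i A + F n1 \<Longrightarrow> g \<in>\<^sub>i A + F n" using cancel_x by blast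
    obtain n2 where n2: "\<And>g. z * g \<in>\<^sub>i pr x + A + F n2 \<Longrightarrow> g \<in>\<^sub>i pr x + A + F (max n n1)"
      using cancel_z by blast
    let ?m = "max (max n n1) n2"
    obtain m where m: "\<And>g. z * g \<in>\<^sub>i A + F m \<Longrightarrow> \<exists>h. g - x ^ p * h \<in>\<^sub>i A + F ?m \<and> z * h \<in>\<^sub>i A + F ?m"
      using Suc.IH[of ?m] by blast
    show ?case
    proof (rule exI[of _ m], intro allI impI)
      fix g assume "z * g \<in>\<^sub>i A + F m"
      then obtain h where h: "g - x ^ p * h \<in>\<^sub>i A + F ?m" "z * h \<in>\<^sub>i A + F ?m" using m by blast
      have "z * h \<in>\<^sub>i pr x + A + F n2"
        using mem_addI2[OF F_anti_add[OF _ h(2), of n2], of "pr x"] by (simp add: add.assoc)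
      then obtain h1 s where h1: "h = x * h1 + s" "s \<in>\<^sub>i A + F (max n n1)"
        using n2 by (blast elim: mod_pr_obtain)
      have "x * (z * h1) = z * h - z * s" by (simp add: h1(1) algebra_simps)
      also have "\<dots> \<in>\<^sub>i A + F n1"
        using F_anti_add[OF _ h(2), of n1] F_anti_add[OF _ h1(2), of n1]
        by (intro mem_diff mem_mult_left[of s]) auto
      finally have "z * h1 \<in>\<^sub>i A + F n" by (rule n1)
      moreover have "g - x ^ Suc p * h1 = (g - x ^ p * h) + x ^ p * s"
        by (simp add: h1(1) algebra_simps)
      moreover have "\<dots> \<in>\<^sub>i A + F n"
        using F_anti_add[OF _ h(1), of n] F_anti_add[OF _ h1(2), of n] by (intro mem_add mem_mult_left) auto
      ultimately show "\<exists>h. g - x ^ Suc p * h \<in>\<^sub>i A + F n \<and> z * h \<in>\<^sub>i A + F n" by metis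
    qed
  qed
  then obtain n' where n': "\<And>g. z * g \<in>\<^sub>i A + F n' \<Longrightarrow> \<exists>h. g - x ^ n * h \<in>\<^sub>i A + F n" by metis
  have "x ^ n \<in>\<^sub>i F n"
    using memD[OF mem_power[OF x] V_power[OF superadd_wt order_refl], of n] by simp
  then have "(g - x ^ n * h) + x ^ n * h \<in>\<^sub>i A + F n" if "g - x ^ n * h \<in>\<^sub>i A + F n" for g h
    using that by (intro mem_add) (auto intro: mem_addI2)
  then show ?thesis using n' by (intro exI[of _ n']) (metis diff_add_cancel)
qed

text \<open>\<open>SR\<close> quantifies over all subsets \<open>T\<close>, as for a permutable
  regular sequence, because the exchange is repeated at every position.\<close>

lemma SR_exchange:
  assumes SR: "SR d u" and i: "i < d" and uF: "\<And>j. j < d \<Longrightarrow> u j \<in>\<^sub>i F 1"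
    and z: "\<And>n. \<exists>c. u i - z * c \<in>\<^sub>i (\<Sum>t\<in>{..<d} - {i}. pr (u t)) + F n"
  shows "SR d (u(i := z))"
proof -
  define S where "S T = (\<Sum>t\<in>T. pr (u t))" for T
  have S_insert: "S (insert j T) = pr (u j) + S T" if "j \<notin> T" "T \<subseteq> {..<d}" for j T
    using that finite_subset[of T "{..<d}"] by (simp add: S_def)
  have SR': "\<exists>n'. \<forall>g. u j * g \<in>\<^sub>i S T + F n' \<longrightarrow> g \<in>\<^sub>i S T + F n" if "T \<subseteq> {..<d}" "j < d" "j \<notin> T" for T j n
    using SR that unfolding SR_def S_def by blast
  \<comment> \<open>Modulo the other elements \<open>u i\<close> is a multiple of \<open>z\<close>,
    so whatever \<open>z\<close> annihilates is annihilated by \<open>u i\<close>.\<close>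
  have full: "\<exists>n'. \<forall>g. z * g \<in>\<^sub>i S ({..<d} - {i}) + F n' \<longrightarrow> g \<in>\<^sub>i S ({..<d} - {i}) + F n" for n
  proof -
    obtain n' where n': "\<And>g. u i * g \<in>\<^sub>i S ({..<d} - {i}) + F n' \<Longrightarrow> g \<in>\<^sub>i S ({..<d} - {i}) + F n"
      using SR'[of "{..<d} - {i}" i n] i by blast
    obtain c where c: "u i - z * c \<in>\<^sub>i S ({..<d} - {i}) + F n'" using z unfolding S_def by blast
    have "u i * g \<in>\<^sub>i S ({..<d} - {i}) + F n'" if "z * g \<in>\<^sub>i S ({..<d} - {i}) + F n'" for g
    proof -
      have "g * (u i - z * c) + c * (z * g) \<in>\<^sub>i S ({..<d} - {i}) + F n'"
        by (intro mem_add mem_mult_left c that)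
      then show ?thesis by (simp add: algebra_simps)
    qed
    then show ?thesis using n' by blast
  qed
  \<comment> \<open>The elements outside \<open>T\<close> are removed from the modulus one by one
    with \<open>regular_shrink\<close>.\<close>
  have ZR: "\<exists>n'. \<forall>g. z * g \<in>\<^sub>i S T + F n' \<longrightarrow> g \<in>\<^sub>i S T + F n" if "T \<subseteq> {..<d} - {i}" for T n
  proof -
    have "finite C \<Longrightarrow> C \<subseteq> {..<d} - {i} \<Longrightarrow>
        \<exists>n'. \<forall>g. z * g \<in>\<^sub>i S ({..<d} - {i} - C) + F n' \<longrightarrow> g \<in>\<^sub>i S ({..<d} - {i} - C) + F n" for C n
    proof (induction C arbitrary: n rule: finite_induct)
      case empty
      then show ?case using full by simp
    next
      case (insert j C)
      let ?T = "{..<d} - {i} - insert j C"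
      have jT: "insert j ?T = {..<d} - {i} - C" using insert by blast
      have S: "S ({..<d} - {i} - C) = pr (u j) + S ?T"
        unfolding jT[symmetric] by (rule S_insert) auto
      show ?case
      proof (rule regular_shrink)
        show "\<exists>n'. \<forall>g. z * g \<in>\<^sub>i pr (u j) + S ?T + F n' \<longrightarrow> g \<in>\<^sub>i pr (u j) + S ?T + F n" for n
          using insert.IH[of n] insert.prems unfolding S by simp
        show "\<exists>n'. \<forall>g. u j * g \<in>\<^sub>i S ?T + F n' \<longrightarrow> g \<in>\<^sub>i S ?T + F n" for n
          using insert.prems by (intro SR') auto
        show "u j \<in>\<^sub>i F 1" using insert.prems by (intro uF) auto
      qed
    qed
    from this[of "{..<d} - {i} - T" n] show ?thesis
      using that by (simp add: double_diff)
  qed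
  show ?thesis
    unfolding SR_def
  proof (intro allI impI)
    fix T j n assume T: "T \<subseteq> {..<d}" and j: "j < d" "j \<notin> T"
    have sum': "(\<Sum>t\<in>T. pr ((u(i := z)) t)) = S T" if "i \<notin> T" for T
      unfolding S_def using that by (intro sum.cong) auto
    show "\<exists>n'. \<forall>g. (u(i := z)) j * g \<in>\<^sub>i (\<Sum>t\<in>T. pr ((u(i := z)) t)) + F n' \<longrightarrow>
      g \<in>\<^sub>i (\<Sum>t\<in>T. pr ((u(i := z)) t)) + F n"
    proof (cases "i \<in> T")
      case False
      show ?thesis
      proof (cases "j = i")
        case True
        have "T \<subseteq> {..<d} - {i}" using T False by auto
        from ZR[OF this, of n] show ?thesis unfolding sum'[OF False] True fun_upd_same .
      next
        case ji: False
        from SR'[OF T j, of n] show ?thesis unfolding sum'[OF False] fun_upd_other[OF ji] .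
      qed
    next
      case True
      then have ji: "j \<noteq> i" using j by blast
      define T0 where "T0 = T - {i}"
      have T0: "T0 \<subseteq> {..<d}" "i \<notin> T0" "j \<notin> T0" "T = insert i T0" using T True j by (auto simp: T0_def)
      have sumT: "(\<Sum>t\<in>T. pr ((u(i := z)) t)) = pr z + S T0"
        unfolding T0(4) using T0 finite_subset[OF T0(1)] sum'[OF T0(2)] by simp
      obtain n1 where n1: "\<And>g. u j * g \<in>\<^sub>i S T0 + F n1 \<Longrightarrow> g \<in>\<^sub>i S T0 + F n"
        using SR'[OF T0(1) j(1) T0(3), of n] by blast
      obtain n2 where n2: "\<And>g. z * g \<in>\<^sub>i pr (u j) + S T0 + F n2 \<Longrightarrow> g \<in>\<^sub>i pr (u j) + S T0 + F n1"
        using ZR[of "insert j T0" n1] T0 j ji S_insert[OF T0(3,1)] by auto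
      \<comment> \<open>For \<open>u j\<close> modulo a set containing \<open>z\<close> the two are
        interchanged: in \<open>u j * g = z * h + s\<close> the regularity of \<open>z\<close>
        modulo \<open>u j\<close> makes \<open>h\<close> a multiple \<open>u j * h1\<close> up to
        error, and \<open>u j\<close> is then cancelled from \<open>g - z * h1\<close>.\<close>
      have "g \<in>\<^sub>i pr z + S T0 + F n" if g: "u j * g \<in>\<^sub>i pr z + S T0 + F (max n1 n2)" for g
      proof -
        obtain h s where h: "u j * g = z * h + s" "s \<in>\<^sub>i S T0 + F (max n1 n2)"
          using g by (rule mod_pr_obtain)
        have "u j * g - s \<in>\<^sub>i pr (u j) + (S T0 + F n2)"
          using F_anti_add[OF _ h(2), of n2] by (intro mem_diff) (auto intro: mem_addI1 mem_addI2 simp: mem_pr)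
        then have "z * h \<in>\<^sub>i pr (u j) + S T0 + F n2" by (simp add: h(1) add.assoc)
        then obtain h1 s1 where h1: "h = u j * h1 + s1" "s1 \<in>\<^sub>i S T0 + F n1"
          using n2 by (blast elim: mod_pr_obtain)
        have "u j * (g - z * h1) = s + z * s1" using h(1) by (simp add: h1(1) algebra_simps)
        also have "\<dots> \<in>\<^sub>i S T0 + F n1"
          using F_anti_add[OF _ h(2), of n1] h1(2) by (intro mem_add mem_mult_left) auto
        finally have "g - z * h1 \<in>\<^sub>i S T0 + F n" by (rule n1)
        then have "z * h1 + (g - z * h1) \<in>\<^sub>i pr z + (S T0 + F n)"
          by (intro mem_add[OF mem_addI1 mem_addI2]) (auto simp: mem_pr)
        then show ?thesis by (simp add: add.assoc)
      qed
      then show ?thesis unfolding sumT fun_upd_other[OF ji] by blast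
    qed
  qed
qed

lemma mon_mem_sum:
  assumes "finite T" "\<And>t. t \<in> T \<Longrightarrow> monI (A t)"
  shows "mon k \<in>\<^sub>i (\<Sum>t\<in>T. A t) \<longleftrightarrow> (\<exists>t\<in>T. mon k \<in>\<^sub>i (A t :: ('v, 'k) mpoly idl))"
  using assms
proof (induction T rule: finite_induct)
  case empty
  have "mon k \<noteq> (0 :: ('v, 'k) mpoly)" by (metis lookup_single_eq lookup_zero zero_neq_one)
  then show ?case by simp
next
  case (insert t T)
  then show ?case by (simp add: mon_mem_plus monI_sum)
qed

lemma SR_powers:
  assumes "inj_on e {..<d}"
  shows "SR d (\<lambda>j. y (e j) ^ N j)"
  unfolding SR_def
proof (intro allI impI)
  fix T j n assume T: "T \<subseteq> {..<d}" and j: "j < d" "j \<notin> T"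
  have finT: "finite T" using T finite_subset by blast
  let ?S = "\<Sum>t\<in>T. pr (y (e t) ^ N t)"
  let ?s = "\<lambda>t. Poly_Mapping.single (e t) (N t * a (e t))"
  have mS: "monI ?S" by (intro monI_sum) (simp add: y_power monI_pr)
  have mem: "mon k \<in>\<^sub>i ?S + F n \<longleftrightarrow> (\<exists>t\<in>T. \<exists>l. k = ?s t + l) \<or> n \<le> wt k" for k n
    by (subst mon_mem_plus[OF mS monI_V], subst mon_mem_sum[OF finT])
      (simp_all add: y_power monI_pr mon_mem_pr mon_mem_V)
  show "\<exists>n'. \<forall>g. y (e j) ^ N j * g \<in>\<^sub>i ?S + F n' \<longrightarrow> g \<in>\<^sub>i ?S + F n"
  proof (intro exI allI impI, rule mem_of_keys)
    fix g k assume g: "y (e j) ^ N j * g \<in>\<^sub>i ?S + F (N j * L + n)" and k: "k \<in> Poly_Mapping.keys g"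
    have "?s j + k \<in> Poly_Mapping.keys (y (e j) ^ N j * g)" using k by (simp add: y_power keys_mon_mult)
    then have "mon (?s j + k) \<in>\<^sub>i ?S + F (N j * L + n)"
      using g monI_add[OF mS monI_V] unfolding monI_def by blast
    then consider t l where "t \<in> T" "?s j + k = ?s t + l" | "N j * L + n \<le> wt (?s j + k)"
      unfolding mem by blast
    then show "mon k \<in>\<^sub>i ?S + F n"
    proof cases
      case 1
      then have ne: "e t \<noteq> e j" using assms T j by (metis inj_on_eq_iff lessThan_iff subsetD)
      have "lkp (?s t) v \<le> lkp k v" for v
      proof (cases "v = e t")
        case True
        have "lkp (?s j + k) v = lkp (?s t + l) v" using 1 by simp
        then show ?thesis using True ne by (simp add: lookup_add lookup_single when_def)
      qed (simp add: lookup_single when_def)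
      then obtain l' where "k = ?s t + l'" by (rule pm_le_obtain)
      then show ?thesis unfolding mem using 1 by blast
    next
      case 2
      then show ?thesis unfolding mem by (simp add: wt_add wt_single)
    qed
  qed
qed

end

section \<open>A lower bound for the core of a monomial ideal\<close>

context monomial_reduction
begin

lemma J_sum_enum:
  assumes "bij_betw e {..<CARD('v)} (UNIV :: 'v set)"
  shows "(\<Sum>j<CARD('v). pr (y (e j))) = J"
  unfolding J_y using sum.reindex_bij_betw[OF assms, of "\<lambda>v. pr (y v)"] by simp

lemma RED_J: "RED J"
proof -
  from red obtain r where "I ^ Suc r = J * I ^ r" by (auto simp: reduction_def)
  then have "I ^ Suc r \<le> Q J (Suc r)" by (simp add: Q_def)
  then show ?thesis using J_le_I unfolding RED_def by blast
qed

lemma sum_if_Suc: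
  fixes f :: "'b \<Rightarrow> 'c::comm_monoid_add"
  assumes "i < d"
  shows "(\<Sum>j<d. f (if j < Suc i then z j else x j)) = f (z i) + (\<Sum>j\<in>{..<d} - {i}. f (if j < i then z j else x j))"
proof -
  have "(\<Sum>j<d. f (if j < Suc i then z j else x j)) = f (z i) + (\<Sum>j\<in>{..<d} - {i}. f (if j < Suc i then z j else x j))"
    using assms by (subst sum.remove[of _ i]) auto
  also have "(\<Sum>j\<in>{..<d} - {i}. f (if j < Suc i then z j else x j)) = (\<Sum>j\<in>{..<d} - {i}. f (if j < i then z j else x j))"
    by (rule sum.cong) (auto simp: less_Suc_eq)
  finally show ?thesis .
qed

text \<open>All intermediate systems are recorded, not only the last one, because
  \<open>mem_reduction\<close> rewrites the \<open>i\<close>-th power with the system in which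
  exactly the first \<open>Suc i\<close> generators are exchanged.\<close>

lemma reduction_chain:
  assumes e: "bij_betw e {..<d} (UNIV :: 'v set)" and d: "d = CARD('v)" and K: "reduction K I"
  shows "i \<le> d \<Longrightarrow> \<exists>z. (\<forall>j<i. z j \<in>\<^sub>i K) \<and>
    (\<forall>i'\<le>i. RED (\<Sum>j<d. pr (if j < i' then z j else y (e j))))"
proof (induction i)
  case 0
  have "RED (\<Sum>j<d. pr (if j < 0 then z j else y (e j)))" for z
    using RED_J J_sum_enum[OF e[unfolded d]] by (simp add: d)
  then show ?case by auto
next
  case (Suc i)
  then obtain z where z: "\<And>j. j < i \<Longrightarrow> z j \<in>\<^sub>i K"
    and R: "\<And>i'. i' \<le> i \<Longrightarrow> RED (\<Sum>j<d. pr (if j < i' then z j else y (e j)))" by auto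
  define R' where "R' = (\<Sum>j\<in>{..<d} - {i}. pr (if j < i then z j else y (e j)))"
  have "(\<Sum>j<d. pr (if j < i then z j else y (e j))) = pr (y (e i)) + R'"
    unfolding R'_def using Suc.prems by (subst sum.remove[of _ i]) auto
  then have "RED (pr (y (e i)) + R')" using R[of i] by simp
  then obtain x where x: "x \<in>\<^sub>i K" "RED (pr x + R')" using RED_exchange[OF y_mem_I _ K] by blast
  define z' where "z' = z(i := x)"
  have "RED (\<Sum>j<d. pr (if j < i' then z' j else y (e j)))" if "i' \<le> Suc i" for i'
  proof (cases "i' = Suc i")
    case True
    have "(\<Sum>j\<in>{..<d} - {i}. pr (if j < i then z' j else y (e j))) = R'"
      unfolding R'_def by (rule sum.cong) (simp_all add: z'_def)
    then have "(\<Sum>j<d. pr (if j < i' then z' j else y (e j))) = pr x + R'"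
      using Suc.prems unfolding True by (subst sum_if_Suc) (simp_all add: z'_def)
    then show ?thesis using x by simp
  next
    case False
    then have "(\<Sum>j<d. pr (if j < i' then z' j else y (e j))) = (\<Sum>j<d. pr (if j < i' then z j else y (e j)))"
      using that by (intro sum.cong) (auto simp: z'_def)
    then show ?thesis using R[of i'] that False by simp
  qed
  moreover have "z' j \<in>\<^sub>i K" if "j < Suc i" for j
    using that x z by (auto simp: z'_def less_Suc_eq)
  ultimately show ?case by blast
qed

text \<open>When the \<open>i\<close>-th power is rewritten, the later powers are still in the
  ideal; for the pigeonhole argument \<open>N i\<close> has to exceed the sum of their exponents.
  Powers of \<open>Suc n0 + d\<close> with decreasing exponent satisfy this.\<close>

lemma rapidly_decreasing:
  fixes d n0 :: nat
  obtains N :: "nat \<Rightarrow> nat" where "\<And>i. i < d \<Longrightarrow> Suc (n0 + (\<Sum>j\<in>{i<..<d}. N j)) \<le> N i"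
proof
  fix i assume i: "i < d"
  let ?B = "Suc n0 + d"
  let ?p = "?B ^ (d - Suc i)"
  have "(\<Sum>j\<in>{i<..<d}. ?B ^ (d - j)) \<le> card {i<..<d} * ?p"
  proof (subst of_nat_id[symmetric, of "card _"], rule sum_bounded_above)
    fix j assume "j \<in> {i<..<d}"
    then show "?B ^ (d - j) \<le> ?p" by (intro power_increasing) auto
  qed
  also have "\<dots> \<le> d * ?p" by (intro mult_le_mono1) simp
  finally have s: "(\<Sum>j\<in>{i<..<d}. ?B ^ (d - j)) \<le> d * ?p" .
  have "1 \<le> ?p" by simp
  then have "Suc n0 * 1 \<le> Suc n0 * ?p" by (intro mult_le_mono2)
  from add_mono[OF this s] have "Suc n0 + (\<Sum>j\<in>{i<..<d}. ?B ^ (d - j)) \<le> Suc n0 * ?p + d * ?p" by simp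
  also have "\<dots> = ?B * ?p" by (simp add: distrib_right)
  also have "\<dots> = ?B ^ Suc (d - Suc i)" by simp
  also have "Suc (d - Suc i) = d - i" using i by simp
  finally show "Suc (n0 + (\<Sum>j\<in>{i<..<d}. ?B ^ (d - j))) \<le> ?B ^ (d - i)" by simp
qed

lemma F_le_reduction:
  assumes "reduction K I" obtains n where "F n \<le> K"
proof -
  obtain s where "I ^ Suc s = K * I ^ s" "I ^ Suc s \<le> K" by (rule power_le_reduction[OF assms])
  then have "J ^ Suc s \<le> K" using order_trans[OF idl_power_mono[OF J_le_I]] by blast
  then show ?thesis using that order_trans[OF F_le_J[OF order_refl]] by blast
qed

theorem mem_reduction:
  assumes f: "\<And>m. pr f * I ^ m \<le> J ^ Suc m" and K: "reduction K I"
  shows "f \<in>\<^sub>i K"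
proof -
  have KI: "K \<le> I" using K by (simp add: reduction_def)
  define d where "d = CARD('v)"
  obtain e where e: "bij_betw e {..<d} (UNIV :: 'v set)"
    using ex_bij_betw_nat_finite[of "UNIV :: 'v set"] by (auto simp: d_def lessThan_atLeast0)
  obtain z where zK: "\<And>j. j < d \<Longrightarrow> z j \<in>\<^sub>i K"
    and R: "\<And>i. i \<le> d \<Longrightarrow> RED (\<Sum>j<d. pr (if j < i then z j else y (e j)))"
    using reduction_chain[OF e d_def K order_refl] by auto
  have "\<forall>i. \<exists>n0. i \<le> d \<longrightarrow> (\<forall>N\<ge>n0. \<forall>n. I ^ Suc N \<le> (\<Sum>j<d. pr (if j < i then z j else y (e j))) * I ^ N + F n)"
  proof
    fix i show "\<exists>n0. i \<le> d \<longrightarrow> (\<forall>N\<ge>n0. \<forall>n. I ^ Suc N \<le> (\<Sum>j<d. pr (if j < i then z j else y (e j))) * I ^ N + F n)"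
    proof (cases "i \<le> d")
      case True
      show ?thesis
      proof (rule RED_lift[OF R[OF True]])
        fix n1 assume "\<And>N n. n1 \<le> N \<Longrightarrow>
          I ^ Suc N \<le> (\<Sum>j<d. pr (if j < i then z j else y (e j))) * I ^ N + F n"
        then show ?thesis by (intro exI[of _ n1]) simp
      qed
    qed simp
  qed
  from choice[OF this] obtain n0 where n0: "\<And>i N n. i \<le> d \<Longrightarrow> N \<ge> n0 i \<Longrightarrow>
      I ^ Suc N \<le> (\<Sum>j<d. pr (if j < i then z j else y (e j))) * I ^ N + F n" by blast
  define N0 where "N0 = (\<Sum>i\<le>d. n0 i)"
  have N0: "n0 i \<le> N0" if "i \<le> d" for i unfolding N0_def using that by (intro member_le_sum) auto
  obtain N :: "nat \<Rightarrow> nat" where N: "\<And>i. i < d \<Longrightarrow> Suc (N0 + (\<Sum>j\<in>{i<..<d}. N j)) \<le> N i"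
    using rapidly_decreasing[of d N0] by blast
  define Y where "Y j = y (e j) ^ N j" for j
  define W where "W i j = (if j < i then z j else Y j)" for i j
  define S where "S i = (\<Sum>t\<in>{..<d} - {i}. pr (W i t))" for i
  have sumW: "(\<Sum>t<d. pr (W i t)) = pr (Y i) + S i" if "i < d" for i
    unfolding S_def using that by (subst sum.remove[of _ i]) (auto simp: W_def)
  have sumW': "(\<Sum>t<d. pr (W (Suc i) t)) = pr (z i) + S i" if "i < d" for i
    unfolding S_def W_def by (rule sum_if_Suc[OF that])
  \<comment> \<open>The exponent of \<open>c\<close> is exactly one less than that of
    \<open>Y i\<close>. The part \<open>A\<close> lies in \<open>S i\<close> already, and the power
    of \<open>B\<close> falls into the later \<open>Y j\<close> by the choice of
    \<open>N\<close>.\<close>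
  have exch: "\<exists>c. c \<in>\<^sub>i I ^ (N i - 1) \<and> Y i - z i * c \<in>\<^sub>i S i + F n" if i: "i < d" for i n
  proof -
    define A where "A = (\<Sum>j<i. pr (z j))"
    define B where "B = (\<Sum>j\<in>{i<..<d}. pr (y (e j)))"
    have set: "{..<d} - {i} = {..<i} \<union> {i<..<d}" using i by auto
    have U: "(\<Sum>j<d. pr (if j < Suc i then z j else y (e j))) = pr (z i) + A + B"
      unfolding A_def B_def sum_if_Suc[OF i, of pr z "\<lambda>j. y (e j)"] set add.assoc
      by (subst sum.union_disjoint) (auto intro!: sum.cong arg_cong2[of _ _ _ _ "(+)"])
    have AI: "A \<le> I" unfolding A_def using i memD[OF zK KI] by (simp add: sum_idl_le_iff)
    have BI: "B \<le> I" unfolding B_def by (simp add: sum_idl_le_iff y_mem_I)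
    define k where "k = N i - Suc N0"
    have k: "N i = N0 + Suc k" "(\<Sum>j\<in>{i<..<d}. N j) \<le> k" using N[OF i] by (auto simp: k_def)
    have "I ^ (N0 + Suc k) \<le> pr (z i) * I ^ (N0 + k) + A + B ^ Suc k + F n"
    proof (rule RED_iterate[OF _ AI BI])
      fix M assume "N0 \<le> M"
      then show "I ^ Suc M \<le> (pr (z i) + A + B) * I ^ M + F n"
        using n0[of "Suc i" M n] N0[of "Suc i"] i unfolding U by simp
    qed
    then have "Y i \<in>\<^sub>i pr (z i) * I ^ (N0 + k) + A + B ^ Suc k + F n"
      unfolding Y_def k(1)[symmetric] by (rule memD[OF mem_power[OF y_mem_I]])
    then obtain q r where qr: "Y i = q + r" "q \<in>\<^sub>i pr (z i) * I ^ (N0 + k)" "r \<in>\<^sub>i A + B ^ Suc k + F n"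
      unfolding add.assoc[of "pr (z i) * I ^ (N0 + k) + A"] add.assoc[of "pr (z i) * I ^ (N0 + k)"]
        mem_plus[of "Y i" "pr (z i) * I ^ (N0 + k)"] by blast
    obtain c where c: "q = z i * c" "c \<in>\<^sub>i I ^ (N0 + k)" using qr(2) unfolding mem_pr_mult by blast
    have "B ^ Suc k \<le> (\<Sum>j\<in>{i<..<d}. pr (y (e j)) ^ N j * 1 ^ (Suc k - N j))"
      unfolding B_def using k(2) by (intro sum_power_le) auto
    also have "\<dots> = (\<Sum>j\<in>{i<..<d}. pr (Y j))" by (simp add: Y_def pr_power)
    finally have "A + (B ^ Suc k + F n) \<le> A + ((\<Sum>j\<in>{i<..<d}. pr (Y j)) + F n)"
      by (intro add_mono order_refl)
    also have "\<dots> = S i + F n"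
      unfolding S_def set A_def add.assoc[symmetric]
      by (subst sum.union_disjoint) (auto simp: W_def intro!: sum.cong arg_cong2[of _ _ _ _ "(+)"])
    finally have "r \<in>\<^sub>i S i + F n" by (rule memD[OF qr(3)[unfolded add.assoc]])
    then show ?thesis using c qr(1) k(1) by (intro exI[of _ c]) auto
  qed
  have WF: "W i j \<in>\<^sub>i F 1" if j: "j < d" for i j
  proof -
    have "I \<le> F 1" using order_trans[OF I_le_F V_anti[of 1 L]] L_pos by simp
    moreover have "Y j \<in>\<^sub>i I"
    proof -
      obtain n where "N j = Suc n" using N[OF j] by (cases "N j") auto
      then show ?thesis unfolding Y_def using y_mem_I by auto
    qed
    ultimately show ?thesis using memD[OF zK[OF j] KI] unfolding W_def by (auto intro: memD)
  qed
  have SRW: "i \<le> d \<Longrightarrow> SR d (W i)" for i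
  proof (induction i)
    case 0
    have "W 0 = (\<lambda>j. y (e j) ^ N j)" by (auto simp: W_def Y_def)
    then show ?case using SR_powers[OF bij_betw_imp_inj_on[OF e]] by simp
  next
    case (Suc i)
    have "SR d ((W i)(i := z i))"
    proof (rule SR_exchange)
      fix n
      have "W i i = Y i" by (simp add: W_def)
      then show "\<exists>c. W i i - z i * c \<in>\<^sub>i (\<Sum>t\<in>{..<d} - {i}. pr (W i t)) + F n"
        using exch[of i n] Suc.prems unfolding S_def by auto
    qed (use Suc WF in auto)
    also have "(W i)(i := z i) = W (Suc i)" by (auto simp: W_def less_Suc_eq)
    finally show ?case .
  qed
  \<comment> \<open>Invariant of the exchange: the cofactors collected in \<open>c\<close> multiply
    \<open>G\<close> into the ideal of the powers \<open>Y t\<close> only if \<open>G\<close>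
    already lies, up to \<open>F n\<close>, in the partly exchanged ideal.\<close>
  have stage: "i \<le> d \<Longrightarrow> \<exists>c. c \<in>\<^sub>i I ^ (\<Sum>j<i. N j - 1) \<and>
      (\<forall>G. c * G \<in>\<^sub>i (\<Sum>t<d. pr (Y t)) \<longrightarrow> G \<in>\<^sub>i (\<Sum>t<d. pr (W i t)) + F n)" for i n
  proof (induction i arbitrary: n)
    case 0
    have "W 0 = Y" by (auto simp: W_def)
    then show ?case by (intro exI[of _ 1]) (auto intro: mem_addI1)
  next
    case (Suc i)
    then have i: "i < d" by simp
    have "\<exists>n1. \<forall>g. W i i * g \<in>\<^sub>i S i + F n1 \<longrightarrow> g \<in>\<^sub>i S i + F n"
      using SRW[of i] i unfolding SR_def S_def by (metis DiffE Diff_subset insertI1 less_imp_le)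
    then obtain n1 where n1: "\<And>g. Y i * g \<in>\<^sub>i S i + F n1 \<Longrightarrow> g \<in>\<^sub>i S i + F n"
      by (auto simp: W_def)
    obtain c' where c': "c' \<in>\<^sub>i I ^ (\<Sum>j<i. N j - 1)"
      "\<And>G. c' * G \<in>\<^sub>i (\<Sum>t<d. pr (Y t)) \<Longrightarrow> G \<in>\<^sub>i (\<Sum>t<d. pr (W i t)) + F n1"
      using Suc.IH[of n1] i by auto
    obtain c where c: "c \<in>\<^sub>i I ^ (N i - 1)" "Y i - z i * c \<in>\<^sub>i S i + F n1" using exch[OF i] by blast
    show ?case
    proof (intro exI conjI allI impI)
      show "c' * c \<in>\<^sub>i I ^ (\<Sum>j<Suc i. N j - 1)" using mem_times[OF c'(1) c(1)] by (simp add: power_add)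
      fix G assume "c' * c * G \<in>\<^sub>i (\<Sum>t<d. pr (Y t))"
      then have "c * G \<in>\<^sub>i pr (Y i) + S i + F n1" using c'(2)[of "c * G"] sumW[OF i] by (simp add: mult.assoc)
      then obtain h s where h: "c * G = Y i * h + s" "s \<in>\<^sub>i S i + F n1" by (rule mod_pr_obtain)
      define r where "r = Y i - z i * c"
      have r: "r \<in>\<^sub>i S i + F n1" using c by (simp add: r_def)
      have "Y i * (G - z i * h) = (z i * c + r) * (G - z i * h)" by (simp add: r_def)
      also have "\<dots> = z i * (c * G) - z i * (z i * c) * h + r * (G - z i * h)" by (simp add: algebra_simps)
      also have "z i * c = Y i - r" by (simp add: r_def)
      also have "z i * (c * G) - z i * (Y i - r) * h + r * (G - z i * h) = z i * s + (z i * h) * r + (G - z i * h) * r"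
        unfolding h(1) by (simp add: algebra_simps)
      also have "\<dots> \<in>\<^sub>i S i + F n1" by (intro mem_add mem_mult_left r h)
      finally have "G - z i * h \<in>\<^sub>i S i + F n" by (rule n1)
      then have "z i * h + (G - z i * h) \<in>\<^sub>i pr (z i) + (S i + F n)"
        by (intro mem_add[OF mem_addI1 mem_addI2]) (auto simp: mem_pr)
      then show "G \<in>\<^sub>i (\<Sum>t<d. pr (W (Suc i) t)) + F n" by (simp add: sumW'[OF i] add.assoc)
    qed
  qed
  obtain n where n: "F n \<le> K" by (rule F_le_reduction[OF K])
  define M where "M = (\<Sum>j<d. N j - 1)"
  obtain c where c: "c \<in>\<^sub>i I ^ M"
    "\<And>G. c * G \<in>\<^sub>i (\<Sum>t<d. pr (Y t)) \<Longrightarrow> G \<in>\<^sub>i (\<Sum>t<d. pr (W d t)) + F n"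
    using stage[OF order_refl, of n] unfolding M_def by blast
  \<comment> \<open>Here the exponents match: \<open>c\<close> lies in \<open>I ^ M\<close> with
    \<open>M\<close> the sum of the \<open>N j - 1\<close>, so \<open>c * f\<close> lies in
    \<open>J ^ Suc M\<close>, and a monomial of order greater than \<open>M\<close> is divisible by
    some \<open>Y j\<close>.\<close>
  have "c * f \<in>\<^sub>i (\<Sum>t<d. pr (Y t))"
  proof (rule mem_of_keys)
    fix k assume k: "k \<in> Poly_Mapping.keys (c * f)"
    have "f * c \<in>\<^sub>i J ^ Suc M" by (rule memD[OF _ f[of M]]) (use c in \<open>auto simp: mem_pr_mult\<close>)
    then have "Suc M \<le> ord k" using k unfolding mem_J_power by (metis mult.commute)
    also have "ord k = (\<Sum>j<d. lkp k (e j) div a (e j))"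
      unfolding ord_def using sum.reindex_bij_betw[OF e, of "\<lambda>v. lkp k v div a v"] by simp
    finally have big: "Suc M \<le> (\<Sum>j<d. lkp k (e j) div a (e j))" .
    have "\<exists>j<d. N j \<le> lkp k (e j) div a (e j)"
    proof (rule ccontr)
      assume neg: "\<not> (\<exists>j<d. N j \<le> lkp k (e j) div a (e j))"
      have "(\<Sum>j<d. lkp k (e j) div a (e j)) \<le> M"
        unfolding M_def
      proof (rule sum_mono)
        fix j assume "j \<in> {..<d}"
        then have "\<not> N j \<le> lkp k (e j) div a (e j)" using neg by blast
        then show "lkp k (e j) div a (e j) \<le> N j - 1" by linarith
      qed
      then show False using big by simp
    qed
    then obtain j where j: "j < d" "N j \<le> lkp k (e j) div a (e j)" by blast
    have "N j * a (e j) \<le> lkp k (e j)"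
      using order_trans[OF mult_le_mono1[OF j(2)] div_times_less_eq_dividend] .
    then have "lkp (Poly_Mapping.single (e j) (N j * a (e j))) v \<le> lkp k v" for v
      by (auto simp: lookup_single when_def)
    then obtain l where "k = Poly_Mapping.single (e j) (N j * a (e j)) + l" by (rule pm_le_obtain)
    then have "mon k \<in>\<^sub>i pr (Y j)" by (auto simp: Y_def y_power mon_mem_pr)
    then show "mon k \<in>\<^sub>i (\<Sum>t<d. pr (Y t))"
      by (rule memD) (rule mem_sum_idl[of "{..<d}" j], use j in auto)
  qed
  then have "f \<in>\<^sub>i (\<Sum>t<d. pr (W d t)) + F n" by (rule c(2))
  moreover have "(\<Sum>t<d. pr (W d t)) \<le> K" using zK by (simp add: sum_idl_le_iff W_def)
  ultimately show ?thesis using n memD by (metis idl_add_le)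
qed

end

section \<open>An upper bound for the core\<close>

lemma radix_inj:
  fixes f g :: "nat \<Rightarrow> nat"
  assumes "\<And>j. j < n \<Longrightarrow> f j < B" "\<And>j. j < n \<Longrightarrow> g j < B"
    and "(\<Sum>j<n. f j * B ^ j) = (\<Sum>j<n. g j * B ^ j)" and "j < n"
  shows "f j = g j"
  using assms
proof (induction n arbitrary: j)
  case (Suc n)
  have bound: "(\<Sum>j<m. h j * B ^ j) < B ^ m" if "\<And>j. j < m \<Longrightarrow> h j < B" for h :: "nat \<Rightarrow> nat" and m
    using that
  proof (induction m)
    case (Suc m)
    have "Suc (h m) * B ^ m \<le> B * B ^ m" using Suc.prems[of m] by (intro mult_le_mono1) simp
    then show ?case using Suc.IH Suc.prems by simp
  qed simp
  have lt: "(\<Sum>j<n. f j * B ^ j) < B ^ n" "(\<Sum>j<n. g j * B ^ j) < B ^ n"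
    using Suc.prems by (auto intro!: bound)
  have eq: "(\<Sum>j<n. f j * B ^ j) + f n * B ^ n = (\<Sum>j<n. g j * B ^ j) + g n * B ^ n"
    using Suc.prems(3) by simp
  have "(\<Sum>j<n. f j * B ^ j) = ((\<Sum>j<n. f j * B ^ j) + f n * B ^ n) mod B ^ n" using lt by simp
  also have "\<dots> = (\<Sum>j<n. g j * B ^ j)" unfolding eq using lt by simp
  finally have low: "(\<Sum>j<n. f j * B ^ j) = (\<Sum>j<n. g j * B ^ j)" .
  then have "f n * B ^ n = g n * B ^ n" using eq by simp
  moreover have "B ^ n > 0" using lt by linarith
  ultimately have "f n = g n" by (metis less_not_refl mult_cancel2)
  then show ?case using Suc.IH[OF _ _ low] Suc.prems by (auto simp: less_Suc_eq)
qed simp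

lemma lookup_mult_0: "lkp (f * g) 0 = lkp f 0 * lkp g 0" for f g :: "('v::finite, 'k::field) mpoly"
proof -
  have "f * g = (\<Sum>k\<in>Poly_Mapping.keys f. cst (lkp f k) * mon k * g)"
    by (subst mpoly_sum[of f]) (simp add: sum_distrib_right)
  also have "lkp \<dots> 0 = (\<Sum>k\<in>Poly_Mapping.keys f. if k = 0 then lkp f 0 * lkp g 0 else 0)"
    unfolding lookup_sum
  proof (rule sum.cong)
    fix k assume "k \<in> Poly_Mapping.keys f"
    show "lkp (cst (lkp f k) * mon k * g) 0 = (if k = 0 then lkp f 0 * lkp g 0 else 0)"
    proof (cases "k = 0")
      case True
      then show ?thesis by (simp add: mult_single lookup_cst_mult)
    next
      case False
      have "lkp (Poly_Mapping.single k (lkp f k) * g) 0 = 0"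
      proof (rule lookup_single_mult_0)
        fix n show "0 \<noteq> k + n"
        proof
          assume kn: "0 = k + n"
          have "lkp k v = 0" for v using arg_cong[OF kn, of "\<lambda>m. lkp m v"] by (simp add: lookup_add)
          then show False using False by (metis lookup_zero poly_mapping_eqI)
        qed
      qed
      then show ?thesis using False by (simp add: mult_single)
    qed
  qed simp
  also have "\<dots> = lkp f 0 * lkp g 0" by (simp add: in_keys_iff)
  finally show ?thesis .
qed

lemma lookup_power_0: "lkp (f ^ n) 0 = lkp f 0 ^ n" for f :: "('v::finite, 'k::field) mpoly"
  by (induction n) (simp_all add: lookup_mult_0)

context power_ideal
begin

section \<open>Integral dependence over \<open>J\<close>\<close>

lemma reduction_of_integral:
  assumes JH: "J \<le> H" and int: "\<And>h. h \<in>\<^sub>i H \<Longrightarrow> integral J h"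
  shows "reduction J H"
proof -
  have "J ^ 1 \<le> H" using JH by simp
  then obtain S where S: "finite S" "H = gen S" by (rule fin_gen_J)
  have SH: "h \<in>\<^sub>i H" if "h \<in> S" for h using that S(2) by auto
  have "\<forall>h. \<exists>n. h \<in> S \<longrightarrow> h ^ Suc n \<in>\<^sub>i J * (J + pr h) ^ n"
    using int SH unfolding integral_def by blast
  from choice[OF this] obtain N where N: "\<And>h. h \<in> S \<Longrightarrow> h ^ Suc (N h) \<in>\<^sub>i J * (J + pr h) ^ N h" by blast
  define n where "n = (\<Sum>h\<in>S. Suc (N h))"
  have sum: "H = (\<Sum>h\<in>S. pr h)" using gen_image_finite[OF S(1), of "\<lambda>x. x"] S(2) by simp
  have "(\<Sum>h\<in>S. pr h) ^ Suc n \<le> (\<Sum>h\<in>S. pr h ^ Suc (N h) * H ^ (Suc n - Suc (N h)))"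
    by (rule sum_power_le) (use S SH in \<open>auto simp: n_def\<close>)
  also have "\<dots> \<le> J * H ^ n"
  proof (subst sum_idl_le_iff[OF S(1)], intro ballI)
    fix h assume h: "h \<in> S"
    then have "Suc (N h) \<le> n" unfolding n_def using S(1) by (intro member_le_sum) auto
    have "J + pr h \<le> H" using JH SH[OF h] by simp
    then have "pr h ^ Suc (N h) \<le> J * H ^ N h"
      using memD[OF N[OF h] idl_mult_mono[OF order_refl idl_power_mono]] by (simp only: pr_power pr_le_iff)
    then have "pr h ^ Suc (N h) * H ^ (Suc n - Suc (N h)) \<le> (J * H ^ N h) * H ^ (Suc n - Suc (N h))"
      by (rule idl_mult_mono[OF _ order_refl])
    also have "\<dots> = J * H ^ n" using \<open>Suc (N h) \<le> n\<close> by (simp add: mult.assoc flip: power_add)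
    finally show "pr h ^ Suc (N h) * H ^ (Suc n - Suc (N h)) \<le> J * H ^ n" .
  qed
  finally show ?thesis using JH unfolding sum[symmetric] by (rule reductionI[rotated])
qed

lemma integral_if_stable:
  assumes "J ^ n \<le> M" "pr f * M \<le> J * M" shows "integral J f"
proof -
  obtain S where S: "finite S" "M = gen S" using assms(1) by (rule fin_gen_J)
  obtain v :: 'v where True by blast
  have "y v ^ n \<in>\<^sub>i gen S" using memD[OF mem_power[OF y_mem_J] assms(1)] S(2) by simp
  moreover have "x = 0" if "x * y v ^ n = 0" for x
    using that mon_nzd by (metis mult.commute y_power)
  ultimately show ?thesis using integral_of_stable[OF S(1)] assms(2) S(2) by blast
qed

text \<open>\<open>I\<close> is a reduction of \<open>T = I + pr h\<close> and \<open>J\<close> one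
  of \<open>I\<close>. Hence \<open>pr h * M \<le> J * M\<close> for a high power \<open>M\<close>
  of \<open>T\<close>, and the determinant trick applies; no equations are combined.\<close>

lemma integral_trans:
  assumes red: "reduction J I" and h: "integral I h" shows "integral J h"
proof -
  have JI: "J \<le> I" using red by (simp add: reduction_def)
  define T where "T = I + pr h"
  have IT: "I \<le> T" and hT: "pr h \<le> T" by (simp_all add: T_def mem_addI2)
  from h obtain q where "h ^ Suc q \<in>\<^sub>i I * T ^ q" unfolding integral_def T_def by blast
  then have q: "pr h ^ Suc q \<le> I * T ^ q" by (simp only: pr_power pr_le_iff)
  have "T ^ (1 + Suc q) \<le> I ^ 1 * T ^ Suc q + pr h ^ Suc q * T ^ 1"
    unfolding T_def by (rule add_power_le) (simp_all add: mem_addI2)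
  also have "\<dots> \<le> I * T ^ Suc q"
  proof -
    have "pr h ^ Suc q * T ^ 1 \<le> (I * T ^ q) * T ^ 1" by (rule idl_mult_mono[OF q order_refl])
    also have "\<dots> = I * T ^ Suc q" by (simp add: mult_ac)
    finally show ?thesis by simp
  qed
  finally have "reduction I T" using IT reductionI[of I T "Suc q"] by simp
  then obtain r1 where r1: "\<And>m n. m \<ge> r1 \<Longrightarrow> T ^ (n + m) = I ^ n * T ^ m" using reduction_powers by blast
  obtain r2 where r2: "\<And>m n. m \<ge> r2 \<Longrightarrow> I ^ (n + m) = J ^ n * I ^ m" using reduction_powers[OF red] by blast
  define M where "M = T ^ (r2 + r1)"
  have "J ^ (r2 + r1) \<le> M" unfolding M_def using order_trans[OF JI IT] by (rule idl_power_mono)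
  moreover have "pr h * M \<le> J * M"
  proof -
    have "pr h * M \<le> T ^ ((1 + r2) + r1)" unfolding M_def using idl_mult_mono[OF hT order_refl] by simp
    also have "\<dots> = I ^ (1 + r2) * T ^ r1" by (rule r1) simp
    also have "I ^ (1 + r2) = J ^ 1 * I ^ r2" by (rule r2) simp
    also have "J ^ 1 * I ^ r2 * T ^ r1 = J * M" unfolding M_def using r1[of r1 r2] by (simp add: mult.assoc)
    finally show ?thesis .
  qed
  ultimately show ?thesis by (rule integral_if_stable)
qed

text \<open>After normalisation \<open>\<nu> = 1 - c * s\<close> has no constant term, so
  \<open>\<nu> ^ p\<close> lies in \<open>F p\<close> and thus in \<open>J ^ N\<close>. The
  truncated geometric series is the inverse.\<close>

lemma unit_mod_J:
  fixes s :: "('v, 'k) mpoly"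
  assumes "lkp s 0 \<noteq> 0" shows "\<exists>s'. s' * s - 1 \<in>\<^sub>i J ^ N"
proof -
  define c :: "('v, 'k) mpoly" where "c = cst (1 / lkp s 0)"
  define \<nu> where "\<nu> = 1 - c * s"
  have "lkp \<nu> 0 = 0" using assms by (simp add: \<nu>_def c_def lookup_minus lookup_cst_mult)
  have "\<nu> \<in>\<^sub>i F 1"
    unfolding mem_V[OF superadd_wt]
  proof
    fix k assume k: "k \<in> Poly_Mapping.keys \<nu>"
    have "k \<noteq> 0"
    proof
      assume "k = 0"
      then show False using k \<open>lkp \<nu> 0 = 0\<close> by (simp add: in_keys_iff)
    qed
    then obtain v where "lkp k v \<noteq> 0" by (metis lookup_zero poly_mapping_eqI)
    then have "1 \<le> lkp k v * w v" using w_pos[of v] by (simp add: Suc_le_eq)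
    also have "\<dots> \<le> wt k" unfolding wt_def by (rule member_le_sum) auto
    finally show "1 \<le> wt k" .
  qed
  define p where "p = (N + CARD('v)) * L"
  have "\<nu> ^ p \<in>\<^sub>i J ^ N"
    using memD[OF mem_power[OF \<open>\<nu> \<in>\<^sub>i F 1\<close>] order_trans[OF V_power[OF superadd_wt order_refl] F_le_J], of N p]
    by (simp add: p_def)
  moreover have "((\<Sum>t<p. \<nu> ^ t) * c) * s - 1 = - (\<nu> ^ p)"
  proof -
    have "1 - \<nu> ^ p = (1 - \<nu>) * (\<Sum>t<p. \<nu> ^ t)" by (rule one_diff_power_eq)
    also have "1 - \<nu> = c * s" by (simp add: \<nu>_def)
    finally show ?thesis by (simp add: algebra_simps)
  qed
  ultimately show ?thesis by (metis mem_uminus)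
qed

text \<open>\<open>lin v0 \<mu>\<close> cuts the linear system spanned by the \<open>y v\<close> down to the single
  element \<open>y v0\<close>, by imposing \<open>y v = \<mu> v y v0\<close>.\<close>

definition lin :: "'v \<Rightarrow> ('v \<Rightarrow> 'k) \<Rightarrow> ('v, 'k) mpoly idl" where
  "lin v0 \<mu> = (\<Sum>v\<in>UNIV. pr (y v - cst (\<mu> v) * y v0))"

lemma lin_mem: "y v - cst (\<mu> v) * y v0 \<in>\<^sub>i lin v0 \<mu>"
  using mem_sum_idl[of UNIV v "\<lambda>v. pr (y v - cst (\<mu> v) * y v0)"] by (simp add: lin_def)

lemma lin_le_J: "lin v0 \<mu> \<le> J"
  unfolding lin_def by (simp add: sum_idl_le_iff mem_diff mem_mult_left y_mem_J)

lemma J_le_lin: "J \<le> pr (y v0) + lin v0 \<mu>"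
  unfolding J_y
proof (subst sum_idl_le_iff, simp, intro ballI)
  fix v
  have "cst (\<mu> v) * y v0 + (y v - cst (\<mu> v) * y v0) \<in>\<^sub>i pr (y v0) + lin v0 \<mu>"
    by (intro mem_add[OF mem_addI1 mem_addI2] mem_mult_left mem_pr_self lin_mem)
  then show "pr (y v) \<le> pr (y v0) + lin v0 \<mu>" by simp
qed

text \<open>The factor \<open>J ^ j\<close> beside \<open>lin\<close> is kept because
  \<open>reduction_pencil\<close> needs the corrections to the coefficients to retain their order in
  \<open>J\<close>.\<close>

lemma J_power_lin: "J ^ Suc j \<le> pr (y v0 ^ Suc j) + lin v0 \<mu> * J ^ j"
proof (induction j)
  case 0
  then show ?case using J_le_lin by simp
next
  case (Suc j)
  let ?Y = "y v0 ^ Suc j" and ?R = "lin v0 \<mu> * J ^ Suc j"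
  have "lin v0 \<mu> * pr ?Y \<le> ?R"
    by (rule idl_mult_mono[OF order_refl]) (simp only: pr_le_iff mem_power[OF y_mem_J])
  then have "(pr (y v0) + lin v0 \<mu>) * pr ?Y \<le> pr (y v0 ^ Suc (Suc j)) + ?R"
    unfolding distrib_right pr_mult power_Suc[of _ "Suc j"] by (rule add_left_mono)
  then have *: "J * pr ?Y \<le> pr (y v0 ^ Suc (Suc j)) + ?R"
    using order_trans[OF idl_mult_mono[OF J_le_lin order_refl]] by blast
  have "J ^ Suc (Suc j) \<le> J * (pr ?Y + lin v0 \<mu> * J ^ j)"
    unfolding power_Suc[of J "Suc j"] by (rule idl_mult_mono[OF order_refl Suc])
  also have "\<dots> = J * pr ?Y + ?R"
    by (simp add: distrib_left mult_ac)
  also have "\<dots> \<le> (pr (y v0 ^ Suc (Suc j)) + ?R) + ?R"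
    using * by (rule add_right_mono)
  finally show ?case by (simp add: add.assoc)
qed

text \<open>Sorted by the residues of exponents modulo the \<open>a v\<close>, a polynomial becomes
  a family of polynomials in the \<open>y v\<close>. Setting all \<open>y v\<close> to scalar
  multiples of one of them tests its part of order \<open>p < q\<close>, which must vanish at every
  specialisation. A Kronecker substitution reduces the test to a polynomial in one scalar
  \<open>\<theta>\<close>.\<close>

lemma lin_specialise:
  assumes e: "bij_betw e {..<CARD('v)} (UNIV :: 'v set)"
    and f: "\<And>\<mu>. \<mu> (e 0) = 1 \<Longrightarrow> f \<in>\<^sub>i pr (y (e 0) ^ q) + lin (e 0) \<mu>"
  shows "f \<in>\<^sub>i J ^ q"
proof -
  let ?d = "CARD('v)"
  define dig where "dig k v = lkp k v div a v" for k :: "'v \<Rightarrow>\<^sub>0 nat" and v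
  define i where "i v = the_inv_into {..<?d} e v" for v
  have ie: "i (e j) = j" if "j < ?d" for j
    unfolding i_def using that by (intro the_inv_into_f_f bij_betw_imp_inj_on[OF e]) auto
  \<comment> \<open>Base \<open>Suc q\<close> exceeds every digit of a monomial of order below
    \<open>q\<close>. The index \<open>0\<close> gets exponent \<open>0\<close> because
    \<open>\<mu> (e 0)\<close> has to be \<open>1\<close>.\<close>
  define \<kappa> where "\<kappa> v = (if i v = 0 then 0 else Suc q ^ i v)" for v
  define enc where "enc k = (\<Sum>v\<in>UNIV. dig k v * \<kappa> v)" for k
  define T where "T \<gamma> p = {k. (\<forall>v. lkp k v mod a v = \<gamma> v) \<and> ord k = p}" for \<gamma> p
  have finT: "finite (T \<gamma> p)" for \<gamma> p
  proof (rule finite_subset[OF _ finite_box[of "\<lambda>v. Suc p * a v"]], safe)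
    fix k v assume "k \<in> T \<gamma> p"
    then have "lkp k v div a v \<le> p" unfolding T_def ord_def
      using member_le_sum[of v UNIV "\<lambda>v. lkp k v div a v"] by auto
    then have "lkp k v div a v < Suc p" by simp
    then show "lkp k v < Suc p * a v" by (simp add: div_less_iff_less_mult a_pos)
  qed
  \<comment> \<open>Evaluation \<open>y v = \<theta> ^ \<kappa> v\<close> of the part with residues
    \<open>\<gamma>\<close> and order \<open>p\<close>. It annihilates \<open>lin\<close> for
    \<open>\<mu> v = \<theta> ^ \<kappa> v\<close>.\<close>
  define \<Phi> where "\<Phi> \<theta> \<gamma> p g = (\<Sum>k\<in>T \<gamma> p. lkp g k * \<theta> ^ enc k)" for \<theta> :: 'k and \<gamma> p g
  have \<Phi>_add: "\<Phi> \<theta> \<gamma> p (g + h) = \<Phi> \<theta> \<gamma> p g + \<Phi> \<theta> \<gamma> p h" for \<theta> \<gamma> p g h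
    by (simp add: \<Phi>_def lookup_add distrib_right sum.distrib)
  have \<Phi>_diff: "\<Phi> \<theta> \<gamma> p (g - h) = \<Phi> \<theta> \<gamma> p g - \<Phi> \<theta> \<gamma> p h" for \<theta> \<gamma> p g h
    by (simp add: \<Phi>_def lookup_minus left_diff_distrib sum_subtractf)
  have \<Phi>_cst: "\<Phi> \<theta> \<gamma> p (cst c * g) = c * \<Phi> \<theta> \<gamma> p g" for \<theta> \<gamma> p c g
    by (simp add: \<Phi>_def lookup_cst_mult sum_distrib_left mult.assoc)
  have \<Phi>_sum: "\<Phi> \<theta> \<gamma> p (sum g S) = (\<Sum>s\<in>S. \<Phi> \<theta> \<gamma> p (g s))" if "finite S" for \<theta> \<gamma> p g and S :: "'v set"
    using that by (induction S rule: finite_induct) (simp_all add: \<Phi>_add, simp add: \<Phi>_def)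
  have \<Phi>_y: "\<Phi> \<theta> \<gamma> p (y v * g) = (if p = 0 then 0 else \<theta> ^ \<kappa> v * \<Phi> \<theta> \<gamma> (p - 1) g)" for \<theta> \<gamma> p v g
  proof -
    let ?s = "Poly_Mapping.single v (a v)"
    have zero: "lkp (y v * g) k = 0" if "k \<notin> range ((+) ?s)" for k
      using that unfolding y_def by (intro lookup_single_mult_0) auto
    have digs: "dig (?s + k) u = (if u = v then 1 else 0) + dig k u" for k u
      using a_pos[of u] by (auto simp: dig_def lookup_add lookup_single when_def)
    have encs: "enc (?s + k) = \<kappa> v + enc k" for k
    proof -
      have "enc (?s + k) = (\<Sum>u\<in>UNIV. (if u = v then \<kappa> v else 0) + dig k u * \<kappa> u)"
        unfolding enc_def digs by (intro sum.cong) (auto simp: distrib_right)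
      then show ?thesis by (simp add: sum.distrib enc_def)
    qed
    have ordS: "ord (?s + k) = Suc (ord k)" for k using ord_single_add[of v 1 k] by simp
    have modS: "lkp (?s + k) u mod a u = lkp k u mod a u" for k u
      by (auto simp: lookup_add lookup_single when_def)
    show ?thesis
    proof (cases p)
      case 0
      have "lkp (y v * g) k = 0" if "k \<in> T \<gamma> p" for k
      proof (rule zero)
        show "k \<notin> range ((+) ?s)" using that ordS by (auto simp: T_def 0)
      qed
      then show ?thesis by (simp add: \<Phi>_def 0)
    next
      case (Suc p')
      have sub: "(+) ?s ` T \<gamma> p' \<subseteq> T \<gamma> p" by (auto simp: T_def Suc ordS modS)
      have "\<Phi> \<theta> \<gamma> p (y v * g) = (\<Sum>k\<in>(+) ?s ` T \<gamma> p'. lkp (y v * g) k * \<theta> ^ enc k)"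
        unfolding \<Phi>_def
      proof (rule sum.mono_neutral_right[OF finT sub], intro ballI)
        fix k assume k: "k \<in> T \<gamma> p - (+) ?s ` T \<gamma> p'"
        have "k \<notin> range ((+) ?s)" using k by (auto simp: T_def Suc ordS modS)
        then show "lkp (y v * g) k * \<theta> ^ enc k = 0" by (simp add: zero)
      qed
      also have "\<dots> = (\<Sum>k\<in>T \<gamma> p'. lkp (y v * g) (?s + k) * \<theta> ^ enc (?s + k))"
        by (subst sum.reindex) (auto simp: inj_on_def)
      also have "\<dots> = \<theta> ^ \<kappa> v * \<Phi> \<theta> \<gamma> p' g"
        unfolding \<Phi>_def sum_distrib_left
        by (intro sum.cong) (auto simp: encs power_add y_def lookup_single_mult)
      finally show ?thesis by (simp add: Suc)
    qed
  qed
  have \<kappa>0: "\<kappa> (e 0) = 0" by (simp add: \<kappa>_def ie)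
  have \<Phi>f: "\<Phi> \<theta> \<gamma> p f = 0" if p: "p < q" for \<theta> \<gamma> p
  proof -
    define \<mu> where "\<mu> v = \<theta> ^ \<kappa> v" for v
    have "f \<in>\<^sub>i pr (y (e 0) ^ q) + lin (e 0) \<mu>" by (rule f) (simp add: \<mu>_def \<kappa>0)
    then obtain g h where gh: "f = g + h" "g \<in>\<^sub>i pr (y (e 0) ^ q)" "h \<in>\<^sub>i lin (e 0) \<mu>"
      unfolding mem_plus by blast
    have "\<Phi> \<theta> \<gamma> p g = 0"
    proof -
      have gJ: "g \<in>\<^sub>i J ^ q" using memD[OF gh(2), of "J ^ q"] by (simp add: mem_power y_mem_J)
      have "lkp g k = 0" if "k \<in> T \<gamma> p" for k
        using gJ that p unfolding mem_J_power T_def by (force simp: in_keys_iff)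
      then show ?thesis by (simp add: \<Phi>_def)
    qed
    moreover have "\<Phi> \<theta> \<gamma> p h = 0"
    proof -
      obtain c where c: "\<And>v. c v \<in>\<^sub>i pr (y v - cst (\<mu> v) * y (e 0))" "h = (\<Sum>v\<in>UNIV. c v)"
        using mem_sum_idl_obtain[OF finite gh(3)[unfolded lin_def]] by auto
      have "\<Phi> \<theta> \<gamma> p (c v) = 0" for v
      proof -
        obtain r where "c v = (y v - cst (\<mu> v) * y (e 0)) * r" using c(1)[of v] by (auto simp: mem_pr)
        then have "c v = y v * r - cst (\<mu> v) * (y (e 0) * r)" by (simp add: algebra_simps)
        then show ?thesis by (simp add: \<Phi>_diff \<Phi>_cst \<Phi>_y \<kappa>0 \<mu>_def)
      qed
      then show ?thesis by (simp add: c(2) \<Phi>_sum)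
    qed
    ultimately show ?thesis by (simp add: gh(1) \<Phi>_add)
  qed
  \<comment> \<open>The code does not see the digit at \<open>e 0\<close>, but on
    \<open>T \<gamma> p\<close> that digit is determined by the order \<open>p\<close> and the other
    digits.\<close>
  have enc_inj: "inj_on enc (T \<gamma> p)" if p: "p < q" for \<gamma> p
  proof (rule inj_onI)
    fix k l assume k: "k \<in> T \<gamma> p" and l: "l \<in> T \<gamma> p" and eq: "enc k = enc l"
    have dig_le: "dig m v \<le> p" if "m \<in> T \<gamma> p" for m v
      using that member_le_sum[of v UNIV "\<lambda>v. lkp m v div a v"] by (auto simp: T_def ord_def dig_def)
    define f where "f m j = (if j = 0 then 0 else dig m (e j))" for m j
    have enc': "enc m = (\<Sum>j<?d. f m j * Suc q ^ j)" for m
      unfolding enc_def sum.reindex_bij_betw[OF e, symmetric, of "\<lambda>v. dig m v * \<kappa> v"]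
      by (intro sum.cong) (auto simp: \<kappa>_def ie f_def)
    have fq: "f m j < Suc q" if "m \<in> T \<gamma> p" for m j
      using dig_le[OF that, of "e j"] p by (simp add: f_def)
    have fkl: "f k j = f l j" if "j < ?d" for j
      by (rule radix_inj[of ?d "f k" "Suc q" "f l"]) (use fq[OF k] fq[OF l] eq enc' that in simp_all)
    have nz: "dig k (e j) = dig l (e j)" if "j < ?d" "j \<noteq> 0" for j
      using fkl[OF that(1)] that(2) by (simp add: f_def)
    have ordsum: "ord m = dig m (e 0) + (\<Sum>j\<in>{..<?d} - {0}. dig m (e j))" for m
      unfolding ord_def sum.reindex_bij_betw[OF e, symmetric, of "\<lambda>v. lkp m v div a v"] dig_def
      by (subst sum.remove[of _ 0]) auto
    have "(\<Sum>j\<in>{..<?d} - {0}. dig k (e j)) = (\<Sum>j\<in>{..<?d} - {0}. dig l (e j))"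
      by (intro sum.cong) (auto simp: nz)
    moreover have "ord k = ord l" using k l by (simp add: T_def)
    ultimately have "dig k (e 0) = dig l (e 0)" unfolding ordsum by simp
    then have all: "dig k (e j) = dig l (e j)" if "j < ?d" for j using nz that by (cases "j = 0") auto
    show "k = l"
    proof (rule poly_mapping_eqI)
      fix v
      obtain j where "j < ?d" "v = e j" using e unfolding bij_betw_def by (metis UNIV_I imageE lessThan_iff)
      then have "lkp k v div a v = lkp l v div a v" using all by (simp add: dig_def)
      moreover have "lkp k v mod a v = lkp l v mod a v" using k l by (simp add: T_def)
      ultimately show "lkp k v = lkp l v" by (metis div_mult_mod_eq)
    qed
  qed
  show ?thesis
    unfolding mem_J_power
  proof
    fix k assume kf: "k \<in> Poly_Mapping.keys f"
    show "q \<le> ord k"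
    proof (rule ccontr)
      assume "\<not> q \<le> ord k"
      then have p: "ord k < q" by simp
      define \<gamma> where "\<gamma> v = lkp k v mod a v" for v
      let ?T = "T \<gamma> (ord k)"
      have kT: "k \<in> ?T" by (simp add: T_def \<gamma>_def)
      define P where "P = (\<Sum>l\<in>?T. Polynomial.monom (lkp f l) (enc l))"
      have "poly P \<theta> = \<Phi> \<theta> \<gamma> (ord k) f" for \<theta>
        by (simp add: P_def \<Phi>_def poly_sum poly_monom)
      then have "poly P \<theta> = 0" for \<theta> using \<Phi>f[OF p] by simp
      then have "P = 0" using poly_roots_finite[of P] inf_k by (metis (mono_tags, lifting) Collect_cong UNIV_def)
      moreover have "poly.coeff P (enc k) = lkp f k"
      proof -
        have "poly.coeff P (enc k) = (\<Sum>l\<in>?T. if l = k then lkp f k else 0)"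
          unfolding P_def coeff_sum
          by (intro sum.cong) (auto dest: inj_onD[OF enc_inj[OF p] _ _ kT])
        then show ?thesis using kT finT by simp
      qed
      ultimately show False using kf by (simp add: in_keys_iff)
    qed
  qed
qed


text \<open>The reductions used below are \<open>(y v0 + l h) + lin v0 \<mu> + J\<^sup>N\<close>; the summand \<open>J\<^sup>N\<close>
  makes up for working in the polynomial ring instead of its localisation at the origin.\<close>

lemma reduction_pencil:
  assumes red: "reduction J H" and h: "h \<in>\<^sub>i H" and \<mu>: "\<mu> v0 = 1"
    and eq: "h ^ q = (\<Sum>j=1..q. c j * h ^ (q - j))" and q: "q \<ge> 1"
    and c: "\<And>j. j \<in> {1..q} \<Longrightarrow> c j - b j * y v0 ^ j \<in>\<^sub>i lin v0 \<mu> * J ^ (j - 1)"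
    and unit: "lkp (1 - (\<Sum>j=1..q. b j * cst (- l) ^ j)) 0 \<noteq> 0"
    and N: "N \<ge> 1"
  shows "reduction (pr (y v0 + cst l * h) + lin v0 \<mu> + J ^ N) H"
proof -
  have JH: "J \<le> H" using red by (simp add: reduction_def)
  define x where "x = y v0 + cst l * h"
  define K0 where "K0 = pr x + lin v0 \<mu>"
  define K where "K = K0 + J ^ N"
  define s where "s = 1 - (\<Sum>j=1..q. b j * cst (- l) ^ j)"
  have yH: "y v \<in>\<^sub>i H" for v by (rule memD[OF y_mem_J JH])
  have lH: "cst (- l) * h \<in>\<^sub>i H" using h by auto
  have neg: "cst (- l) = - (cst l :: ('v, 'k) mpoly)" by (simp add: single_uminus)
  have JN: "J ^ N \<le> J" using idl_power_anti[OF N, of J] by simp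
  have KH: "K \<le> H"
    using JH order_trans[OF lin_le_J JH] order_trans[OF JN JH] yH h
    by (auto simp: K_def K0_def x_def intro!: mem_add mem_mult_left)
  have Hq: "H ^ (j - 1) * H ^ (q - j) = H ^ (q - 1)" if "j \<in> {1..q}" for j
    using that by (simp flip: power_add)
  \<comment> \<open>Replacing \<open>c j\<close> by \<open>b j * y v0 ^ j\<close> costs a multiple
    of \<open>lin\<close>, and replacing \<open>y v0\<close> by \<open>- l h\<close> costs a
    multiple of \<open>x\<close>. Summed up, the integral equation becomes
    \<open>s * h ^ q = 0\<close> modulo \<open>K0 * H ^ (q - 1)\<close>.\<close>
  have trm: "c j * h ^ (q - j) - b j * cst (- l) ^ j * h ^ q \<in>\<^sub>i K0 * H ^ (q - 1)" if j: "j \<in> {1..q}" for j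
  proof -
    have "(c j - b j * y v0 ^ j) * h ^ (q - j) \<in>\<^sub>i (lin v0 \<mu> * J ^ (j - 1)) * H ^ (q - j)"
      by (intro mem_times c[OF j] mem_power h)
    also have "\<dots> \<le> (K0 * H ^ (j - 1)) * H ^ (q - j)"
      by (intro idl_mult_mono idl_power_mono JH order_refl) (simp add: K0_def)
    also have "\<dots> = K0 * H ^ (q - 1)" using Hq[OF j] by (simp add: mult.assoc)
    finally have 1: "(c j - b j * y v0 ^ j) * h ^ (q - j) \<in>\<^sub>i K0 * H ^ (q - 1)" .
    obtain i where i: "j = Suc i" using j by (cases j) auto
    have "y v0 ^ j - (cst (- l) * h) ^ j = x * (\<Sum>t<Suc i. y v0 ^ t * (cst (- l) * h) ^ (i - t))"
      unfolding i diff_power_eq_sum by (simp add: x_def neg)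
    moreover have "(\<Sum>t<Suc i. y v0 ^ t * (cst (- l) * h) ^ (i - t)) \<in>\<^sub>i H ^ (j - 1)"
    proof (rule mem_sum)
      fix t assume "t \<in> {..<Suc i}"
      then have "H ^ t * H ^ (i - t) = H ^ (j - 1)" by (simp add: i flip: power_add)
      then show "y v0 ^ t * (cst (- l) * h) ^ (i - t) \<in>\<^sub>i H ^ (j - 1)"
        using mem_times[OF mem_power[OF yH] mem_power[OF lH]] by metis
    qed
    ultimately have "(y v0 ^ j - (cst (- l) * h) ^ j) * h ^ (q - j) \<in>\<^sub>i (K0 * H ^ (j - 1)) * H ^ (q - j)"
      by (simp only:) (intro mem_times mem_power h, auto simp: K0_def intro: mem_addI1)
    also have "(K0 * H ^ (j - 1)) * H ^ (q - j) = K0 * H ^ (q - 1)" using Hq[OF j] by (simp add: mult.assoc)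
    finally have 2: "b j * ((y v0 ^ j - (cst (- l) * h) ^ j) * h ^ (q - j)) \<in>\<^sub>i K0 * H ^ (q - 1)" by (rule mem_mult_left)
    have hq: "h ^ j * h ^ (q - j) = h ^ q" using j by (simp flip: power_add)
    have "(c j - b j * y v0 ^ j) * h ^ (q - j) + b j * ((y v0 ^ j - (cst (- l) * h) ^ j) * h ^ (q - j))
        = c j * h ^ (q - j) - b j * (cst (- l) ^ j * (h ^ j * h ^ (q - j)))"
      by (simp add: power_mult_distrib algebra_simps)
    also have "\<dots> = c j * h ^ (q - j) - b j * cst (- l) ^ j * h ^ q" by (simp only: hq mult.assoc)
    finally show ?thesis using mem_add[OF 1 2] by simp
  qed
  have "s * h ^ q = (\<Sum>j=1..q. c j * h ^ (q - j)) - (\<Sum>j=1..q. b j * cst (- l) ^ j * h ^ q)"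
    unfolding s_def left_diff_distrib sum_distrib_right eq[symmetric] by simp
  also have "\<dots> = (\<Sum>j=1..q. c j * h ^ (q - j) - b j * cst (- l) ^ j * h ^ q)" by (simp add: sum_subtractf)
  also have "\<dots> \<in>\<^sub>i K0 * H ^ (q - 1)" using trm by (rule mem_sum)
  finally have sh: "s * h ^ q \<in>\<^sub>i K0 * H ^ (q - 1)" .
  obtain s' where s': "s' * s - 1 \<in>\<^sub>i J ^ N" using unit_mod_J[of s N] unit by (auto simp: s_def)
  have "h ^ q = s' * (s * h ^ q) - (s' * s - 1) * h ^ q" by (simp add: algebra_simps)
  also have "\<dots> \<in>\<^sub>i K * H ^ (q - 1)"
  proof (rule mem_diff)
    show "s' * (s * h ^ q) \<in>\<^sub>i K * H ^ (q - 1)"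
      by (rule memD[OF mem_mult_left[OF sh] idl_mult_mono[OF _ order_refl]]) (simp add: K_def)
    have "h ^ q \<in>\<^sub>i H ^ (q - 1)"
      using memD[OF mem_power[OF h] idl_power_anti[of "q - 1" q H]] by simp
    then show "(s' * s - 1) * h ^ q \<in>\<^sub>i K * H ^ (q - 1)"
      by (rule mem_times[rotated]) (use s' in \<open>auto simp: K_def intro: mem_addI2\<close>)
  qed
  finally have hq: "pr (h ^ q) \<le> K * H ^ (q - 1)" by simp
  have JK: "J \<le> K + pr h"
    unfolding J_y
  proof (subst sum_idl_le_iff, simp, intro ballI)
    fix v
    have "y v = (y v - cst (\<mu> v) * y v0) + cst (\<mu> v) * (x - cst l * h)" by (simp add: x_def)
    also have "\<dots> \<in>\<^sub>i K + pr h"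
    proof (intro mem_add)
      show "y v - cst (\<mu> v) * y v0 \<in>\<^sub>i K + pr h"
        unfolding K_def K0_def by (intro mem_addI1 mem_addI2[OF lin_mem])
      have "x \<in>\<^sub>i K + pr h" unfolding K_def K0_def by (intro mem_addI1 mem_pr_self)
      moreover have "cst l * h \<in>\<^sub>i K + pr h" by (intro mem_addI2 mem_mult_left mem_pr_self)
      ultimately show "cst (\<mu> v) * (x - cst l * h) \<in>\<^sub>i K + pr h" by (rule mem_mult_left[OF mem_diff])
    qed
    finally show "pr (y v) \<le> K + pr h" by simp
  qed
  obtain r where r: "\<And>m n. m \<ge> r \<Longrightarrow> H ^ (n + m) = J ^ n * H ^ m" using reduction_powers[OF red] by blast
  \<comment> \<open>By \<open>J \<le> K + pr h\<close> a high power of \<open>H\<close> is a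
    multiple of \<open>K\<close> up to powers of \<open>h\<close>; at exponent \<open>q\<close> the
    power of \<open>h\<close> is absorbed as well.\<close>
  have iter: "H ^ (r + Suc t) \<le> K * H ^ (r + t) + pr (h ^ Suc t) * H ^ r" for t
  proof (induction t)
    case 0
    have "H ^ (1 + r) = J ^ 1 * H ^ r" by (rule r) simp
    also have "\<dots> \<le> (K + pr h) * H ^ r" using idl_mult_mono[OF JK order_refl] by simp
    finally show ?case by (simp add: distrib_right add.commute[of r])
  next
    case (Suc t)
    have "H ^ (1 + (r + Suc t)) = J ^ 1 * H ^ (r + Suc t)" by (rule r) simp
    also have "\<dots> \<le> (K + pr h) * H ^ (r + Suc t)" using idl_mult_mono[OF JK order_refl] by simp
    also have "\<dots> = K * H ^ (r + Suc t) + pr h * H ^ (r + Suc t)" by (rule distrib_right)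
    also have "\<dots> \<le> K * H ^ (r + Suc t) + (K * H ^ (r + Suc t) + pr (h ^ Suc (Suc t)) * H ^ r)"
    proof (rule add_left_mono)
      have "pr h * H ^ (r + Suc t) \<le> pr h * (K * H ^ (r + t) + pr (h ^ Suc t) * H ^ r)"
        by (rule idl_mult_mono[OF order_refl Suc])
      also have "\<dots> = K * (pr h * H ^ (r + t)) + pr (h ^ Suc (Suc t)) * H ^ r"
        by (simp add: distrib_left mult_ac flip: pr_mult)
      also have "K * (pr h * H ^ (r + t)) + pr (h ^ Suc (Suc t)) * H ^ r
          \<le> K * (H * H ^ (r + t)) + pr (h ^ Suc (Suc t)) * H ^ r"
        by (intro add_right_mono idl_mult_mono order_refl) (simp add: h)
      finally show "pr h * H ^ (r + Suc t) \<le> K * H ^ (r + Suc t) + pr (h ^ Suc (Suc t)) * H ^ r" by simp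
    qed
    finally show ?case by (simp add: add.assoc[symmetric])
  qed
  obtain t where t: "q = Suc t" using q by (cases q) auto
  have "pr (h ^ Suc t) * H ^ r \<le> (K * H ^ t) * H ^ r"
    using hq unfolding t by (intro idl_mult_mono) simp_all
  also have "\<dots> = K * H ^ (r + t)" by (simp add: power_add mult_ac)
  finally have "H ^ (r + Suc t) \<le> K * H ^ (r + t)" using order_trans[OF iter[of t]] by simp
  then have "reduction K H" using KH by (intro reductionI[of K H "r + t"]) simp_all
  then show ?thesis by (simp add: K_def K0_def x_def)
qed

text \<open>The \<open>E n\<close> are the Horner partial values of the equation for
  \<open>h\<close> with coefficients \<open>b j * y0 ^ j\<close>. The sum is a cofactor that turns
  \<open>y0 - l * h\<close> into a multiple of \<open>y0 ^ n\<close>, up to a multiple of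
  \<open>E n\<close>, and it is polynomial in \<open>l\<close>.\<close>

lemma horner_telescope:
  fixes y0 :: "'a::comm_ring_1"
  assumes E0: "E 0 = 1" and ES: "\<And>n. E (Suc n) = h * E n - b (Suc n) * y0 ^ Suc n"
  shows "(y0 - l * h) * (\<Sum>i<n. l ^ i * y0 ^ (n - Suc i) * E i)
      = y0 ^ n * (1 - (\<Sum>j=1..n. b j * l ^ j)) - l ^ n * E n"
proof (induction n)
  case (Suc n)
  have "(\<Sum>i<n. l ^ i * y0 ^ (Suc n - Suc i) * E i) = (\<Sum>i<n. y0 * (l ^ i * y0 ^ (n - Suc i) * E i))"
  proof (rule sum.cong)
    fix i assume "i \<in> {..<n}"
    then have "Suc n - Suc i = Suc (n - Suc i)" by auto
    then show "l ^ i * y0 ^ (Suc n - Suc i) * E i = y0 * (l ^ i * y0 ^ (n - Suc i) * E i)"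
      by (simp add: mult_ac)
  qed simp
  then have "(y0 - l * h) * (\<Sum>i<Suc n. l ^ i * y0 ^ (Suc n - Suc i) * E i)
      = y0 * ((y0 - l * h) * (\<Sum>i<n. l ^ i * y0 ^ (n - Suc i) * E i)) + (y0 - l * h) * (l ^ n * E n)"
    by (simp add: distrib_left sum_distrib_left mult_ac)
  also have "\<dots> = y0 * (y0 ^ n * (1 - (\<Sum>j=1..n. b j * l ^ j)) - l ^ n * E n) + (y0 - l * h) * (l ^ n * E n)"
    by (simp only: Suc)
  also have "\<dots> = y0 ^ Suc n * (1 - (\<Sum>j=1..Suc n. b j * l ^ j)) - l ^ Suc n * E (Suc n)"
    unfolding ES by (simp add: algebra_simps)
  finally show ?case .
qed (simp add: E0)

text \<open>A reduction from the pencil puts \<open>g\<close> into \<open>pr x + A\<close> with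
  \<open>x = y v0 + cst l * h\<close>, and only \<open>x\<close> depends on \<open>l\<close>. The
  cofactor \<open>\<Psi>\<close> sends \<open>x\<close> into \<open>A\<close>, so
  \<open>g * \<Psi>\<close> lies in \<open>A\<close> for infinitely many \<open>l\<close>, and its
  coefficients in \<open>l\<close> can be separated.\<close>

theorem core_bound:
  assumes red: "reduction J H" and h: "h \<in>\<^sub>i H" and int: "integral J h"
    and g: "\<And>K. reduction K H \<Longrightarrow> g \<in>\<^sub>i K"
  shows "g * h ^ i \<in>\<^sub>i J ^ Suc i"
proof -
  obtain n c0 where n: "n \<ge> 1" and c0: "\<And>j. j \<in> {1..n} \<Longrightarrow> c0 j \<in>\<^sub>i J ^ j"
    and eq0: "h ^ n = (\<Sum>j=1..n. c0 j * h ^ (n - j))"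
    using int unfolding integral_iff by blast
  \<comment> \<open>Multiplying the equation by \<open>h ^ Suc i\<close> ensures
    \<open>i < q\<close>, so that \<open>h ^ i\<close> occurs among the powers recovered; the
    additional coefficients are \<open>0\<close>.\<close>
  define q where "q = n + Suc i"
  define c where "c j = (if j \<le> n then c0 j else 0)" for j
  have q: "q \<ge> 1" "i < q" by (simp_all add: q_def)
  have c: "c j \<in>\<^sub>i J ^ j" if "j \<in> {1..q}" for j using c0[of j] that by (auto simp: c_def)
  have eq: "h ^ q = (\<Sum>j=1..q. c j * h ^ (q - j))"
  proof -
    have "h ^ q = (\<Sum>j=1..n. c0 j * h ^ (n - j)) * h ^ Suc i"
      unfolding q_def power_add eq0[symmetric] ..
    also have "\<dots> = (\<Sum>j=1..n. c j * h ^ (q - j))"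
      unfolding sum_distrib_right
    proof (rule sum.cong)
      fix j assume "j \<in> {1..n}"
      then have "q - j = (n - j) + Suc i" "c j = c0 j" by (auto simp: q_def c_def)
      then show "c0 j * h ^ (n - j) * h ^ Suc i = c j * h ^ (q - j)" by (simp only: power_add mult.assoc)
    qed simp
    also have "\<dots> = (\<Sum>j=1..q. c j * h ^ (q - j))"
      by (rule sum.mono_neutral_left) (auto simp: c_def q_def)
    finally show ?thesis .
  qed
  obtain e where e: "bij_betw e {..<CARD('v)} (UNIV :: 'v set)"
    using ex_bij_betw_nat_finite[of "UNIV :: 'v set"] by (auto simp: lessThan_atLeast0)
  define v0 where "v0 = e 0"
  \<comment> \<open>Padding with a power of \<open>y v0\<close> brings \<open>h ^ i\<close> to total
    degree \<open>q - 1\<close>, the degree of \<open>\<Psi>\<close>; the power is cancelled at the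
    end.\<close>
  have "g * (y v0 ^ (q - Suc i) * h ^ i) \<in>\<^sub>i J ^ q"
  proof (rule lin_specialise[OF e], fold v0_def)
    fix \<mu> :: "'v \<Rightarrow> 'k" assume \<mu>: "\<mu> v0 = 1"
    define A where "A = pr (y v0 ^ q) + lin v0 \<mu>"
    have "\<forall>j. \<exists>b. j \<in> {1..q} \<longrightarrow> c j - b * y v0 ^ j \<in>\<^sub>i lin v0 \<mu> * J ^ (j - 1)"
    proof (intro allI)
      fix j show "\<exists>b. j \<in> {1..q} \<longrightarrow> c j - b * y v0 ^ j \<in>\<^sub>i lin v0 \<mu> * J ^ (j - 1)"
      proof (cases "j \<in> {1..q}")
        case True
        then obtain k where k: "j = Suc k" by (cases j) auto
        have "c j \<in>\<^sub>i pr (y v0 ^ j) + lin v0 \<mu> * J ^ (j - 1)"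
          using memD[OF c[OF True], of "pr (y v0 ^ j) + lin v0 \<mu> * J ^ (j - 1)"] J_power_lin[of k v0 \<mu>] by (simp add: k)
        then obtain u r where "c j = u + r" "u \<in>\<^sub>i pr (y v0 ^ j)" "r \<in>\<^sub>i lin v0 \<mu> * J ^ (j - 1)" unfolding mem_plus by blast
        moreover from this(2) obtain b where "u = y v0 ^ j * b" unfolding mem_pr by blast
        ultimately have "c j - b * y v0 ^ j \<in>\<^sub>i lin v0 \<mu> * J ^ (j - 1)" by (simp add: mult.commute)
        then show ?thesis by blast
      next
        case False
        then show ?thesis by blast
      qed
    qed
    from choice[OF this] obtain b where b: "\<And>j. j \<in> {1..q} \<Longrightarrow> c j - b j * y v0 ^ j \<in>\<^sub>i lin v0 \<mu> * J ^ (j - 1)" by blast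
    define E where "E = rec_nat (1 :: ('v, 'k) mpoly) (\<lambda>n e. h * e - b (Suc n) * y v0 ^ Suc n)"
    have E0: "E 0 = 1" and ES: "E (Suc n) = h * E n - b (Suc n) * y v0 ^ Suc n" for n by (simp_all add: E_def)
    have E: "E n = h ^ n - (\<Sum>j=1..n. b j * y v0 ^ j * h ^ (n - j))" for n
    proof (induction n)
      case (Suc n)
      have "(\<Sum>j=1..n. b j * y v0 ^ j * h ^ (Suc n - j)) = (\<Sum>j=1..n. h * (b j * y v0 ^ j * h ^ (n - j)))"
        by (intro sum.cong) (auto simp: Suc_diff_le mult_ac)
      then show ?case unfolding ES Suc by (simp add: right_diff_distrib sum_distrib_left)
    qed (simp add: E0)
    have EqL: "E q \<in>\<^sub>i lin v0 \<mu>"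
    proof -
      have "E q = (\<Sum>j=1..q. (c j - b j * y v0 ^ j) * h ^ (q - j))"
        unfolding E eq by (simp add: left_diff_distrib sum_subtractf)
      moreover have "(c j - b j * y v0 ^ j) * h ^ (q - j) \<in>\<^sub>i lin v0 \<mu>" if "j \<in> {1..q}" for j
        using memD[OF b[OF that] idl_mult_le1[OF order_refl]] by (rule mem_mult_right)
      ultimately show ?thesis by auto
    qed
    define S where "S l = 1 - (\<Sum>j=1..q. b j * cst (- l) ^ j)" for l
    \<comment> \<open>The scalars for which the pencil gives a reduction. All but finitely many
      qualify, because the constant term of \<open>S l\<close> is a polynomial in \<open>l\<close>
      with value \<open>1\<close> at \<open>0\<close>.\<close>
    define \<Gamma> where "\<Gamma> = {l. lkp (S l) 0 \<noteq> 0}"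
    have inf\<Gamma>: "infinite \<Gamma>"
    proof -
      define P where "P = 1 - (\<Sum>j=1..q. Polynomial.monom (lkp (b j) 0 * (- 1) ^ j) j)"
      have "poly P l = lkp (S l) 0" for l
      proof -
        have "lkp (S l) 0 = 1 - (\<Sum>j=1..q. lkp (b j) 0 * (- l) ^ j)"
          by (simp add: S_def lookup_minus lookup_sum lookup_mult_0 lookup_power_0)
        then show ?thesis
          by (simp add: P_def poly_sum poly_monom power_minus[of l] mult_ac)
      qed
      moreover have "P \<noteq> 0"
      proof
        assume "P = 0"
        moreover have "poly P 0 = 1" by (simp add: P_def poly_sum poly_monom)
        ultimately show False by simp
      qed
      ultimately have "finite (- \<Gamma>)" using poly_roots_finite[of P] by (simp add: \<Gamma>_def Compl_eq)
      then show ?thesis using inf_k by (metis Compl_partition finite_UnI)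
    qed
    have coef: "g * y v0 ^ (q - Suc j) * E j \<in>\<^sub>i A" if j: "j < q" for j
    proof -
      have "cst ((- 1) ^ j) * (g * y v0 ^ (q - Suc j) * E j) \<in>\<^sub>i A"
      proof (rule vandermonde_mem[where n = "q - 1" and i = j
            and c = "\<lambda>j. cst ((- 1) ^ j) * (g * y v0 ^ (q - Suc j) * E j)", OF inf\<Gamma>])
        fix l assume l: "l \<in> \<Gamma>"
        define x where "x = y v0 + cst l * h"
        define \<Psi> where "\<Psi> = (\<Sum>j<q. cst (- l) ^ j * y v0 ^ (q - Suc j) * E j)"
        have "g \<in>\<^sub>i pr x + lin v0 \<mu> + J ^ q"
          unfolding x_def using l q
          by (intro g reduction_pencil[OF red h \<mu> eq _ b]) (auto simp: \<Gamma>_def S_def)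
        also have "\<dots> \<le> pr x + A"
        proof -
          obtain k where "q = Suc k" using q by (cases q) auto
          then have "J ^ q \<le> A" unfolding A_def
            using order_trans[OF J_power_lin[of k v0 \<mu>] add_left_mono[OF idl_mult_le1[OF order_refl]]] by simp
          moreover have "lin v0 \<mu> \<le> A" by (simp add: A_def)
          moreover have "A \<le> pr x + A" by simp
          ultimately show ?thesis by (auto intro: order_trans mem_addI1)
        qed
        finally obtain u r where ur: "g = u + r" "u \<in>\<^sub>i pr x" "r \<in>\<^sub>i A" unfolding mem_plus by blast
        obtain u' where u': "u = x * u'" using ur(2) unfolding mem_pr by blast
        have neg: "cst (- l) = - (cst l :: ('v, 'k) mpoly)" by (simp add: single_uminus)
        have "x * \<Psi> = y v0 ^ q * S l - cst (- l) ^ q * E q"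
          using horner_telescope[of E h b "y v0" "cst (- l)" q, OF E0 ES] by (simp add: x_def \<Psi>_def S_def neg)
        moreover have "y v0 ^ q * S l \<in>\<^sub>i A" unfolding A_def by (rule mem_addI1) (auto simp: mem_pr)
        moreover have "cst (- l) ^ q * E q \<in>\<^sub>i A" unfolding A_def using EqL by (auto intro: mem_addI2)
        ultimately have "x * \<Psi> \<in>\<^sub>i A" by auto
        then have "u' * (x * \<Psi>) + r * \<Psi> \<in>\<^sub>i A" using ur(3) by auto
        then have "g * \<Psi> \<in>\<^sub>i A" by (simp add: ur(1) u' algebra_simps)
        also have "g * \<Psi> = (\<Sum>j\<le>q - 1. cst ((- 1) ^ j) * (g * y v0 ^ (q - Suc j) * E j) * cst l ^ j)"
        proof -
          have "{..<q} = {..q - 1}" using q by auto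
          moreover have "cst (- l) ^ j = cst ((- 1) ^ j) * (cst l ^ j :: ('v, 'k) mpoly)" for j
          proof -
            have "cst ((- 1) ^ j) = ((- 1) ^ j :: ('v, 'k) mpoly)"
              by (induction j) (simp_all add: single_uminus)
            then show ?thesis by (simp add: neg power_minus[of "cst l"])
          qed
          ultimately show ?thesis unfolding \<Psi>_def sum_distrib_left
            by (intro sum.cong) (simp_all add: mult_ac)
        qed
        finally show "(\<Sum>j\<le>q - 1. cst ((- 1) ^ j) * (g * y v0 ^ (q - Suc j) * E j) * cst l ^ j) \<in>\<^sub>i A" .
      qed (use j in simp)
      then have "cst ((- 1) ^ j) * (cst ((- 1) ^ j) * (g * y v0 ^ (q - Suc j) * E j)) \<in>\<^sub>i A" by (rule mem_mult_left)
      moreover have "cst ((- 1) ^ j) * cst ((- 1) ^ j) = (1 :: ('v, 'k) mpoly)"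
        by (simp add: mult_single flip: power_mult_distrib)
      ultimately show ?thesis by (simp flip: mult.assoc)
    qed
    \<comment> \<open>Triangular inversion: \<open>E m\<close> and \<open>h ^ m\<close> differ by
      multiples of \<open>y v0 ^ j * h ^ (m - j)\<close> with \<open>j \<ge> 1\<close>, which
      smaller exponents have settled.\<close>
    have "m < q \<Longrightarrow> g * (y v0 ^ (q - Suc m) * h ^ m) \<in>\<^sub>i A" for m
    proof (induction m rule: less_induct)
      case (less m)
      have "h ^ m = E m + (\<Sum>j=1..m. b j * y v0 ^ j * h ^ (m - j))" by (simp add: E)
      then have "g * (y v0 ^ (q - Suc m) * h ^ m) = g * y v0 ^ (q - Suc m) * E m
          + (\<Sum>j=1..m. g * y v0 ^ (q - Suc m) * (b j * y v0 ^ j * h ^ (m - j)))"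
        by (simp add: distrib_left sum_distrib_left mult.assoc)
      moreover have "g * y v0 ^ (q - Suc m) * (b j * y v0 ^ j * h ^ (m - j)) \<in>\<^sub>i A" if j: "j \<in> {1..m}" for j
      proof -
        have "q - Suc (m - j) = (q - Suc m) + j" using j less.prems by auto
        then have "b j * (g * (y v0 ^ (q - Suc (m - j)) * h ^ (m - j)))
            = g * y v0 ^ (q - Suc m) * (b j * y v0 ^ j * h ^ (m - j))"
          by (simp only: power_add mult_ac)
        moreover have "b j * (g * (y v0 ^ (q - Suc (m - j)) * h ^ (m - j))) \<in>\<^sub>i A"
          using j less by (intro mem_mult_left less.IH) auto
        ultimately show ?thesis by simp
      qed
      ultimately show ?case using coef[OF less.prems] by (auto intro!: mem_add mem_sum)
    qed
    then show "g * (y v0 ^ (q - Suc i) * h ^ i) \<in>\<^sub>i pr (y v0 ^ q) + lin v0 \<mu>" using q by (simp add: A_def)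
  qed
  also have "g * (y v0 ^ (q - Suc i) * h ^ i) = y v0 ^ (q - Suc i) * (g * h ^ i)" by (simp only: mult_ac)
  also have "q = (q - Suc i) + Suc i" using q by simp
  finally show ?thesis unfolding diff_add_inverse2 y_cancel .
qed

end

section \<open>Extended Rees algebras and canonical modules by degree\<close>

lemma lookup_int_mult:
  fixes f g :: "int \<Rightarrow>\<^sub>0 'r::comm_ring_1"
  shows "lkp (f * g) n = (\<Sum>l\<in>Poly_Mapping.keys f. lkp f l * lkp g (n - l))"
proof -
  have inner: "Sum_any (\<lambda>q. lkp g q when n = l + q) = lkp g (n - l)" for l
  proof -
    have "(\<lambda>q. lkp g q when n = l + q) = (\<lambda>q. lkp g q when n - l = q)"
      by (rule ext) (auto simp: when_def)
    then show ?thesis by (simp only: Sum_any_when_equal')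
  qed
  have "lkp (f * g) n = Sum_any (\<lambda>l. lkp f l * Sum_any (\<lambda>q. lkp g q when n = l + q))"
    by (rule lookup_mult)
  also have "\<dots> = (\<Sum>l\<in>Poly_Mapping.keys f. lkp f l * Sum_any (\<lambda>q. lkp g q when n = l + q))"
    by (rule Sum_any.expand_superset) (auto simp: in_keys_iff intro: mult_not_zero)
  finally show ?thesis by (simp only: inner)
qed

lemma lookup_mult_single_int:
  "lkp (f * Poly_Mapping.single m h) n = lkp f (n - m) * h" for f :: "int \<Rightarrow>\<^sub>0 'r::comm_ring_1"
  using lookup_single_mult[of m h f "n - m"] by (simp add: mult.commute)

text \<open>In negative degrees \<open>H ^ nat n\<close> is \<open>H ^ 0\<close>, the unit ideal.\<close>

lemma ext_rees_iff:
  fixes H :: "'r::comm_ring_1 idl"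
  shows "z \<in> ext_rees (elts H) \<longleftrightarrow> (\<forall>n. lkp z n \<in>\<^sub>i H ^ nat n)"
proof
  assume "z \<in> ext_rees (elts H)"
  then show "\<forall>n. lkp z n \<in>\<^sub>i H ^ nat n"
    unfolding ext_rees_def
  proof (induction rule: generate_ring.induct)
    case one
    then show ?case by (auto simp: lookup_one when_def)
  next
    case (incl h)
    then show ?case by (auto simp: lookup_single when_def mem_def[symmetric])
  next
    case (a_inv h)
    then show ?case by (auto intro: mem_uminus)
  next
    case (eng_add g h)
    then show ?case by (auto simp: lookup_add)
  next
    case (eng_mult g h)
    show ?case
    proof
      fix n
      have "lkp g l * lkp h (n - l) \<in>\<^sub>i H ^ nat n" for l
      proof -
        have "lkp g l * lkp h (n - l) \<in>\<^sub>i H ^ nat l * H ^ nat (n - l)" using eng_mult by (intro mem_times) auto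
        also have "\<dots> = H ^ (nat l + nat (n - l))" by (simp add: power_add)
        also have "\<dots> \<le> H ^ nat n" by (rule idl_power_anti) linarith
        finally show ?thesis .
      qed
      then show "lkp (g \<otimes>\<^bsub>ring_of_type_algebra\<^esub> h) n \<in>\<^sub>i H ^ nat n"
        by (auto simp: lookup_int_mult)
    qed
  qed
next
  assume z: "\<forall>n. lkp z n \<in>\<^sub>i H ^ nat n"
  let ?S = "range (Poly_Mapping.single 0) \<union> Poly_Mapping.single 1 ` elts H \<union> {Poly_Mapping.single (-1) (1::'r)}"
  let ?E = "generate_ring (ring_of_type_algebra :: (int \<Rightarrow>\<^sub>0 'r) ring) ?S"
  have add: "u + v \<in> ?E" if "u \<in> ?E" "v \<in> ?E" for u v
    using generate_ring.eng_add[OF that] by simp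
  have mult: "u * v \<in> ?E" if "u \<in> ?E" "v \<in> ?E" for u v
    using generate_ring.eng_mult[OF that] by simp
  have const: "Poly_Mapping.single 0 f \<in> ?E" for f by (rule generate_ring.incl) simp
  have neg: "Poly_Mapping.single (- int n) 1 \<in> ?E" for n
  proof (induction n)
    case (Suc n)
    have "Poly_Mapping.single (-1) 1 * Poly_Mapping.single (- int n) 1 \<in> ?E"
      by (intro mult Suc generate_ring.incl) simp
    then show ?case by (simp add: mult_single)
  qed (use const[of 1] in simp)
  have pos: "f \<in>\<^sub>i H ^ n \<Longrightarrow> Poly_Mapping.single (int n) f \<in> ?E" for f n
  proof (induction n arbitrary: f)
    case 0
    then show ?case using const by simp
  next
    case (Suc n)
    from Suc.prems[unfolded power_Suc] show ?case
    proof (induction rule: times_induct)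
      case (prod p q)
      have "Poly_Mapping.single 1 p * Poly_Mapping.single (int n) q \<in> ?E"
        using prod by (intro mult Suc.IH generate_ring.incl) (auto simp: mem_def)
      then show ?case by (simp add: mult_single)
    next
      case (add p q)
      then show ?case unfolding single_add using \<open>\<And>v u. u \<in> ?E \<Longrightarrow> v \<in> ?E \<Longrightarrow> u + v \<in> ?E\<close> by blast
    qed
  qed
  have single: "Poly_Mapping.single n (lkp z n) \<in> ?E" for n
  proof (cases "n \<ge> 0")
    case True
    then show ?thesis using pos[of "lkp z n" "nat n"] z by simp
  next
    case False
    have "Poly_Mapping.single 0 (lkp z n) * Poly_Mapping.single (- int (nat (- n))) 1 \<in> ?E"
      by (intro mult const neg)
    then show ?thesis using False by (simp add: mult_single)
  qed
  have "(\<Sum>n\<in>S. Poly_Mapping.single n (lkp z n)) \<in> ?E" if "finite S" for S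
    using that
  proof (induction S rule: finite_induct)
    case empty
    then show ?case using const[of 0] by simp
  next
    case (insert n S)
    then show ?case using add[OF single[of n]] by simp
  qed
  moreover have "(\<Sum>n\<in>Poly_Mapping.keys z. Poly_Mapping.single n (lkp z n)) = z"
  proof (rule poly_mapping_eqI)
    fix k
    have "lkp (\<Sum>n\<in>Poly_Mapping.keys z. Poly_Mapping.single n (lkp z n)) k
        = (\<Sum>n\<in>Poly_Mapping.keys z. if n = k then lkp z k else 0)"
      unfolding lookup_sum by (rule sum.cong) (auto simp: lookup_single when_def)
    then show "lkp (\<Sum>n\<in>Poly_Mapping.keys z. Poly_Mapping.single n (lkp z n)) k = lkp z k"
      by (simp add: in_keys_iff)
  qed
  ultimately have "z \<in> ?E" by (metis finite_keys)
  then show "z \<in> ext_rees (elts H)" by (simp add: ext_rees_def)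
qed

context power_ideal
begin

text \<open>The degree-\<open>n\<close> part of \<open>omega_rees\<close>. The exponent comes from
  \<open>\<omega>\<^sub>A\<close>, the shift of \<open>A\<close> by \<open>CARD('v) - 1\<close>: its
  part of degree \<open>n + m\<close> is this power of \<open>J\<close>, with \<open>nat\<close>
  giving the unit ideal for negative exponents.\<close>

definition W :: "('v, 'k) mpoly idl \<Rightarrow> int \<Rightarrow> ('v, 'k) mpoly idl" where
  "W H n = Idl_of {f. \<forall>m h. h \<in>\<^sub>i H ^ m \<longrightarrow> f * h \<in>\<^sub>i J ^ nat (n + int m - int CARD('v) + 1)}"

lemma mem_W: "f \<in>\<^sub>i W H n \<longleftrightarrow>
    (\<forall>m h. h \<in>\<^sub>i H ^ m \<longrightarrow> f * h \<in>\<^sub>i J ^ nat (n + int m - int CARD('v) + 1))"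
  unfolding W_def by (subst mem_Idl_of) (auto simp: ideal_set_def distrib_right mult.assoc)

lemma omega_base_iff:
  "z \<in> omega_base (elts J) \<longleftrightarrow> (\<forall>n. lkp z n \<in>\<^sub>i J ^ nat (n - int CARD('v) + 1))"
proof
  assume "z \<in> omega_base (elts J)"
  then obtain b where b: "b \<in> ext_rees (elts J)" "z = b * Poly_Mapping.single (int CARD('v) - 1) 1"
    unfolding omega_base_def by blast
  show "\<forall>n. lkp z n \<in>\<^sub>i J ^ nat (n - int CARD('v) + 1)"
    unfolding b(2) lookup_mult_single_int
    using b(1)[unfolded ext_rees_iff] by (simp add: algebra_simps)
next
  assume z: "\<forall>n. lkp z n \<in>\<^sub>i J ^ nat (n - int CARD('v) + 1)"
  define b where "b = z * Poly_Mapping.single (1 - int CARD('v)) 1"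
  have "b \<in> ext_rees (elts J)"
    unfolding ext_rees_iff
  proof
    fix n show "lkp b n \<in>\<^sub>i J ^ nat n"
      unfolding b_def lookup_mult_single_int using z[rule_format, of "n - (1 - int CARD('v))"] by simp
  qed
  moreover have "z = b * Poly_Mapping.single (int CARD('v) - 1) 1"
    by (simp add: b_def mult.assoc mult_single)
  ultimately show "z \<in> omega_base (elts J)" unfolding omega_base_def by blast
qed

lemma omega_rees_iff: "z \<in> omega_rees (elts J) (elts H) \<longleftrightarrow> (\<forall>n. lkp z n \<in>\<^sub>i W H n)"
proof
  assume z: "z \<in> omega_rees (elts J) (elts H)"
  show "\<forall>n. lkp z n \<in>\<^sub>i W H n"
    unfolding mem_W
  proof (intro allI impI)
    fix n m h assume h: "h \<in>\<^sub>i H ^ m"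
    have "Poly_Mapping.single (int m) h \<in> ext_rees (elts H)"
      unfolding ext_rees_iff using h by (auto simp: lookup_single when_def)
    then have "z * Poly_Mapping.single (int m) h \<in> omega_base (elts J)"
      using z by (simp add: omega_rees_def colon_def)
    then have "lkp (z * Poly_Mapping.single (int m) h) (n + int m) \<in>\<^sub>i J ^ nat (n + int m - int CARD('v) + 1)"
      unfolding omega_base_iff by blast
    then show "lkp z n * h \<in>\<^sub>i J ^ nat (n + int m - int CARD('v) + 1)"
      by (simp add: lookup_mult_single_int)
  qed
next
  assume z: "\<forall>n. lkp z n \<in>\<^sub>i W H n"
  show "z \<in> omega_rees (elts J) (elts H)"
    unfolding omega_rees_def colon_def mem_Collect_eq omega_base_iff
  proof (intro ballI allI)
    fix b n assume b: "b \<in> ext_rees (elts H)"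
    have "lkp z l * lkp b (n - l) \<in>\<^sub>i J ^ nat (n - int CARD('v) + 1)" for l
    proof -
      have "lkp z l * lkp b (n - l) \<in>\<^sub>i J ^ nat (l + int (nat (n - l)) - int CARD('v) + 1)"
        using z[rule_format, of l] b[unfolded ext_rees_iff] unfolding mem_W by blast
      also have "\<dots> \<le> J ^ nat (n - int CARD('v) + 1)" by (rule idl_power_anti) linarith
      finally show ?thesis .
    qed
    then show "lkp (z * b) n \<in>\<^sub>i J ^ nat (n - int CARD('v) + 1)" by (auto simp: lookup_int_mult)
  qed
qed

lemma check_ideal_iff:
  "f \<in> check_ideal (elts J) (elts I) \<longleftrightarrow> (\<forall>n g. g \<in>\<^sub>i W I n \<longrightarrow> f * g \<in>\<^sub>i W I (n + 1))"
proof
  assume f: "f \<in> check_ideal (elts J) (elts I)"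
  show "\<forall>n g. g \<in>\<^sub>i W I n \<longrightarrow> f * g \<in>\<^sub>i W I (n + 1)"
  proof (intro allI impI)
    fix n g assume g: "g \<in>\<^sub>i W I n"
    have "Poly_Mapping.single n g \<in> omega_rees (elts J) (elts I)"
      unfolding omega_rees_iff using g by (auto simp: lookup_single when_def)
    then have "Poly_Mapping.single 1 f * Poly_Mapping.single n g \<in> omega_rees (elts J) (elts I)"
      using f by (simp add: check_ideal_def colon_def)
    then have "lkp (Poly_Mapping.single 1 f * Poly_Mapping.single n g) (n + 1) \<in>\<^sub>i W I (n + 1)"
      unfolding omega_rees_iff by blast
    then show "f * g \<in>\<^sub>i W I (n + 1)" by (simp add: mult_single add.commute)
  qed
next
  assume f: "\<forall>n g. g \<in>\<^sub>i W I n \<longrightarrow> f * g \<in>\<^sub>i W I (n + 1)"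
  show "f \<in> check_ideal (elts J) (elts I)"
    unfolding check_ideal_def colon_def mem_Collect_eq omega_rees_iff
  proof (intro ballI allI)
    fix b n assume "b \<in> omega_rees (elts J) (elts I)"
    then have "f * lkp b (n - 1) \<in>\<^sub>i W I n"
      using f[rule_format, of "lkp b (n - 1)" "n - 1"] by (simp add: omega_rees_iff)
    then show "lkp (Poly_Mapping.single 1 f * b) n \<in>\<^sub>i W I n"
      using lookup_mult_single_int[of b 1 f n] by (simp add: mult.commute)
  qed
qed

lemma W_anti: "I \<le> H \<Longrightarrow> W H n \<le> W I n"
  unfolding le_idl[of "W H n"] mem_W using idl_power_mono memD by metis

lemma mem_W_top: "f \<in>\<^sub>i W H (int CARD('v)) \<longleftrightarrow> (\<forall>m. pr f * H ^ m \<le> J ^ Suc m)"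
proof -
  have "nat (int CARD('v) + int m - int CARD('v) + 1) = Suc m" for m by simp
  then show ?thesis unfolding mem_W le_idl by (auto simp: mem_pr_mult)
qed

lemma mult_mem_W:
  assumes "f \<in>\<^sub>i J ^ c" "g \<in>\<^sub>i W H n" shows "f * g \<in>\<^sub>i W H (n + int c)"
  unfolding mem_W
proof (intro allI impI)
  fix m h assume "h \<in>\<^sub>i H ^ m"
  then have "g * h \<in>\<^sub>i J ^ nat (n + int m - int CARD('v) + 1)" using assms(2) unfolding mem_W by blast
  then have "f * (g * h) \<in>\<^sub>i J ^ c * J ^ nat (n + int m - int CARD('v) + 1)" by (intro mem_times assms)
  also have "\<dots> = J ^ (c + nat (n + int m - int CARD('v) + 1))" by (simp add: power_add)
  also have "\<dots> \<le> J ^ nat (n + int c + int m - int CARD('v) + 1)" by (rule idl_power_anti) linarith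
  finally show "f * g * h \<in>\<^sub>i J ^ nat (n + int c + int m - int CARD('v) + 1)" by (simp add: mult.assoc)
qed

lemma monI_W:
  assumes H: "monI H" shows "monI (W H n)"
  unfolding monI_def
proof (intro allI impI)
  fix f k assume f: "f \<in>\<^sub>i W H n" and k: "k \<in> Poly_Mapping.keys f"
  show "mon k \<in>\<^sub>i W H n"
    unfolding mem_W mem_J_power
  proof (intro allI impI ballI)
    fix m h p assume h: "h \<in>\<^sub>i H ^ m" and p: "p \<in> Poly_Mapping.keys (mon k * h)"
    then obtain l where l: "l \<in> Poly_Mapping.keys h" "p = k + l" by (auto simp: keys_mon_mult)
    have "mon l \<in>\<^sub>i H ^ m" using h l monI_power[OF H] unfolding monI_def by blast
    then have "f * mon l \<in>\<^sub>i J ^ nat (n + int m - int CARD('v) + 1)" using f unfolding mem_W by blast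
    moreover have "l + k \<in> Poly_Mapping.keys (f * mon l)"
      using k by (simp add: mult.commute[of f] keys_mon_mult)
    ultimately show "nat (n + int m - int CARD('v) + 1) \<le> ord p"
      unfolding mem_J_power l(2) by (simp add: add.commute)
  qed
qed

text \<open>The condition for \<open>m = 0\<close> forces a monomial of \<open>W I (n + 1)\<close>
  to have positive order, so some \<open>y v\<close> divides it and cancels from all conditions at
  once. The bound on \<open>n\<close> prevents truncation of the exponents at
  \<open>0\<close>.\<close>

lemma W_generated:
  assumes I: "monI I" and n: "int CARD('v) \<le> n + 1"
  shows "W I (n + 1) \<le> J * W I n"
  unfolding le_idl
proof (intro allI impI, rule mem_of_keys)
  fix f k assume "f \<in>\<^sub>i W I (n + 1)" "k \<in> Poly_Mapping.keys f"
  then have k: "mon k \<in>\<^sub>i W I (n + 1)" using monI_W[OF I] unfolding monI_def by blast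
  have "mon k * 1 \<in>\<^sub>i J ^ nat (n + 1 + int 0 - int CARD('v) + 1)"
    by (rule k[unfolded mem_W, rule_format]) simp
  then have "1 \<le> ord k" using n by (simp add: mem_J_power)
  then obtain v k' where k': "k = Poly_Mapping.single v (a v) + k'" by (rule ord_pos_obtain)
  have kk: "mon k = y v * mon k'" by (simp add: y_def mult_single k')
  have "mon k' \<in>\<^sub>i W I n"
    unfolding mem_W
  proof (intro allI impI)
    fix m h assume "h \<in>\<^sub>i I ^ m"
    then have "mon k * h \<in>\<^sub>i J ^ nat (n + 1 + int m - int CARD('v) + 1)" using k unfolding mem_W by blast
    also have "nat (n + 1 + int m - int CARD('v) + 1) = Suc (nat (n + int m - int CARD('v) + 1))" using n by simp
    finally show "mon k' * h \<in>\<^sub>i J ^ nat (n + int m - int CARD('v) + 1)"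
      by (simp only: kk mult.assoc y_cancel1)
  qed
  then show "mon k \<in>\<^sub>i J * W I n" unfolding kk by (intro mem_times y_mem_J)
qed

text \<open>Degrees above \<open>CARD('v)\<close> are reached by multiplication with
  \<open>J\<close>. Degrees below are lifted to \<open>CARD('v)\<close> by a power of some
  \<open>y v\<close>, which is a nonzerodivisor for the filtration by powers of \<open>J\<close> and
  can be cancelled afterwards.\<close>

lemma W_le_if_top:
  assumes I: "monI I" and top: "W I (int CARD('v)) \<le> W H (int CARD('v))"
  shows "W I n \<le> W H n"
proof (cases "n \<ge> int CARD('v)")
  case True
  then show ?thesis
  proof (induction n rule: int_ge_induct)
    case base
    show ?case by (rule top)
  next
    case (step n)
    have "W I (n + 1) \<le> J * W I n" using I step by (intro W_generated) auto
    also have "\<dots> \<le> J * W H n" by (rule idl_mult_mono[OF order_refl step.IH])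
    also have "\<dots> \<le> W H (n + 1)" using mult_mem_W[of _ 1 _ H n] by (simp add: idl_times_le_iff)
    finally show ?case .
  qed
next
  case False
  define c where "c = nat (int CARD('v) - n)"
  show ?thesis
    unfolding le_idl
  proof (intro allI impI)
    fix f assume f: "f \<in>\<^sub>i W I n"
    obtain v :: 'v where True by blast
    have "y v ^ c * f \<in>\<^sub>i W I (n + int c)" by (rule mult_mem_W[OF mem_power[OF y_mem_J] f])
    then have yf: "y v ^ c * f \<in>\<^sub>i W H (int CARD('v))" using memD[OF _ top] False by (simp add: c_def)
    show "f \<in>\<^sub>i W H n"
      unfolding mem_W
    proof (intro allI impI)
      fix m h assume "h \<in>\<^sub>i H ^ m"
      then have "y v ^ c * f * h \<in>\<^sub>i J ^ nat (int CARD('v) + int m - int CARD('v) + 1)"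
        using yf unfolding mem_W by blast
      then have yfh: "y v ^ c * (f * h) \<in>\<^sub>i J ^ Suc m" by (simp add: mult.assoc nat_add_distrib)
      show "f * h \<in>\<^sub>i J ^ nat (n + int m - int CARD('v) + 1)"
      proof (cases "c \<le> Suc m")
        case True
        then have "f * h \<in>\<^sub>i J ^ (Suc m - c)" using yfh y_cancel[of v c "f * h" "Suc m - c"] by simp
        moreover have "nat (n + int m - int CARD('v) + 1) = Suc m - c" using False True by (simp add: c_def)
        ultimately show ?thesis by simp
      next
        case False
        then have "nat (n + int m - int CARD('v) + 1) = 0" by (simp add: c_def)
        then show ?thesis by simp
      qed
    qed
  qed
qed

lemma omega_eq:
  assumes "monI I" "I \<le> H" "W I (int CARD('v)) \<le> W H (int CARD('v))"
  shows "omega_rees (elts J) (elts H) = omega_rees (elts J) (elts I)"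
proof -
  have "W H n = W I n" for n by (rule antisym[OF W_anti[OF assms(2)] W_le_if_top[OF assms(1,3)]])
  then show ?thesis by (intro Set.set_eqI) (simp add: omega_rees_iff)
qed

text \<open>In \<open>f (l g + h)\<^sup>N\<close> the coefficient of \<open>l\<close> is \<open>N f g h\<^sup>N\<^sup>-\<^sup>1\<close>, and \<open>N\<close> is a unit.\<close>

lemma power_bound_polarise:
  assumes char: "CHAR('k) = 0" and f: "\<And>h m. h \<in>\<^sub>i H \<Longrightarrow> f * h ^ m \<in>\<^sub>i J ^ Suc m"
  shows "f \<in>\<^sub>i W H (int CARD('v))"
proof -
  \<comment> \<open>The factors of \<open>h ^ m\<close> are replaced one by one by arbitrary
    elements of \<open>H\<close>; at \<open>j = m\<close> no factor \<open>h\<close> is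
    left.\<close>
  have main: "j \<le> m \<Longrightarrow> x \<in>\<^sub>i H ^ j \<Longrightarrow> h \<in>\<^sub>i H \<Longrightarrow> f * h ^ (m - j) * x \<in>\<^sub>i J ^ Suc m" for j m x h
  proof (induction j arbitrary: x h)
    case 0
    then show ?case using f[of h m] by (auto intro: mem_mult_right)
  next
    case (Suc j)
    define N where "N = m - j"
    have N: "N = Suc (m - Suc j)" using Suc.prems by (simp add: N_def)
    from Suc.prems(2)[unfolded power_Suc] show ?case
    proof (induction rule: times_induct)
      case (prod g x)
      define c where "c i = of_nat (N choose i) * g ^ i * h ^ (N - i) * f * x" for i
      have "c 1 \<in>\<^sub>i J ^ Suc m"
      proof (rule vandermonde_mem[where n = N and c = c and i = 1, OF inf_k])
        fix l :: 'k
        have "f * (cst l * g + h) ^ N * x \<in>\<^sub>i J ^ Suc m"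
          unfolding N_def using prod Suc.prems by (intro Suc.IH mem_add mem_mult_left) auto
        also have "f * (cst l * g + h) ^ N * x = (\<Sum>i\<le>N. c i * cst l ^ i)"
          unfolding binomial_ring sum_distrib_left sum_distrib_right c_def
          by (intro sum.cong) (auto simp: power_mult_distrib mult_ac)
        finally show "(\<Sum>i\<le>N. c i * cst l ^ i) \<in>\<^sub>i J ^ Suc m" .
      qed (simp add: N)
      then have "cst (1 / of_nat N) * c 1 \<in>\<^sub>i J ^ Suc m" by (rule mem_mult_left)
      moreover have "cst (1 / of_nat N) * of_nat N = (1 :: ('v, 'k) mpoly)"
      proof -
        have "(of_nat N :: 'k) \<noteq> 0" 
          using char N of_nat_eq_0_iff_char_dvd[where ?'a = 'k, of N] by (metis dvd_0_left_iff nat.distinct(1))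
        then have "cst (1 / of_nat N) * cst (of_nat N) = (1 :: ('v, 'k) mpoly)" by (simp only: mult_single) simp
        then show ?thesis by (simp only: single_of_nat)
      qed
      moreover have "cst (1 / of_nat N) * c 1 = (cst (1 / of_nat N) * of_nat N) * (f * h ^ (m - Suc j) * (g * x))"
        by (simp add: c_def N mult_ac)
      ultimately show ?case by simp
    next
      case (add u v)
      then show ?case by (auto simp: distrib_left)
    qed
  qed
  show ?thesis
    unfolding mem_W_top idl_times_le_iff
  proof (intro allI impI)
    fix m u v assume "u \<in>\<^sub>i pr f" "v \<in>\<^sub>i H ^ m"
    moreover from this have "f * v \<in>\<^sub>i J ^ Suc m" using main[of m m v 0] by simp
    ultimately show "u * v \<in>\<^sub>i J ^ Suc m" by (auto simp: mem_pr mult_ac)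
  qed
qed

end

section \<open>The canonical module and the core\<close>

context monomial_reduction
begin

lemma reduction_of_integral_over:
  assumes "I \<le> H" "\<And>h. h \<in>\<^sub>i H \<Longrightarrow> integral I h"
  shows "reduction J H" and "h \<in>\<^sub>i H \<Longrightarrow> integral J h"
proof -
  have int: "integral J h" if "h \<in>\<^sub>i H" for h by (rule integral_trans[OF red assms(2)[OF that]])
  show "reduction J H" by (rule reduction_of_integral[OF order_trans[OF J_le_I assms(1)] int])
  show "h \<in>\<^sub>i H \<Longrightarrow> integral J h" by (rule int)
qed

lemma mem_W_core:
  assumes "f \<in>\<^sub>i W I (int CARD('v))" "reduction K I" shows "f \<in>\<^sub>i K"
  using assms(1) unfolding mem_W_top by (intro mem_reduction[OF _ assms(2)]) blast

lemma W_top_le: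
  assumes char: "CHAR('k) = 0" and IH: "I \<le> H" and int: "\<And>h. h \<in>\<^sub>i H \<Longrightarrow> integral I h"
    and core: "\<And>f. (\<And>K. reduction K I \<Longrightarrow> f \<in>\<^sub>i K) \<Longrightarrow> (\<And>K. reduction K H \<Longrightarrow> f \<in>\<^sub>i K)"
  shows "W I (int CARD('v)) \<le> W H (int CARD('v))"
  unfolding le_idl
proof (intro allI impI)
  fix f assume f: "f \<in>\<^sub>i W I (int CARD('v))"
  show "f \<in>\<^sub>i W H (int CARD('v))"
  proof (rule power_bound_polarise[OF char])
    fix h m assume h: "h \<in>\<^sub>i H"
    show "f * h ^ m \<in>\<^sub>i J ^ Suc m"
    proof (rule core_bound)
      show "reduction J H" "integral J h" using reduction_of_integral_over[OF IH int] h by blast+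
      show "f \<in>\<^sub>i K" if "reduction K H" for K
        by (rule core[OF mem_W_core[OF f] that])
    qed (rule h)
  qed
qed

section \<open>The largest ideal with the given core\<close>

definition check_idl :: "('v, 'k) mpoly idl" where
  "check_idl = Idl_of {f. \<forall>n g. g \<in>\<^sub>i W I n \<longrightarrow> f * g \<in>\<^sub>i W I (n + 1)}"

lemma mem_check_idl: "f \<in>\<^sub>i check_idl \<longleftrightarrow> (\<forall>n g. g \<in>\<^sub>i W I n \<longrightarrow> f * g \<in>\<^sub>i W I (n + 1))"
  unfolding check_idl_def by (subst mem_Idl_of) (auto simp: ideal_set_def distrib_right mult.assoc)

lemma check_ideal_elts: "check_ideal (elts J) (elts I) = elts check_idl"
  by (auto simp: check_ideal_iff mem_check_idl mem_def[symmetric])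

lemma mult_mem_W_Suc:
  assumes h: "h \<in>\<^sub>i H" and g: "g \<in>\<^sub>i W H n" shows "h * g \<in>\<^sub>i W H (n + 1)"
  unfolding mem_W
proof (intro allI impI)
  fix m x assume "x \<in>\<^sub>i H ^ m"
  then have "h * x \<in>\<^sub>i H ^ Suc m" using h by (simp add: mem_times)
  then have "g * (h * x) \<in>\<^sub>i J ^ nat (n + int (Suc m) - int CARD('v) + 1)" using g unfolding mem_W by blast
  also have "n + int (Suc m) - int CARD('v) + 1 = n + 1 + int m - int CARD('v) + 1" by simp
  finally show "h * g * x \<in>\<^sub>i J ^ nat (n + 1 + int m - int CARD('v) + 1)" by (simp only: mult_ac)
qed

text \<open>Equality in the top degree propagates to all degrees. The components
  \<open>W I n\<close> are then those of a module over the Rees algebra of \<open>H\<close>, so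
  \<open>H\<close> raises their degree by one.\<close>

lemma le_check_idl:
  assumes "I \<le> H" "W I (int CARD('v)) \<le> W H (int CARD('v))" shows "H \<le> check_idl"
proof -
  have W: "W I n = W H n" for n
    by (rule antisym[OF W_le_if_top[OF monI_I assms(2)] W_anti[OF assms(1)]])
  show ?thesis unfolding le_idl mem_check_idl W using mult_mem_W_Suc[of _ H] by blast
qed

lemma I_le_check_idl: "I \<le> check_idl"
  by (rule le_check_idl) auto

lemma monI_check_idl: "monI check_idl"
  unfolding monI_def
proof (intro allI impI)
  fix f k assume f: "f \<in>\<^sub>i check_idl" and k: "k \<in> Poly_Mapping.keys f"
  show "mon k \<in>\<^sub>i check_idl"
    unfolding mem_check_idl
  proof (intro allI impI)
    fix n g assume g: "g \<in>\<^sub>i W I n"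
    show "mon k * g \<in>\<^sub>i W I (n + 1)"
    proof (rule mem_of_keys)
      fix l assume "l \<in> Poly_Mapping.keys (mon k * g)"
      then obtain p where p: "p \<in> Poly_Mapping.keys g" "l = k + p" by (auto simp: keys_mon_mult)
      have "mon p \<in>\<^sub>i W I n" using g p(1) monI_W[OF monI_I] unfolding monI_def by blast
      then have "f * mon p \<in>\<^sub>i W I (n + 1)" using f unfolding mem_check_idl by blast
      moreover have "l \<in> Poly_Mapping.keys (f * mon p)"
        using k unfolding p(2) add.commute[of k] mult.commute[of f] keys_mon_mult by (rule imageI)
      ultimately show "mon l \<in>\<^sub>i W I (n + 1)" using monI_W[OF monI_I] unfolding monI_def by blast
    qed
  qed
qed

text \<open>In degree \<open>CARD('v) - 1\<close>, the lowest where \<open>W_generated\<close>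
  applies, multiplication by \<open>f\<close> lands in \<open>W I (e + 1)\<close> and hence in
  \<open>J * W I e\<close>. This component contains a power of \<open>J\<close>, so the determinant
  trick applies.\<close>

lemma integral_check_idl:
  assumes f: "f \<in>\<^sub>i check_idl" shows "integral I f"
proof -
  obtain r where r: "\<And>m n. m \<ge> r \<Longrightarrow> I ^ (n + m) = J ^ n * I ^ m"
    using reduction_powers[OF red] by blast
  define e where "e = int CARD('v) - 1"
  have "J ^ r \<le> W I e"
    unfolding le_idl mem_W
  proof (intro allI impI)
    fix x m h assume x: "x \<in>\<^sub>i J ^ r" and h: "h \<in>\<^sub>i I ^ m"
    have "x * h \<in>\<^sub>i J ^ r * I ^ m" using x h by (rule mem_times)
    also have "\<dots> \<le> I ^ r * I ^ m" by (rule idl_mult_mono[OF idl_power_mono[OF J_le_I] order_refl])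
    also have "\<dots> = I ^ (m + r)" by (simp add: power_add mult.commute)
    also have "\<dots> = J ^ m * I ^ r" by (rule r) simp
    also have "\<dots> \<le> J ^ m" by (rule idl_mult_le1) simp
    also have "J ^ m = J ^ nat (e + int m - int CARD('v) + 1)" by (simp add: e_def)
    finally show "x * h \<in>\<^sub>i J ^ nat (e + int m - int CARD('v) + 1)" .
  qed
  moreover have "pr f * W I e \<le> J * W I e"
  proof (rule order_trans)
    show "pr f * W I e \<le> W I (e + 1)" using f by (auto simp: le_idl mem_pr_mult mem_check_idl)
    show "W I (e + 1) \<le> J * W I e" by (rule W_generated[OF monI_I]) (simp add: e_def)
  qed
  ultimately have "integral J f" by (rule integral_if_stable)
  then show ?thesis by (rule integral_mono[OF _ J_le_I])
qed

text \<open>An element of \<open>check_idl ^ m\<close> raises the degree by \<open>m\<close>, and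
  the condition on \<open>W I (CARD('v) + m)\<close> at the unit is membership in
  \<open>J ^ Suc m\<close>.\<close>

lemma W_check_idl: "W I (int CARD('v)) \<le> W check_idl (int CARD('v))"
proof -
  have step: "g \<in>\<^sub>i W I n \<Longrightarrow> x \<in>\<^sub>i check_idl ^ m \<Longrightarrow> g * x \<in>\<^sub>i W I (n + int m)" for g n m x
  proof (induction m arbitrary: x)
    case 0
    then show ?case by auto
  next
    case (Suc m)
    from Suc.prems(2)[unfolded power_Suc] show ?case
    proof (induction rule: times_induct)
      case (prod p q)
      have "p * (g * q) \<in>\<^sub>i W I (n + int m + 1)"
        using Suc.IH[OF Suc.prems(1) prod(2)] prod(1) unfolding mem_check_idl by blast
      then show ?case by (simp add: mult_ac add_ac)
    next
      case (add p q)
      then show ?case by (auto simp: distrib_left)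
    qed
  qed
  show ?thesis
    unfolding le_idl[of "W I (int CARD('v))"] mem_W_top
  proof (intro allI impI)
    fix f m assume f: "\<forall>m. pr f * I ^ m \<le> J ^ Suc m"
    show "pr f * check_idl ^ m \<le> J ^ Suc m"
      unfolding le_idl mem_pr_mult
    proof (intro allI impI, elim exE conjE)
      fix z x assume x: "x \<in>\<^sub>i check_idl ^ m" "z = f * x"
      have "f * x \<in>\<^sub>i W I (int CARD('v) + int m)" by (rule step[OF f[folded mem_W_top] x(1)])
      then have "f * x * 1 \<in>\<^sub>i J ^ nat (int CARD('v) + int m + int 0 - int CARD('v) + 1)"
        using mem_1[of 1] power_0[of I] unfolding mem_W by metis
      then show "z \<in>\<^sub>i J ^ Suc m" by (simp add: x(2) nat_add_distrib)
    qed
  qed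
qed

text \<open>Both ideals are monomial with reduction \<open>J\<close>, so in characteristic zero each
  core equals the top component of its canonical module, and these components agree.\<close>

lemma core_check_idl:
  assumes char: "CHAR('k) = 0"
  shows "(\<forall>K. reduction K check_idl \<longrightarrow> f \<in>\<^sub>i K) \<longleftrightarrow> (\<forall>K. reduction K I \<longrightarrow> f \<in>\<^sub>i K)"
proof -
  have int: "\<And>h. h \<in>\<^sub>i check_idl \<Longrightarrow> integral I h" by (rule integral_check_idl)
  have redC: "reduction J check_idl" by (rule reduction_of_integral_over(1)[OF I_le_check_idl int])
  have intJ: "\<And>h. h \<in>\<^sub>i check_idl \<Longrightarrow> integral J h" by (rule reduction_of_integral_over(2)[OF I_le_check_idl int])
  interpret C: monomial_reduction a J check_idl by unfold_locales (rule monI_check_idl redC)+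
  have W_core: "(\<forall>K. reduction K H \<longrightarrow> f \<in>\<^sub>i K) \<Longrightarrow> f \<in>\<^sub>i W H (int CARD('v))"
    if "reduction J H" "\<And>h. h \<in>\<^sub>i H \<Longrightarrow> integral J h" for H
    by (rule power_bound_polarise[OF char], rule core_bound[OF that(1)]) (use that in blast)+
  show ?thesis
  proof
    assume "\<forall>K. reduction K check_idl \<longrightarrow> f \<in>\<^sub>i K"
    then have "f \<in>\<^sub>i W check_idl (int CARD('v))" using W_core[OF redC intJ] by blast
    then have "f \<in>\<^sub>i W I (int CARD('v))" using W_anti[OF I_le_check_idl] memD by blast
    then show "\<forall>K. reduction K I \<longrightarrow> f \<in>\<^sub>i K" using mem_W_core by blast
  next
    assume "\<forall>K. reduction K I \<longrightarrow> f \<in>\<^sub>i K"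
    then have "f \<in>\<^sub>i W I (int CARD('v))"
      using W_core[OF red intJ[OF memD[OF _ I_le_check_idl]]] by blast
    then have "f \<in>\<^sub>i W check_idl (int CARD('v))" using W_check_idl memD by blast
    then show "\<forall>K. reduction K check_idl \<longrightarrow> f \<in>\<^sub>i K" using C.mem_W_core by blast
  qed
qed

end

section \<open>Ideals generated by forms\<close>

definition deg :: "('v::finite \<Rightarrow>\<^sub>0 nat) \<Rightarrow> nat" where
  "deg k = (\<Sum>v\<in>UNIV. lkp k v)"

lemma deg_add [simp]: "deg (k + l) = deg k + deg l"
  by (simp add: deg_def lookup_add sum.distrib)

lemma gen_forms_key:
  assumes F: "\<forall>f\<in>F. is_form n f" and x: "x \<in>\<^sub>i gen F" and k: "k \<in> Poly_Mapping.keys x"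
  obtains f m l where "f \<in> F" "m \<in> Poly_Mapping.keys f" "k = m + l" "deg m = n"
proof -
  have "gen F \<le> gen (mon ` (\<Union>f\<in>F. Poly_Mapping.keys f))"
    unfolding gen_le_iff
  proof
    fix f assume "f \<in> F"
    then show "f \<in>\<^sub>i gen (mon ` (\<Union>f\<in>F. Poly_Mapping.keys f))"
      by (intro mem_of_keys[of f] gen_mem) blast
  qed
  then have "x \<in>\<^sub>i gen (mon ` (\<Union>f\<in>F. Poly_Mapping.keys f))" using x memD by blast
  then obtain m l where m: "m \<in> (\<Union>f\<in>F. Poly_Mapping.keys f)" "k = m + l" using k unfolding gen_mon_iff by blast
  then obtain f where f: "f \<in> F" "m \<in> Poly_Mapping.keys f" by blast
  then have "deg m = n" using F by (simp add: is_form_def deg_def)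
  then show thesis using that f m by blast
qed

context monomial_reduction
begin

context
  fixes n :: nat and FI :: "('v, 'k) mpoly set"
  assumes FI: "\<forall>f\<in>FI. is_form n f" and I_FI: "I = gen FI"
begin

lemma I_form_part:
  assumes "mon k \<in>\<^sub>i I" obtains m l where "k = m + l" "deg m = n" "mon m \<in>\<^sub>i I"
proof -
  obtain f m l where f: "f \<in> FI" "m \<in> Poly_Mapping.keys f" "k = m + l" "deg m = n"
    using gen_forms_key[OF FI assms[unfolded I_FI], of k] by auto
  have "f \<in>\<^sub>i I" using f(1) I_FI by blast
  then have "mon m \<in>\<^sub>i I" using f(2) monI_I unfolding monI_def by blast
  then show thesis using that f by blast
qed

text \<open>A monomial of degree \<open>n\<close> in \<open>I\<close> divides the pure power
  \<open>y v\<close>, so it is a power of the same variable. Its weight \<open>n * w v\<close> is at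
  least \<open>L\<close>, hence \<open>n\<close> cannot be smaller than \<open>a v\<close>.\<close>

lemma a_eq: "a v = n"
proof -
  have "mon (Poly_Mapping.single v (a v)) \<in>\<^sub>i I" using y_mem_I[of v] by (simp add: y_def)
  then obtain m l where m: "Poly_Mapping.single v (a v) = m + l" "deg m = n" "mon m \<in>\<^sub>i I"
    by (rule I_form_part)
  have sum: "lkp m u + lkp l u = (if u = v then a v else 0)" for u
    using arg_cong[OF m(1), of "\<lambda>p. lkp p u"] by (auto simp: lookup_add lookup_single when_def)
  have m0: "lkp m u = 0" if "u \<noteq> v" for u using sum[of u] that by simp
  have "deg m = (\<Sum>u\<in>UNIV. if u = v then lkp m v else 0)"
    unfolding deg_def by (intro sum.cong) (auto simp: m0)
  then have mv: "lkp m v = n" using m(2) by simp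
  have "wt m = (\<Sum>u\<in>UNIV. if u = v then lkp m v * w v else 0)"
    unfolding wt_def by (intro sum.cong) (auto simp: m0)
  then have "wt m = n * w v" using mv by simp
  moreover have "L \<le> wt m" using memD[OF m(3) I_le_F] by (simp add: mon_mem_V)
  ultimately have "a v * w v \<le> n * w v" by (simp add: a_w)
  then have "a v \<le> n" using w_pos[of v] by simp
  then show ?thesis using sum[of v] mv by simp
qed

lemma n_pos: "0 < n"
  using a_pos a_eq by metis

text \<open>With all \<open>a v\<close> equal, the order depends only on the degree and the residues
  modulo \<open>n\<close>. This lets residues alone control membership in powers of
  \<open>J\<close>.\<close>

lemma ord_deg: "n * ord k + (\<Sum>v\<in>UNIV. lkp k v mod n) = deg k"
  by (simp add: ord_def deg_def a_eq sum_distrib_left sum.distrib[symmetric])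

lemma I_power_form_part:
  assumes "mon k \<in>\<^sub>i I ^ m" shows "\<exists>k' l. k = k' + l \<and> deg k' = n * m \<and> mon k' \<in>\<^sub>i I ^ m"
  using assms
proof (induction m arbitrary: k)
  case 0
  show ?case by (intro exI[of _ 0] exI[of _ k]) (simp add: deg_def)
next
  case (Suc m)
  from Suc.prems obtain p q where pq: "k = p + q" "mon p \<in>\<^sub>i I" "mon q \<in>\<^sub>i I ^ m"
    by (auto simp: mon_mem_times[OF monI_I monI_power[OF monI_I]])
  obtain p' s where p': "p = p' + s" "deg p' = n" "mon p' \<in>\<^sub>i I" using pq(2) by (rule I_form_part)
  obtain q' t where q': "q = q' + t" "deg q' = n * m" "mon q' \<in>\<^sub>i I ^ m" using Suc.IH[OF pq(3)] by blast
  have "mon (p' + q') \<in>\<^sub>i I ^ Suc m" using mem_times[OF p'(3) q'(3)] by (simp add: mon_mult)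
  then show ?case
    using pq(1) p' q' by (intro exI[of _ "p' + q'"] exI[of _ "s + t"]) (simp add: add_ac)
qed

text \<open>The classes modulo \<open>n\<close> of the exponents occurring in the algebra generated by the
  degree-\<open>n\<close> part of \<open>I\<close>. An exponent of \<open>H\<close> outside these classes is separated from
  \<open>I\<close> by a monomial in the core.\<close>

definition G :: "('v \<Rightarrow>\<^sub>0 nat) \<Rightarrow> bool" where
  "G k \<longleftrightarrow> (\<exists>m k'. mon k' \<in>\<^sub>i I ^ m \<and> deg k' = n * m \<and> (\<forall>v. lkp k v mod n = lkp k' v mod n))"

lemma G_add:
  assumes "G k" "G l" shows "G (k + l)"
proof -
  from assms obtain m k' p l' where k: "mon k' \<in>\<^sub>i I ^ m" "deg k' = n * m" "\<forall>v. lkp k v mod n = lkp k' v mod n"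
    and l: "mon l' \<in>\<^sub>i I ^ p" "deg l' = n * p" "\<forall>v. lkp l v mod n = lkp l' v mod n" unfolding G_def by blast
  have "mon (k' + l') \<in>\<^sub>i I ^ (m + p)" using mem_times[OF k(1) l(1)] by (simp add: mon_mult power_add)
  moreover have "lkp (k + l) v mod n = lkp (k' + l') v mod n" for v
    using k(3) l(3) unfolding lookup_add by (metis mod_add_cong)
  ultimately show ?thesis
    unfolding G_def by (intro exI[of _ "m + p"] exI[of _ "k' + l'"]) (simp add: k l distrib_left)
qed

text \<open>\<open>b\<close> is complementary to \<open>d\<close>: the sum \<open>b + d\<close> has
  all residues equal to \<open>n - 1\<close>, the largest possible. No exponent of \<open>I\<close>
  reaches these residues with \<open>b\<close>, so everywhere else the order is larger than the
  degree alone would force.\<close>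

lemma separating_monomial:
  assumes "\<not> G d" "deg d = n"
  obtains b where "mon b \<in>\<^sub>i W I (int CARD('v))" "ord (b + d) = 1"
proof -
  obtain v0 :: 'v where True by blast
  have d: "lkp d v < n" for v
  proof (rule ccontr)
    assume "\<not> lkp d v < n"
    then have "lkp (Poly_Mapping.single v n) u \<le> lkp d u" for u by (auto simp: lookup_single when_def)
    then obtain e where e: "d = Poly_Mapping.single v n + e" by (rule pm_le_obtain)
    have "mon d \<in>\<^sub>i I ^ 1" using mon_mem_add[of _ I e] y_mem_I[of v] unfolding e by (simp add: y_def a_eq)
    then have "G d" unfolding G_def using assms(2) by (intro exI[of _ 1] exI[of _ d]) auto
    then show False using assms(1) by simp
  qed
  \<comment> \<open>The additional \<open>n\<close> at \<open>v0\<close> gives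
    \<open>b = t - d\<close> the degree \<open>CARD('v) * (n - 1)\<close> and gives \<open>t\<close>
    order exactly \<open>1\<close>.\<close>
  define t where "t = (\<Sum>v\<in>UNIV. Poly_Mapping.single v (n - 1 + (if v = v0 then n else 0)))"
  have t: "lkp t v = n - 1 + (if v = v0 then n else 0)" for v
  proof -
    have "lkp t v = (\<Sum>u\<in>UNIV. if u = v then n - 1 + (if v = v0 then n else 0) else 0)"
      unfolding t_def lookup_sum by (intro sum.cong) (auto simp: lookup_single when_def)
    then show ?thesis by simp
  qed
  have "lkp d v \<le> lkp t v" for v using d[of v] by (simp add: t)
  then obtain b where b: "t = d + b" by (rule pm_le_obtain)
  have "deg t = (\<Sum>v\<in>(UNIV :: 'v set). n - 1) + (\<Sum>v\<in>UNIV. if v = v0 then n else 0)"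
    unfolding deg_def t by (rule sum.distrib)
  then have deg_t: "deg t = CARD('v) * (n - 1) + n" by simp
  have "lkp t v div n = (if v = v0 then 1 else 0)" for v
    using n_pos div_add_self2[of n "n - 1"] by (cases "v = v0") (simp_all add: t)
  then have ord_t: "ord t = 1" by (simp add: ord_def a_eq)
  have t_mod: "lkp t v mod n = n - 1" for v
    using n_pos mod_add_self2[of "n - 1" n] by (cases "v = v0") (simp_all add: t)
  have "mon b \<in>\<^sub>i W I (int CARD('v))"
    unfolding mem_W_top le_idl mem_pr_mult mem_J_power
  proof (intro allI impI ballI, elim exE conjE)
    fix m z k x assume k: "k \<in> Poly_Mapping.keys z" and x: "x \<in>\<^sub>i I ^ m" and z: "z = mon b * x"
    from k z obtain p where p: "p \<in> Poly_Mapping.keys x" "k = b + p" by (auto simp: keys_mon_mult)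
    have "mon p \<in>\<^sub>i I ^ m" using x p(1) monI_power[OF monI_I] unfolding monI_def by blast
    then obtain p' l where p': "p = p' + l" "deg p' = n * m" "mon p' \<in>\<^sub>i I ^ m" using I_power_form_part by blast
    let ?\<rho> = "\<Sum>v\<in>UNIV. lkp (b + p') v mod n"
    have "deg (b + p') = CARD('v) * (n - 1) + n * m"
      using deg_t p'(2) assms(2) by (simp add: b)
    then have eq: "n * ord (b + p') + ?\<rho> = CARD('v) * (n - 1) + n * m"
      by (simp add: ord_deg)
    have le: "lkp (b + p') v mod n \<le> n - 1" for v
      using mod_less_divisor[OF n_pos, of "lkp (b + p') v"] by linarith
    \<comment> \<open>If all residues were \<open>n - 1\<close>, then \<open>p'\<close> and
      \<open>d\<close> would agree modulo \<open>n\<close>, making \<open>G d\<close> true. So the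
      residue sum is strictly below \<open>CARD('v) * (n - 1)\<close>, and the fixed degree forces
      the order above \<open>m\<close>.\<close>
    have "\<exists>v. lkp (b + p') v mod n < n - 1"
    proof (rule ccontr)
      assume "\<nexists>v. lkp (b + p') v mod n < n - 1"
      then have "lkp (b + p') v mod n = lkp (b + d) v mod n" for v
        using le[of v] t_mod[of v] b by (metis add.commute le_neq_implies_less)
      then have "lkp d v mod n = lkp p' v mod n" for v
        unfolding lookup_add nat_mod_eq_iff by (metis add.assoc add_left_cancel)
      then have "G d" unfolding G_def using p' by blast
      then show False using assms(1) by simp
    qed
    then have "?\<rho> < (\<Sum>v\<in>(UNIV :: 'v set). n - 1)" using le by (intro sum_strict_mono_ex1) auto
    then have "n * m < n * ord (b + p')" using eq by (simp only: sum_constant of_nat_id)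
    then have "Suc m \<le> ord (b + p')" by simp
    also have "\<dots> \<le> ord k" using superadd_ord unfolding superadd_def p(2) p'(1)
      by (metis add.assoc add_leD1)
    finally show "Suc m \<le> ord k" .
  qed
  then show thesis using that ord_t b by (simp add: add.commute)
qed

text \<open>Equality of the cores forces every exponent of a generator of \<open>H\<close> into the
  classes \<open>G\<close>. Modulo \<open>n\<close> the powers of \<open>H\<close> then contain
  nothing that powers of \<open>I\<close> do not, possibly of another degree, and
  \<open>ord_deg\<close> transfers the order bounds.\<close>

lemma W_top_le_forms:
  assumes FH: "\<forall>f\<in>FH. is_form n f" and H: "H = gen FH"
    and IH: "I \<le> H" and int: "\<And>h. h \<in>\<^sub>i H \<Longrightarrow> integral I h"
    and core: "\<And>f. (\<And>K. reduction K I \<Longrightarrow> f \<in>\<^sub>i K) \<Longrightarrow> (\<And>K. reduction K H \<Longrightarrow> f \<in>\<^sub>i K)"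
  shows "W I (int CARD('v)) \<le> W H (int CARD('v))"
proof -
  have G_FH: "G d" if h: "h \<in> FH" "d \<in> Poly_Mapping.keys h" for h d
  proof (rule ccontr)
    assume nG: "\<not> G d"
    have hH: "h \<in>\<^sub>i H" using h(1) H by blast
    have "deg d = n" using FH h by (simp add: is_form_def deg_def)
    then obtain b where b: "mon b \<in>\<^sub>i W I (int CARD('v))" "ord (b + d) = 1"
      using separating_monomial[OF nG] by blast
    \<comment> \<open>\<open>mon b\<close> lies in the core of \<open>I\<close> and therefore in
      that of \<open>H\<close>. The bound with exponent \<open>1\<close> demands order
      \<open>2\<close> at \<open>b + d\<close>, where the order is \<open>1\<close>.\<close>
    have "mon b * h ^ 1 \<in>\<^sub>i J ^ Suc 1"
    proof (rule core_bound[OF _ hH])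
      show "reduction J H" "integral J h" using reduction_of_integral_over[OF IH int] hH by blast+
      show "mon b \<in>\<^sub>i K" if "reduction K H" for K by (rule core[OF mem_W_core[OF b(1)] that])
    qed
    moreover have "b + d \<in> Poly_Mapping.keys (mon b * h)" using h(2) by (simp add: keys_mon_mult)
    ultimately have "Suc 1 \<le> ord (b + d)" unfolding power_one_right mem_J_power by blast
    then show False using b(2) by simp
  qed
  have H_power: "x \<in>\<^sub>i H ^ m \<Longrightarrow> k \<in> Poly_Mapping.keys x \<Longrightarrow> \<exists>d l. k = d + l \<and> G d \<and> deg d = n * m" for x m k
  proof (induction m arbitrary: x k)
    case 0
    have "G 0" unfolding G_def by (intro exI[of _ 0]) (simp add: deg_def)
    then show ?case by (intro exI[of _ 0] exI[of _ k]) (simp add: deg_def)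
  next
    case (Suc m)
    from Suc.prems(1)[unfolded power_Suc] Suc.prems(2) show ?case
    proof (induction arbitrary: k rule: times_induct)
      case (prod p q)
      from prod(3) obtain s t where st: "k = s + t" "s \<in> Poly_Mapping.keys p" "t \<in> Poly_Mapping.keys q"
        using keys_multD by blast
      obtain f s' l where s': "f \<in> FH" "s' \<in> Poly_Mapping.keys f" "s = s' + l" "deg s' = n"
        using gen_forms_key[OF FH prod(1)[unfolded H] st(2)] by blast
      obtain t' l' where t': "t = t' + l'" "G t'" "deg t' = n * m" using Suc.IH[OF prod(2) st(3)] by blast
      have "G (s' + t')" using G_add[OF G_FH[OF s'(1,2)] t'(2)] .
      then show ?case using st(1) s' t'
        by (intro exI[of _ "s' + t'"] exI[of _ "l + l'"]) (simp add: add_ac)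
    next
      case (add p q)
      then show ?case using keys_subsetD[of k p q] by blast
    qed
  qed
  show ?thesis
    unfolding le_idl
  proof (intro allI impI, rule mem_of_keys)
    fix f k assume "f \<in>\<^sub>i W I (int CARD('v))" "k \<in> Poly_Mapping.keys f"
    then have k: "mon k \<in>\<^sub>i W I (int CARD('v))" using monI_W[OF monI_I] unfolding monI_def by blast
    show "mon k \<in>\<^sub>i W H (int CARD('v))"
      unfolding mem_W_top le_idl mem_pr_mult mem_J_power
    proof (intro allI impI ballI, elim exE conjE)
      fix m z q x assume q: "q \<in> Poly_Mapping.keys z" and x: "x \<in>\<^sub>i H ^ m" and z: "z = mon k * x"
      from q z obtain p where p: "p \<in> Poly_Mapping.keys x" "q = k + p" by (auto simp: keys_mon_mult)
      obtain d l where d: "p = d + l" "G d" "deg d = n * m" using H_power[OF x p(1)] by blast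
      from d(2) obtain m' d' where d': "mon d' \<in>\<^sub>i I ^ m'" "deg d' = n * m'" "\<And>v. lkp d v mod n = lkp d' v mod n"
        unfolding G_def by blast
      have "mon k * mon d' \<in>\<^sub>i pr (mon k) * I ^ m'" using d'(1) by (intro mem_times) auto
      then have "mon k * mon d' \<in>\<^sub>i J ^ Suc m'" using k[unfolded mem_W_top] memD by blast
      then have ord': "Suc m' \<le> ord (k + d')" unfolding mem_J_power mon_mult by simp
      \<comment> \<open>Equal residues: the orders of \<open>k + d\<close> and \<open>k + d'\<close>
        differ by \<open>m - m'\<close>, exactly the difference of the bounds required.\<close>
      have "(\<Sum>v\<in>UNIV. lkp (k + d) v mod n) = (\<Sum>v\<in>UNIV. lkp (k + d') v mod n)"
        unfolding lookup_add using d'(3) by (intro sum.cong refl) (metis mod_add_right_eq)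
      then have "n * ord (k + d) + n * m' = n * ord (k + d') + n * m"
        using ord_deg[of "k + d"] ord_deg[of "k + d'"] d(3) d'(2) by simp
      then have "n * (ord (k + d) + m') = n * (ord (k + d') + m)" by (simp add: distrib_left)
      then have "Suc m \<le> ord (k + d)" using n_pos ord' by simp
      also have "\<dots> \<le> ord q" using superadd_ord unfolding superadd_def p(2) d(1)
        by (metis add.assoc add_leD1)
      finally show "Suc m \<le> ord q" .
    qed
  qed
qed

end

end

section \<open>Regular sequences of monomials\<close>

abbreviation pm_le :: "('v \<Rightarrow>\<^sub>0 nat) \<Rightarrow> ('v \<Rightarrow>\<^sub>0 nat) \<Rightarrow> bool" where
  "pm_le m k \<equiv> \<forall>v. lkp m v \<le> lkp k v"

lemma mon_mem_gen: "mon k \<in>\<^sub>i (gen (mon ` E) :: ('v::finite, 'k::field) mpoly idl) \<longleftrightarrow> (\<exists>m\<in>E. pm_le m k)"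
proof -
  have "(\<exists>n. k = m + n) \<longleftrightarrow> pm_le m k" for m :: "'v \<Rightarrow>\<^sub>0 nat"
    using pm_le_obtain[of m k] by (auto simp: lookup_add)
  then show ?thesis by (simp add: gen_mon_iff)
qed

lemma pm_le_zero: "pm_le m 0 \<Longrightarrow> m = 0"
  by (rule poly_mapping_eqI) simp

lemma pm_le_single:
  assumes "pm_le m (Poly_Mapping.single v c)" shows "m = Poly_Mapping.single v (lkp m v)"
proof (rule poly_mapping_eqI)
  fix u show "lkp m u = lkp (Poly_Mapping.single v (lkp m v)) u"
    using assms[rule_format, of u] by (cases "u = v") (auto simp: lookup_single when_def)
qed

context
  fixes ms :: "('v::finite \<Rightarrow>\<^sub>0 nat) list"
  assumes nz: "0 \<notin> set ms"
    and reg: "\<And>i e. i < length ms \<Longrightarrow> \<exists>p<i. pm_le (ms ! p) (ms ! i + e) \<Longrightarrow> \<exists>p<i. pm_le (ms ! p) e"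
begin

text \<open>An earlier member dividing a later one makes regularity produce a member equal to
  \<open>1\<close>. If \<open>ms ! l\<close> divides an earlier \<open>ms ! j\<close>, regularity
  applied to the quotient \<open>e\<close> yields a divisor of \<open>ms ! j\<close> with index
  below \<open>l\<close>, and descent ends in the first case or in
  \<open>ms ! l = 0\<close>.\<close>

lemma regular_no_divisor:
  assumes "l < length ms" "j < length ms" "l \<noteq> j" shows "\<not> pm_le (ms ! l) (ms ! j)"
proof -
  have less_case: False if lj: "l < j" "j < length ms" "pm_le (ms ! l) (ms ! j)" for l j
  proof -
    have "\<exists>p<j. pm_le (ms ! p) (ms ! j + 0)" using lj by auto
    then obtain p where p: "p < j" "pm_le (ms ! p) 0" using reg[of j 0] lj(2) by blast
    then have "0 \<in> set ms" using nth_mem[of p ms] pm_le_zero[OF p(2)] lj(2) by simp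
    then show False using nz by simp
  qed
  have greater: "j < l \<Longrightarrow> l < length ms \<Longrightarrow> pm_le (ms ! l) (ms ! j) \<Longrightarrow> False" for l
  proof (induction l rule: less_induct)
    case (less l)
    obtain e where e: "ms ! j = ms ! l + e" using pm_le_obtain less.prems(3) by metis
    then have "\<exists>p<l. pm_le (ms ! p) (ms ! l + e)" using less.prems(1) by (intro exI[of _ j]) simp
    then obtain p where p: "p < l" "pm_le (ms ! p) e" using reg[of l e] less.prems(2) by blast
    then have pj: "pm_le (ms ! p) (ms ! j)" using e by (simp add: lookup_add trans_le_add2)
    consider "p < j" | "p = j" | "j < p" by linarith
    then show False
    proof cases
      case 1
      show False by (rule less_case[OF 1 assms(2) pj])
    next
      case 2
      then have "pm_le (ms ! l) 0" using p(2) e by (auto simp: lookup_add)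
      then have "ms ! l = 0" by (rule pm_le_zero)
      then show False using nz nth_mem[OF less.prems(2)] by simp
    next
      case 3
      show False by (rule less.IH[OF p(1) 3 _ pj]) (use p(1) less.prems(2) in simp)
    qed
  qed
  show ?thesis using less_case greater assms by (meson nat_neq_iff)
qed

text \<open>Each variable contributes a pure power. A further member involving \<open>v\<close>
  would share a factor with the pure power of \<open>v\<close>, and regularity would then produce
  one member dividing another.\<close>

lemma regular_pure_powers:
  assumes pure: "\<And>v. \<exists>c. \<exists>m\<in>set ms. pm_le m (Poly_Mapping.single v c)"
  obtains a where "\<And>v. 0 < a v" "set ms = range (\<lambda>v. Poly_Mapping.single v (a v))"
proof -
  have "\<exists>a>0. Poly_Mapping.single v a \<in> set ms" for v
  proof -
    from pure[of v] obtain m c where m: "m \<in> set ms" "pm_le m (Poly_Mapping.single v c)" by blast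
    then have mv: "m = Poly_Mapping.single v (lkp m v)" by (intro pm_le_single)
    moreover have "lkp m v \<noteq> 0" using mv m(1) nz by (metis single_zero)
    ultimately show ?thesis using m(1) by (metis gr0I)
  qed
  then obtain a where a: "\<And>v. 0 < a v" "\<And>v. Poly_Mapping.single v (a v) \<in> set ms" by metis
  have "ms ! j \<in> range (\<lambda>v. Poly_Mapping.single v (a v))" if j: "j < length ms" for j
  proof (rule ccontr)
    assume nr: "ms ! j \<notin> range (\<lambda>v. Poly_Mapping.single v (a v))"
    have "ms ! j \<noteq> 0" using nz nth_mem[OF j] by metis
    then obtain v where v: "lkp (ms ! j) v \<noteq> 0" by (metis lookup_zero poly_mapping_eqI)
    obtain i where i: "i < length ms" "ms ! i = Poly_Mapping.single v (a v)"
      using a(2)[of v] by (metis in_set_conv_nth)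
    have "i \<noteq> j" using i(2) nr by auto
    then consider "i < j" | "j < i" by linarith
    then show False
    proof cases
      case 1
      \<comment> \<open>One variable factor of \<open>ms ! j\<close> supplies what the power
        \<open>a v - 1\<close> lacks; regularity then gives a member dividing this smaller power,
        hence properly dividing \<open>ms ! i\<close>.\<close>
      have "pm_le (ms ! i) (ms ! j + Poly_Mapping.single v (a v - 1))"
        using v by (auto simp: i(2) lookup_add lookup_single when_def)
      then obtain l where l: "l < j" "pm_le (ms ! l) (Poly_Mapping.single v (a v - 1))"
        using reg[OF j] 1 by blast
      have "pm_le (ms ! l) (ms ! i)"
      proof
        fix u show "lkp (ms ! l) u \<le> lkp (ms ! i) u"
          using l(2)[rule_format, of u] by (auto simp: i(2) lookup_single when_def split: if_splits)
      qed
      moreover have "l \<noteq> i" using l(2)[rule_format, of v] a(1)[of v] by (auto simp: i(2))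
      ultimately show False using regular_no_divisor[of l i] l(1) i(1) j by simp
    next
      case 2
      have "lkp (Poly_Mapping.single v 1) u \<le> lkp (ms ! j) u" for u
        using v by (auto simp: lookup_single when_def)
      then obtain e where e: "ms ! j = Poly_Mapping.single v 1 + e" by (rule pm_le_obtain)
      \<comment> \<open>The pure power supplies the factor removed from \<open>ms ! j\<close>;
        regularity gives a member dividing the quotient \<open>e\<close>, hence dividing
        \<open>ms ! j\<close>.\<close>
      have "pm_le (ms ! j) (ms ! i + e)"
        using a(1)[of v] by (auto simp: i(2) e lookup_add lookup_single when_def)
      then obtain l where l: "l < i" "pm_le (ms ! l) e" using reg[OF i(1)] 2 by blast
      have "l \<noteq> j" using l(2)[rule_format, of v] by (auto simp: e lookup_add)
      moreover have "pm_le (ms ! l) (ms ! j)" using l(2) by (simp add: e lookup_add trans_le_add2)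
      ultimately show False using regular_no_divisor[of l j] l(1) i(1) j by simp
    qed
  qed
  then have "set ms = range (\<lambda>v. Poly_Mapping.single v (a v))"
    using a(2) by (auto simp: in_set_conv_nth)
  then show thesis using that a(1) by blast
qed

end

section \<open>Zero-dimensional monomial ideals\<close>

lemma lookup_mult_unique:
  fixes x y :: "('v::finite, 'k::field) mpoly"
  assumes "\<And>l n. l \<in> Poly_Mapping.keys x \<Longrightarrow> n \<in> Poly_Mapping.keys y \<Longrightarrow> p + q = l + n \<Longrightarrow> l = p"
  shows "lkp (x * y) (p + q) = lkp x p * lkp y q"
proof -
  define x' where "x' = x - Poly_Mapping.single p (lkp x p)"
  have lx': "lkp x' k = (if k = p then 0 else lkp x k)" for k
    by (simp add: x'_def lookup_minus lookup_single when_def)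
  have "p + q \<notin> Poly_Mapping.keys (x' * y)"
  proof
    assume "p + q \<in> Poly_Mapping.keys (x' * y)"
    then obtain l n where l: "p + q = l + n" "l \<in> Poly_Mapping.keys x'" "n \<in> Poly_Mapping.keys y"
      using keys_multD by blast
    then have "l \<noteq> p" "l \<in> Poly_Mapping.keys x" by (auto simp: in_keys_iff lx' split: if_splits)
    then show False using assms l by blast
  qed
  moreover have "x * y = Poly_Mapping.single p (lkp x p) * y + x' * y"
    by (simp add: x'_def algebra_simps)
  ultimately show ?thesis by (simp add: lookup_add lookup_single_mult in_keys_iff)
qed

definition var_idl :: "'v::finite set \<Rightarrow> ('v, 'k::field) mpoly idl" where
  "var_idl A = gen (mon ` {k. \<exists>w\<in>A. lkp k w \<noteq> 0})"

lemma mem_var_idl: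
  fixes f :: "('v::finite, 'k::field) mpoly"
  shows "f \<in>\<^sub>i var_idl A \<longleftrightarrow> (\<forall>k\<in>Poly_Mapping.keys f. \<exists>w\<in>A. lkp k w \<noteq> 0)"
proof -
  have "mon k \<in>\<^sub>i (var_idl A :: ('v, 'k) mpoly idl) \<longleftrightarrow> (\<exists>w\<in>A. lkp k w \<noteq> 0)" for k
    unfolding var_idl_def mon_mem_gen
  proof
    assume "\<exists>m\<in>{k. \<exists>w\<in>A. lkp k w \<noteq> 0}. pm_le m k"
    then obtain m w where "w \<in> A" "lkp m w \<noteq> 0" "lkp m w \<le> lkp k w" by blast
    then show "\<exists>w\<in>A. lkp k w \<noteq> 0" by (intro bexI[of _ w]) auto
  qed blast
  then show ?thesis
    using monI_mem_iff[OF monI_gen, of f "{k. \<exists>w\<in>A. lkp k w \<noteq> 0}"] by (simp add: var_idl_def)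
qed

text \<open>With at most one variable outside \<open>A\<close>, the terms free of \<open>A\<close>
  are ordered by the exponent of \<open>v\<close>. The lowest such terms of \<open>x\<close> and
  \<open>y\<close> multiply without cancellation.\<close>

lemma var_idl_prime:
  fixes x y :: "('v::finite, 'k::field) mpoly"
  assumes A: "- A \<subseteq> {v}" and xy: "x * y \<in>\<^sub>i var_idl A"
  shows "x \<in>\<^sub>i var_idl A \<or> y \<in>\<^sub>i var_idl A"
proof (rule ccontr)
  have least: "\<exists>p. (p \<in> Poly_Mapping.keys z \<and> (\<forall>w\<in>A. lkp p w = 0)) \<and>
      (\<forall>l. l \<in> Poly_Mapping.keys z \<and> (\<forall>w\<in>A. lkp l w = 0) \<longrightarrow> lkp p v \<le> lkp l v)"
    if z: "\<not> z \<in>\<^sub>i var_idl A" for z :: "('v, 'k) mpoly"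
  proof -
    obtain k where "k \<in> Poly_Mapping.keys z \<and> (\<forall>w\<in>A. lkp k w = 0)" using z unfolding mem_var_idl by blast
    then show ?thesis by (rule ex_has_least_nat)
  qed
  assume "\<not> (x \<in>\<^sub>i var_idl A \<or> y \<in>\<^sub>i var_idl A)"
  then obtain p q where p: "p \<in> Poly_Mapping.keys x" "\<forall>w\<in>A. lkp p w = 0"
      "\<And>l. l \<in> Poly_Mapping.keys x \<Longrightarrow> \<forall>w\<in>A. lkp l w = 0 \<Longrightarrow> lkp p v \<le> lkp l v"
    and q: "q \<in> Poly_Mapping.keys y" "\<forall>w\<in>A. lkp q w = 0"
      "\<And>l. l \<in> Poly_Mapping.keys y \<Longrightarrow> \<forall>w\<in>A. lkp l w = 0 \<Longrightarrow> lkp q v \<le> lkp l v"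
    using least[of x] least[of y] by blast
  have "lkp (x * y) (p + q) = lkp x p * lkp y q"
  proof (rule lookup_mult_unique)
    fix l n assume ln: "l \<in> Poly_Mapping.keys x" "n \<in> Poly_Mapping.keys y" "p + q = l + n"
    have sum: "lkp p w + lkp q w = lkp l w + lkp n w" for w
      using arg_cong[OF ln(3), of "\<lambda>k. lkp k w"] by (simp add: lookup_add)
    have A0: "lkp l w = 0 \<and> lkp n w = 0" if "w \<in> A" for w using sum[of w] p(2) q(2) that by simp
    then have "lkp p v \<le> lkp l v" "lkp q v \<le> lkp n v" using p(3)[OF ln(1)] q(3)[OF ln(2)] by blast+
    then have lv: "lkp l v = lkp p v" using sum[of v] by simp
    show "l = p"
    proof (rule poly_mapping_eqI)
      fix w show "lkp l w = lkp p w" using A A0[of w] p(2) lv by (cases "w \<in> A") auto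
    qed
  qed
  then have "p + q \<in> Poly_Mapping.keys (x * y)" using p(1) q(1) by (simp add: in_keys_iff)
  then obtain w where "w \<in> A" "lkp (p + q) w \<noteq> 0" using xy unfolding mem_var_idl by blast
  then show False using p(2) q(2) by (simp add: lookup_add)
qed

section \<open>Prime ideals of the quotient ring and dimension zero\<close>

lemma coset_eq_iff:
  fixes I :: "'a::comm_ring_1 idl"
  shows "elts I +>\<^bsub>ring_of_type_algebra\<^esub> x = elts I +>\<^bsub>ring_of_type_algebra\<^esub> y \<longleftrightarrow> x - y \<in>\<^sub>i I"
proof -
  have mem: "z \<in> elts I +>\<^bsub>ring_of_type_algebra\<^esub> x \<longleftrightarrow> z - x \<in>\<^sub>i I" for z x :: 'a
    unfolding a_r_coset_def' mem_def by (auto simp: eq_diff_eq[symmetric]) (metis diff_add_cancel)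
  show ?thesis
  proof
    assume "elts I +>\<^bsub>ring_of_type_algebra\<^esub> x = elts I +>\<^bsub>ring_of_type_algebra\<^esub> y"
    then show "x - y \<in>\<^sub>i I" using mem[of x x] mem[of x y] by simp
  next
    assume xy: "x - y \<in>\<^sub>i I"
    show "elts I +>\<^bsub>ring_of_type_algebra\<^esub> x = elts I +>\<^bsub>ring_of_type_algebra\<^esub> y"
    proof (rule Set.set_eqI, unfold mem)
      fix z
      have "z - x = (z - y) - (x - y)" "z - y = (z - x) + (x - y)" by simp_all
      then show "z - x \<in>\<^sub>i I \<longleftrightarrow> z - y \<in>\<^sub>i I" using xy by (metis mem_add mem_diff)
    qed
  qed
qed

lemma coset_image_iff:
  assumes "I \<le> P"
  shows "elts I +>\<^bsub>ring_of_type_algebra\<^esub> x \<in> (+>\<^bsub>ring_of_type_algebra\<^esub>) (elts I) ` elts P \<longleftrightarrow> x \<in>\<^sub>i P"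
proof
  assume "elts I +>\<^bsub>ring_of_type_algebra\<^esub> x \<in> (+>\<^bsub>ring_of_type_algebra\<^esub>) (elts I) ` elts P"
  then obtain p where p: "p \<in>\<^sub>i P" "x - p \<in>\<^sub>i I" by (auto simp: coset_eq_iff mem_def)
  have "x = (x - p) + p" by simp
  then show "x \<in>\<^sub>i P" using p memD[OF _ assms] by (metis mem_add)
qed (simp add: mem_def)

lemma primeideal_quotient:
  fixes I P :: "'a::comm_ring_1 idl"
  assumes IP: "I \<le> P" and P1: "\<not> 1 \<in>\<^sub>i P" and prime: "\<And>x y. x * y \<in>\<^sub>i P \<Longrightarrow> x \<in>\<^sub>i P \<or> y \<in>\<^sub>i P"
  shows "primeideal ((+>\<^bsub>ring_of_type_algebra\<^esub>) (elts I) ` elts P) (ring_of_type_algebra Quot elts I)"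
proof -
  interpret R: cring "ring_of_type_algebra :: 'a ring" by (rule cring_from_type_algebra)
  have carrier: "carrier (ring_of_type_algebra Quot elts I) = range ((+>\<^bsub>ring_of_type_algebra\<^esub>) (elts I))"
    unfolding FactRing_def A_RCOSETS_def' by auto
  show ?thesis
  proof (rule primeidealI)
    show "ideal ((+>\<^bsub>ring_of_type_algebra\<^esub>) (elts I) ` elts P) (ring_of_type_algebra Quot elts I)"
      by (rule R.ring_ideal_imp_quot_ideal) simp_all
    show "cring (ring_of_type_algebra Quot elts I)"
      by (rule ideal.quotient_is_cring[OF ideal_rta_elts R.cring_axioms])
    show "carrier (ring_of_type_algebra Quot elts I) \<noteq> (+>\<^bsub>ring_of_type_algebra\<^esub>) (elts I) ` elts P"
      using coset_image_iff[OF IP, of 1] P1 unfolding carrier by blast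
    fix a b assume "a \<in> carrier (ring_of_type_algebra Quot elts I)" "b \<in> carrier (ring_of_type_algebra Quot elts I)"
    then obtain x y where xy: "a = elts I +>\<^bsub>ring_of_type_algebra\<^esub> x" "b = elts I +>\<^bsub>ring_of_type_algebra\<^esub> y"
      unfolding carrier by blast
    have "a \<otimes>\<^bsub>ring_of_type_algebra Quot elts I\<^esub> b = elts I +>\<^bsub>ring_of_type_algebra\<^esub> (x * y)"
      unfolding xy FactRing_def
      using ideal.rcoset_mult_add[OF ideal_rta_elts[of I], of x y] by simp
    moreover assume "a \<otimes>\<^bsub>ring_of_type_algebra Quot elts I\<^esub> b \<in> (+>\<^bsub>ring_of_type_algebra\<^esub>) (elts I) ` elts P"
    ultimately have "x * y \<in>\<^sub>i P" using coset_image_iff[OF IP] by metis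
    then show "a \<in> (+>\<^bsub>ring_of_type_algebra\<^esub>) (elts I) ` elts P \<or> b \<in> (+>\<^bsub>ring_of_type_algebra\<^esub>) (elts I) ` elts P"
      unfolding xy coset_image_iff[OF IP] by (rule prime)
  qed
qed

lemma krull_dim_ge_1:
  fixes I P Q :: "'a::comm_ring_1 idl"
  assumes "I \<le> P" "P \<le> Q" "\<not> Q \<le> P" "\<not> 1 \<in>\<^sub>i Q"
    and "\<And>x y. x * y \<in>\<^sub>i P \<Longrightarrow> x \<in>\<^sub>i P \<or> y \<in>\<^sub>i P" "\<And>x y. x * y \<in>\<^sub>i Q \<Longrightarrow> x \<in>\<^sub>i Q \<or> y \<in>\<^sub>i Q"
  shows "1 \<le> krull_dim (ring_of_type_algebra Quot elts I)"
proof -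
  define S where "S T = (+>\<^bsub>ring_of_type_algebra\<^esub>) (elts I) ` elts T" for T
  have "primeideal (S P) (ring_of_type_algebra Quot elts I)"
    unfolding S_def by (rule primeideal_quotient) (use assms memD in blast)+
  moreover have "primeideal (S Q) (ring_of_type_algebra Quot elts I)"
    unfolding S_def by (rule primeideal_quotient) (use assms in \<open>blast intro: order_trans\<close>)+
  moreover have "S P \<subset> S Q"
  proof -
    obtain x where x: "x \<in>\<^sub>i Q" "\<not> x \<in>\<^sub>i P" using assms(3) by (auto simp: le_idl)
    have "elts I +>\<^bsub>ring_of_type_algebra\<^esub> x \<in> S Q" "elts I +>\<^bsub>ring_of_type_algebra\<^esub> x \<notin> S P"
      using x coset_image_iff[OF assms(1)] coset_image_iff[OF order_trans[OF assms(1,2)]] unfolding S_def by blast+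
    moreover have "S P \<subseteq> S Q" using assms(2) by (auto simp: S_def elts_le_iff[symmetric])
    ultimately show ?thesis by blast
  qed
  ultimately have "(\<forall>i\<le>1. primeideal (if i = 0 then S P else S Q) (ring_of_type_algebra Quot elts I)) \<and>
      (\<forall>i<1. (if i = 0 then S P else S Q) \<subset> (if Suc i = 0 then S P else S Q))" for i :: nat by simp
  then have "(1::nat) \<in> {n. \<exists>P :: nat \<Rightarrow> 'a set set.
     (\<forall>i\<le>n. primeideal (P i) (ring_of_type_algebra Quot elts I)) \<and> (\<forall>i<n. P i \<subset> P (Suc i))}"
    by (intro CollectI exI[of _ "\<lambda>i. if i = 0 then S P else S Q"]) auto
  from SUP_upper[OF this, of "\<lambda>n. ereal (real n)"] show ?thesis
    unfolding krull_dim_def by (simp add: one_ereal_def)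
qed

text \<open>Without a power of the variable \<open>v\<close>, every monomial generator involves
  another variable. The ideal then lies in the prime generated by the other variables, which is
  properly contained in the prime of all variables, a chain of length one.\<close>

lemma pure_power_mem:
  fixes E :: "('v::finite \<Rightarrow>\<^sub>0 nat) set"
  assumes dim: "krull_dim ((mpoly_ring :: ('v, 'k::field) mpoly ring) Quot elts (gen (mon ` E))) = 0"
  shows "\<exists>c. mon (Poly_Mapping.single v c) \<in>\<^sub>i (gen (mon ` E) :: ('v, 'k) mpoly idl)"
proof (rule ccontr)
  assume nc: "\<nexists>c. mon (Poly_Mapping.single v c) \<in>\<^sub>i (gen (mon ` E) :: ('v, 'k) mpoly idl)"
  let ?P = "var_idl (- {v}) :: ('v, 'k) mpoly idl" and ?Q = "var_idl UNIV :: ('v, 'k) mpoly idl"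
  have "1 \<le> krull_dim ((mpoly_ring :: ('v, 'k) mpoly ring) Quot elts (gen (mon ` E)))"
  proof (rule krull_dim_ge_1)
    show "gen (mon ` E) \<le> ?P"
      unfolding gen_le_iff ball_simps mem_var_idl
    proof (rule ballI, rule ballI)
      fix m k assume m: "m \<in> E" and "k \<in> Poly_Mapping.keys (mon m :: ('v, 'k) mpoly)"
      then have k: "k = m" by simp
      show "\<exists>w\<in>- {v}. lkp k w \<noteq> 0"
      proof (rule ccontr)
        assume "\<not> (\<exists>w\<in>- {v}. lkp k w \<noteq> 0)"
        then have "k = Poly_Mapping.single v (lkp k v)"
          by (intro poly_mapping_eqI) (auto simp: lookup_single when_def)
        then show False using nc m k gen_mem[of "mon m :: ('v, 'k) mpoly" "mon ` E"] by (metis imageI)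
      qed
    qed
    show "?P \<le> ?Q" by (auto simp: le_idl mem_var_idl)
    have "mon (Poly_Mapping.single v 1) \<in>\<^sub>i ?Q" "\<not> mon (Poly_Mapping.single v 1) \<in>\<^sub>i ?P"
      by (auto simp: mem_var_idl lookup_single when_def)
    then show "\<not> ?Q \<le> ?P" using memD by blast
    show "\<not> 1 \<in>\<^sub>i ?Q" by (simp add: mem_var_idl)
    show "x \<in>\<^sub>i ?P \<or> y \<in>\<^sub>i ?P" if "x * y \<in>\<^sub>i ?P" for x y by (rule var_idl_prime[OF _ that, of v]) simp
    show "x \<in>\<^sub>i ?Q \<or> y \<in>\<^sub>i ?Q" if "x * y \<in>\<^sub>i ?Q" for x y by (rule var_idl_prime[OF _ that, of v]) simp
  qed
  then show False using dim by simp
qed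

text \<open>Dimension zero puts pure powers into \<open>I\<close>, and
  \<open>I ^ Suc r \<le> J\<close> moves them into \<open>J\<close>. On monomials, ideal membership
  is divisibility, so regularity becomes a statement about exponent vectors.\<close>

lemma obtain_power_ideal:
  fixes E :: "('v::finite \<Rightarrow>\<^sub>0 nat) set"
  defines "I \<equiv> gen (mon ` E) :: ('v, 'k::field) mpoly idl"
  assumes dim: "krull_dim (mpoly_ring Quot elts I) = 0" and red: "reduction (gen (set fs)) I"
    and fs: "set fs \<subseteq> monomials" "regular_sequence mpoly_ring fs"
  obtains a where "\<And>v. 0 < a v" "gen (set fs) = (\<Sum>v\<in>UNIV. pr (mon (Poly_Mapping.single v (a v))))"
proof -
  have "\<exists>ms. fs = map mon ms" using fs(1) unfolding ex_map_conv monomials_def by blast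
  then obtain ms where ms: "fs = map mon ms" ..
  have set_fs: "set fs = mon ` set ms" and take_fs: "set (take i fs) = mon ` set (take i ms)" for i
    by (simp_all add: ms take_map)
  have J1: "\<not> 1 \<in>\<^sub>i gen (set fs)"
  proof
    assume "1 \<in>\<^sub>i gen (set fs)"
    then have "1 * x \<in>\<^sub>i gen (set fs)" for x by (rule mem_mult_right)
    then have "elts (gen (set fs)) = UNIV" by (auto simp: mem_def)
    then show False using fs(2) by (simp add: regular_sequence_def Idl_rta)
  qed
  obtain r where r: "I ^ Suc r = gen (set fs) * I ^ r" using red by (auto simp: reduction_def)
  then have IJ: "I ^ Suc r \<le> gen (set fs)" by (simp add: idl_mult_le1)
  have pure_I: "\<exists>c. mon (Poly_Mapping.single v c) \<in>\<^sub>i I" for v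
    using pure_power_mem[of E v] dim unfolding I_def by blast
  have "0 \<notin> set ms"
  proof
    assume "0 \<in> set ms"
    then have "mon 0 \<in>\<^sub>i gen (set fs)" unfolding set_fs by blast
    then show False using J1 by simp
  qed
  moreover have "\<exists>p<i. pm_le (ms ! p) e"
    if i: "i < length ms" and p: "\<exists>p<i. pm_le (ms ! p) (ms ! i + e)" for i e
  proof -
    have take: "(\<exists>p<i. pm_le (ms ! p) k) \<longleftrightarrow> (mon k :: ('v, 'k) mpoly) \<in>\<^sub>i gen (set (take i fs))" for k
      unfolding take_fs mon_mem_gen using i by (simp add: nth_image[symmetric] Bex_def)
    have "fs ! i * mon e \<in>\<^sub>i gen (set (take i fs))"
      using p i unfolding take by (simp add: ms mon_mult)
    moreover have "fs ! i * b \<in>\<^sub>i gen (set (take i fs)) \<longrightarrow> b \<in>\<^sub>i gen (set (take i fs))" for b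
      using fs(2) i unfolding regular_sequence_def Idl_rta by (simp add: ms mem_def)
    ultimately show ?thesis unfolding take by blast
  qed
  moreover have "\<exists>c. \<exists>m\<in>set ms. pm_le m (Poly_Mapping.single v c)" for v
  proof -
    obtain c where c: "mon (Poly_Mapping.single v c) \<in>\<^sub>i I" using pure_I by blast
    have "mon (Poly_Mapping.single v c) ^ n = (mon (Poly_Mapping.single v (n * c)) :: ('v, 'k) mpoly)" for n
      by (induction n) (simp_all add: mult_single single_add[symmetric])
    then have "mon (Poly_Mapping.single v (Suc r * c)) \<in>\<^sub>i gen (set fs)"
      using memD[OF mem_power[OF c] IJ] by metis
    then show ?thesis unfolding set_fs mon_mem_gen by blast
  qed
  ultimately obtain a where a: "\<And>v. 0 < a v" "set ms = range (\<lambda>v. Poly_Mapping.single v (a v))"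
    by (rule regular_pure_powers[of ms]) blast+
  have "gen (set fs) = gen ((\<lambda>v. mon (Poly_Mapping.single v (a v))) ` UNIV)"
    unfolding set_fs a(2) by (simp add: image_image)
  also have "\<dots> = (\<Sum>v\<in>UNIV. pr (mon (Poly_Mapping.single v (a v))))"
    by (rule gen_image_finite) simp
  finally show thesis by (rule that[OF a(1)])
qed

theorem corollary4p9:
  fixes I J :: "('v::finite, 'k::field) mpoly set"
  assumes "infinite (UNIV :: 'k set)"
    and "monomial_ideal I"
    and "I \<noteq> {0}"
    and "krull_dim (mpoly_ring Quot I) = 0"
    and "is_reduction mpoly_ring J I"
    and "\<exists>fs. set fs \<subseteq> monomials \<and> regular_sequence mpoly_ring fs \<and>
           J = Idl\<^bsub>mpoly_ring\<^esub> (set fs)"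
  shows "(\<forall>H. integral_over mpoly_ring H I \<longrightarrow> core mpoly_ring H = core mpoly_ring I \<longrightarrow>
            (\<exists>n. generated_by_forms n H \<and> generated_by_forms n I) \<or> CHAR('k) = 0 \<longrightarrow>
            omega_rees J H = omega_rees J I) \<and>
         (CHAR('k) = 0 \<longrightarrow>
            integral_over mpoly_ring (check_ideal J I) I \<and>
            core mpoly_ring (check_ideal J I) = core mpoly_ring I \<and>
            (\<forall>H. integral_over mpoly_ring H I \<longrightarrow> core mpoly_ring H = core mpoly_ring I \<longrightarrow>
              H \<subseteq> check_ideal J I))"
proof -
  obtain M where M: "M \<subseteq> monomials" "I = elts (gen M)"
    using assms(2) by (auto simp: monomial_ideal_def Idl_rta)
  obtain E :: "('v \<Rightarrow>\<^sub>0 nat) set" where E: "M = mon ` E"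
    using M(1) unfolding monomials_def subset_image_iff by blast
  define I' :: "('v, 'k) mpoly idl" where "I' = gen (mon ` E)"
  have I: "I = elts I'" by (simp add: M(2) E I'_def)
  obtain fs where fs: "set fs \<subseteq> monomials" "regular_sequence mpoly_ring fs" "J = elts (gen (set fs))"
    using assms(6) by (auto simp: Idl_rta)
  have red: "reduction (gen (set fs)) I'"
    using assms(5) unfolding fs(3) I is_reduction_rta .
  obtain a where a: "\<And>v. 0 < a v" "gen (set fs) = (\<Sum>v\<in>UNIV. pr (mon (Poly_Mapping.single v (a v)))) "
    using obtain_power_ideal[OF assms(4)[unfolded I I'_def] red[unfolded I'_def] fs(1,2)] by blast
  define J' where "J' = gen (set fs)"
  interpret monomial_reduction a J' I'
    by unfold_locales (use assms(1) a red in \<open>simp_all add: J'_def I'_def monI_gen\<close>)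
  have J: "J = elts J'" by (simp add: fs(3) J'_def)
  have over: "integral_over mpoly_ring (elts H) I \<longleftrightarrow> I' \<le> H \<and> (\<forall>h. h \<in>\<^sub>i H \<longrightarrow> integral I' h)" for H
    unfolding integral_over_def I elts_le_iff by (auto simp: integral_closure_rta mem_def)
  have core: "core mpoly_ring (elts H) = core mpoly_ring I \<longleftrightarrow>
      (\<forall>f. (\<forall>K. reduction K H \<longrightarrow> f \<in>\<^sub>i K) \<longleftrightarrow> (\<forall>K. reduction K I' \<longrightarrow> f \<in>\<^sub>i K))" for H
    unfolding I set_eq_iff mem_core_rta ..
  \<comment> \<open>Only here do the alternatives of (a), forms of one degree or characteristic
    zero, require different arguments.\<close>
  have top: "W I' (int CARD('v)) \<le> W H (int CARD('v))"
    if H: "integral_over mpoly_ring (elts H) I" "core mpoly_ring (elts H) = core mpoly_ring I"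
      and alt: "(\<exists>n. generated_by_forms n (elts H) \<and> generated_by_forms n I) \<or> CHAR('k) = 0" for H
  proof -
    have IH: "I' \<le> H" and int: "\<And>h. h \<in>\<^sub>i H \<Longrightarrow> integral I' h" using H(1) over by blast+
    have core': "\<And>f K. (\<And>K. reduction K I' \<Longrightarrow> f \<in>\<^sub>i K) \<Longrightarrow> reduction K H \<Longrightarrow> f \<in>\<^sub>i K"
      using H(2) unfolding core by blast
    from alt show ?thesis
    proof (elim disjE exE conjE)
      assume "CHAR('k) = 0"
      then show ?thesis by (rule W_top_le[OF _ IH int core'])
    next
      fix n assume "generated_by_forms n (elts H)" "generated_by_forms n I"
      then obtain FH FI where "\<forall>f\<in>FH. is_form n f" "H = gen FH" "\<forall>f\<in>FI. is_form n f" "I' = gen FI"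
        unfolding generated_by_forms_def Idl_rta I elts_inject by blast
      then show ?thesis using W_top_le_forms[of FI n FH H] IH int core' by blast
    qed
  qed
  show ?thesis
  proof (intro conjI allI impI)
    fix Y
    assume Y: "integral_over mpoly_ring Y I" "core mpoly_ring Y = core mpoly_ring I"
      and alt: "(\<exists>n. generated_by_forms n Y \<and> generated_by_forms n I) \<or> CHAR('k) = 0"
    obtain H where H: "Y = elts H" using Y(1) ideal_rtaE unfolding integral_over_def by blast
    have "I' \<le> H" using Y(1) over H by blast
    then show "omega_rees J Y = omega_rees J I"
      unfolding H J I using top Y alt H by (intro omega_eq[OF monI_I]) blast+
  next
    show "integral_over mpoly_ring (check_ideal J I) I"
      unfolding J I check_ideal_elts unfolding I[symmetric] over using I_le_check_idl integral_check_idl by blast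
  next
    assume "CHAR('k) = 0"
    then show "core mpoly_ring (check_ideal J I) = core mpoly_ring I"
      unfolding J I check_ideal_elts unfolding I[symmetric] core using core_check_idl by blast
  next
    fix Y
    assume char: "CHAR('k) = 0"
      and Y: "integral_over mpoly_ring Y I" "core mpoly_ring Y = core mpoly_ring I"
    obtain H where H: "Y = elts H" using Y(1) ideal_rtaE unfolding integral_over_def by blast
    have "I' \<le> H" using Y(1) over H by blast
    then have "H \<le> check_idl" using top Y char H by (intro le_check_idl) blast+
    then show "Y \<subseteq> check_ideal J I" unfolding H J I check_ideal_elts elts_le_iff .
  qed
qed

end
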